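(* Let $n\ge1$ be an integer, $m\ge1$, $\sigma\ge1$ and $0\le\sigma_1<\sigma/2<\sigma_2\le\sigma$ be real numbers, and let $\varepsilon>0$. Assume that $u_0\equiv0$ and that $u_1\in L^m(\mathbb{R}^n)$ satisfies $$\int_{\mathbb{R}^n}u_1(x)\,dx>0\ \text{ if } m=1,\qquad\text{or}\qquad u_1(x)\ge\langle x\rangle^{-\frac nm}\big(\log(e+|x|)\big)^{-1}\ \text{ if } m>1.$$ Moreover, assume that the exponent $p$ and the spatial dimension $n$ fulfill $$1<p\begin{cases}<\infty & \text{if } m\ge1 \text{ and } n\le 2m\sigma_1,\\ \le 1+\dfrac{2\sigma}{n-2\sigma_1} & \text{if } m=1\text{ and } n>2\sigma_1,\\ <1+\dfrac{2m\sigma}{n-2m\sigma_1} & \text{if } m>1\text{ and } n>2m\sigma_1.\end{cases}$$ Then there is no global (in time) weak solution $u\in\mathcal{C}([0,\infty),L^2)$ to the Cauchy problem $$\begin{cases} u_{tt}+(-\Delta)^\sigma u+(-\Delta)^{\sigma_1}u_t+(-\Delta)^{\sigma_2}u_t=|u|^p, & x\in\mathbb{R}^n,\ t>0,\\ u(0,x)=\varepsilon u_0(x),\quad u_t(0,x)=\varepsilon u_1(x), & x\in\mathbb{R}^n.\end{cases}$$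
   Context: Here $\langle x\rangle=(1+|x|^2)^{1/2}$, and $(-\Delta)^{a}\psi=\mathfrak{F}^{-1}(|\xi|^{2a}\mathfrak{F}(\psi)(\xi))$ with $\mathfrak{F}$ the Fourier transform in $x$. Weak solution (for $u_0\equiv 0$, $p>1$, $T>0$): $u\in\mathcal{C}([0,T),L^2)$ is a local weak solution if for all test functions $\phi(t,x)=\eta(t)\varphi(x)$, with $\eta\in\mathcal{C}_0^\infty([0,T))$ and $\varphi\in\mathcal{C}^\infty(\mathbb{R}^n)$ having all derivatives in $L^1\cap L^\infty$, it holds $$\int_0^T\!\!\int_{\mathbb{R}^n}|u(t,x)|^p\phi(t,x)\,dx\,dt+\varepsilon\int_{\mathbb{R}^n}u_1(x)\phi(0,x)\,dx=\int_0^T\!\!\int_{\mathbb{R}^n}u(t,x)\Big(\partial_t^2-\partial_t(-\Delta)^{\sigma_1}-\partial_t(-\Delta)^{\sigma_2}+(-\Delta)^\sigma\Big)\phi(t,x)\,dx\,dt.$$ If $T=\infty$, $u$ is called a global weak solution. *)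

theory Defs
  imports "HOL-Analysis.Analysis"
begin

definition Lp_fun :: "real \<Rightarrow> (real^'n \<Rightarrow> 'b::{banach, second_countable_topology}) \<Rightarrow> bool" where
  "Lp_fun q f \<longleftrightarrow>
     f \<in> borel_measurable lebesgue \<and> integrable lebesgue (\<lambda>x. norm (f x) powr q)"

definition Lp_norm :: "real \<Rightarrow> (real^'n \<Rightarrow> 'b::{banach, second_countable_topology}) \<Rightarrow> real" where
  "Lp_norm q f = (LINT x|lebesgue. norm (f x) powr q) powr (1 / q)"

definition japanese_bracket :: "real^'n \<Rightarrow> real" where
  "japanese_bracket x = (1 + (norm x)\<^sup>2) powr (1 / 2)"


definition fourier :: "(real^'n \<Rightarrow> complex) \<Rightarrow> real^'n \<Rightarrow> complex" where
  "fourier f \<xi> = (2 * pi) powr (- real CARD('n) / 2) *\<^sub>R (LINT x|lebesgue. cis (- (x \<bullet> \<xi>)) * f x)"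

definition inverse_fourier :: "(real^'n \<Rightarrow> complex) \<Rightarrow> real^'n \<Rightarrow> complex" where
  "inverse_fourier g x = (2 * pi) powr (- real CARD('n) / 2) *\<^sub>R (LINT \<xi>|lebesgue. cis (x \<bullet> \<xi>) * g \<xi>)"

(* The Lebesgue integrals are meaningful for the test functions below: if all derivatives of f
   are integrable, then fourier f decays faster than any power, so the symbol times fourier f is
   integrable.  For a = 0 the symbol is 1 except at the origin, where 0 powr 0 = 0;
   this does not affect the integral, so the operator is then the identity on test functions. *)
definition frac_laplacian :: "real \<Rightarrow> (real^'n \<Rightarrow> complex) \<Rightarrow> real^'n \<Rightarrow> complex" where
  "frac_laplacian a f =
     inverse_fourier (\<lambda>\<xi>. complex_of_real (norm \<xi> powr (2 * a)) * fourier f \<xi>)"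


primrec iter_partial :: "'n list \<Rightarrow> (real^'n \<Rightarrow> real) \<Rightarrow> real^'n \<Rightarrow> real" where
  "iter_partial [] f = f"
| "iter_partial (k # ks) f = (\<lambda>x. frechet_derivative (iter_partial ks f) (at x) (axis k 1))"

(* Every iterated partial derivative is Frechet differentiable everywhere, which is C-infinity.
   As the derivatives are continuous, boundedness of the range is membership in L-infinity. *)
definition space_test_fun :: "(real^'n \<Rightarrow> real) \<Rightarrow> bool" where
  "space_test_fun \<phi> \<longleftrightarrow>
     (\<forall>ks. (\<forall>x. iter_partial ks \<phi> differentiable (at x)) \<and>
           integrable lebesgue (iter_partial ks \<phi>) \<and>
           bounded (range (iter_partial ks \<phi>)))"

definition time_interval :: "ereal \<Rightarrow> real set" where
  "time_interval T = {t. 0 \<le> t \<and> ereal t < T}"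

(* Smooth functions on [0,T) with compact support in [0,T), which need not vanish near t = 0.
   Smoothness up to t = 0 is expressed by taking \<eta> to be (extended to) a smooth function on the
   whole line; its values at negative times play no role. *)
definition time_test_fun :: "ereal \<Rightarrow> (real \<Rightarrow> real) \<Rightarrow> bool" where
  "time_test_fun T \<eta> \<longleftrightarrow>
     (\<forall>k t. (deriv ^^ k) \<eta> field_differentiable (at t)) \<and>
     (\<exists>K. compact K \<and> K \<subseteq> time_interval T \<and> (\<forall>t\<ge>0. t \<notin> K \<longrightarrow> \<eta> t = 0))"


(* Curves in C([0,T), L^2).  An L^2-valued continuous curve is given by a representative;
   it can always be chosen jointly measurable in (t,x), so that space-time integrals make sense. *)
definition continuous_L2_curve :: "ereal \<Rightarrow> (real \<Rightarrow> real^'n \<Rightarrow> complex) \<Rightarrow> bool" where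
  "continuous_L2_curve T u \<longleftrightarrow>
     (\<lambda>(t, x). u t x) \<in> borel_measurable (lebesgue_on (time_interval T \<times> UNIV)) \<and>
     (\<forall>t\<in>time_interval T. Lp_fun 2 (u t)) \<and>
     (\<forall>t\<in>time_interval T.
        ((\<lambda>s. Lp_norm 2 (\<lambda>x. u s x - u t x)) \<longlongrightarrow> 0) (at t within time_interval T))"

definition time_deriv ::
    "(real \<Rightarrow> real^'n \<Rightarrow> complex) \<Rightarrow> real \<Rightarrow> real^'n \<Rightarrow> complex" where
  "time_deriv \<psi> t x = vector_derivative (\<lambda>s. \<psi> s x) (at t)"

definition adjoint_operator ::
    "real \<Rightarrow> real \<Rightarrow> real \<Rightarrow> (real \<Rightarrow> real^'n \<Rightarrow> complex) \<Rightarrow> real \<Rightarrow> real^'n \<Rightarrow> complex" where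
  "adjoint_operator \<sigma> \<sigma>\<^sub>1 \<sigma>\<^sub>2 \<psi> t x =
     time_deriv (time_deriv \<psi>) t x
     - time_deriv (\<lambda>s. frac_laplacian \<sigma>\<^sub>1 (\<psi> s)) t x
     - time_deriv (\<lambda>s. frac_laplacian \<sigma>\<^sub>2 (\<psi> s)) t x
     + frac_laplacian \<sigma> (\<psi> t) x"

(* Weak solutions on [0,T) of
     u_tt + (-Delta)^\<sigma> u + (-Delta)^\<sigma>\<^sub>1 u_t + (-Delta)^\<sigma>\<^sub>2 u_t = |u|^p,  u(0) = 0,  u_t(0) = \<epsilon> u1.
   Since u(t) is only known to lie in L^2, integrability of |u|^p times the test function has to be
   part of the definition: the Bochner integral of a non-integrable function is 0 by convention.
   The other two integrands are integrable for every u1 in some L^m with m >= 1 and every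
   continuous L^2-valued curve u. *)
definition weak_solution ::
    "ereal \<Rightarrow> real \<Rightarrow> real \<Rightarrow> real \<Rightarrow> real \<Rightarrow> real \<Rightarrow> (real^'n \<Rightarrow> real) \<Rightarrow>
     (real \<Rightarrow> real^'n \<Rightarrow> complex) \<Rightarrow> bool" where
  "weak_solution T \<sigma> \<sigma>\<^sub>1 \<sigma>\<^sub>2 p \<epsilon> u1 u \<longleftrightarrow>
     continuous_L2_curve T u \<and>
     (\<forall>\<eta> \<phi>. time_test_fun T \<eta> \<longrightarrow> space_test_fun \<phi> \<longrightarrow>
        (let \<psi> = (\<lambda>t x. complex_of_real (\<eta> t * \<phi> x));
             Q = lebesgue_on (time_interval T \<times> UNIV)
         in integrable Q (\<lambda>(t, x). complex_of_real (norm (u t x) powr p) * \<psi> t x) \<and>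
            (LINT (t, x)|Q. complex_of_real (norm (u t x) powr p) * \<psi> t x)
              + complex_of_real \<epsilon> * (LINT x|lebesgue. complex_of_real (u1 x) * \<psi> 0 x)
            = (LINT (t, x)|Q. u t x * adjoint_operator \<sigma> \<sigma>\<^sub>1 \<sigma>\<^sub>2 \<psi> t x)))"

definition global_weak_solution ::
    "real \<Rightarrow> real \<Rightarrow> real \<Rightarrow> real \<Rightarrow> real \<Rightarrow> (real^'n \<Rightarrow> real) \<Rightarrow>
     (real \<Rightarrow> real^'n \<Rightarrow> complex) \<Rightarrow> bool" where
  "global_weak_solution = weak_solution \<infinity>"

end

theory Submission
  imports Defs "HOL-Probability.Probability" "HOL-Real_Asymp.Real_Asymp"
begin

text \<open>
  The weak formulation is tested with \<open>\<eta>(t / T) \<phi>(x / R)\<close>, where \<open>T\<close> is \<open>R\<close> to the power \<open>2(\<sigma> - \<sigma>\<^sub>1)\<close>,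
  \<open>\<eta>\<close> vanishes to infinite order at the end of its support, so that \<open>\<eta>'\<close> and \<open>\<eta>''\<close> are
  dominated by \<open>\<eta>\<close> to the power \<open>1/p\<close>, and \<open>\<phi>(x) = (1 + |x|\<^sup>2)\<close> to the power \<open>-q\<close> with
  \<open>q = n/2 + b\<close> and a small \<open>b > 0\<close>. The tail of \<open>\<phi>\<close> is so heavy that \<open>|(-\<Delta>)\<^sup>s \<phi>| \<le> C \<phi>\<close> for
  the three exponents in the equation. To see this, write \<open>\<phi>\<close> as a mixture of Gaussians with Gamma
  weights. The fractional Laplacian of a Gaussian is bounded by \<open>(\<theta> + |x|\<^sup>2)\<close> to the power
  \<open>-n/2 - s\<close>: for an integer \<open>s\<close> by differentiating the heat kernel in time, in general by
  writing \<open>|\<xi>|\<^sup>-\<^sup>2\<^sup>c\<close> with \<open>c = \<lceil>s\<rceil> - s\<close> as a Gamma integral.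

  Young's inequality then bounds \<open>\<epsilon> \<integral> u\<^sub>1 \<phi>(x/R)\<close> by a multiple of \<open>R\<close> to the power
  \<open>n - 2\<sigma>\<^sub>1 - 2\<sigma>/(p-1)\<close>. For \<open>m > 1\<close> the left-hand side grows faster. For \<open>m = 1\<close> the bound
  is uniform in \<open>R\<close>, so \<open>|u|\<^sup>p\<close> is integrable in space-time; the dual factors are then bounded in
  the dual Lebesgue space and tend to 0 pointwise, hence weakly, which also covers the critical exponent.
\<close>

subsection \<open>Gaussian and Gamma integrals\<close>

text \<open>The choice of \<open>T\<close> balances the lower damping against the elliptic term:
  T^(-1) R^(-2 sigma_1) = R^(-2 sigma). As sigma_1 < sigma/2 and sigma_1 < sigma_2, the second time
  derivative and the upper damping contribute less for R >= 1, so all four terms are O(R^(-2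
  sigma)). The obstacle is that (-Delta)^s is nonlocal: for noninteger s it turns a compactly
  supported phi into a function whose tail is in general of order |x|^(-n-2s), and no multiple of
  phi dominates that. A phi with the tail |x|^(-n-2b) survives as long as b is at most every
  positive exponent s of the equation, while b > 0 keeps phi integrable. The price is that nothing
  is localised near |x| = R, so the usual argument at the critical exponent, by integrals over
  receding annuli, has no direct counterpart; the weak convergence of the dual factors takes its
  place. Gaussians are used because they can be followed explicitly through both Fourier transforms,
  and because the weights of the mixture are positive, so that pointwise bounds for each Gaussian
  pass to phi.\<close>

lemma powr_le_exp:
  fixes M c :: real
  assumes "M \<ge> 0" "c > 0"
  shows "\<exists>C>0. \<forall>z\<ge>0. z powr M \<le> C * exp (c * z)"
proof (cases "M = 0")
  case True
  then show ?thesis using assms by (intro exI[of _ 1]) auto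
next
  case False
  then have M: "M > 0" using assms by simp
  \<comment> \<open>This is (M/c)^M; it comes from ln y <= y - 1 at y = c z / M.\<close>
  define C where "C = exp (- M * ln (c / M))"
  have "z powr M \<le> C * exp (c * z)" if "z \<ge> 0" for z
  proof (cases "z = 0")
    case True then show ?thesis by (simp add: C_def)
  next
    case False
    then have z: "z > 0" using that by simp
    have "ln (c / M * z) \<le> c / M * z - 1" using z M assms by (intro ln_le_minus_one) auto
    then have "ln z \<le> c / M * z - ln (c / M)" using z M assms by (simp add: ln_mult ln_div)
    then have "M * ln z \<le> M * (c / M * z - ln (c / M))" using M by simp
    also have "\<dots> = c * z - M * ln (c / M)" using M by (simp add: field_simps)
    finally have "exp (M * ln z) \<le> exp (c * z - M * ln (c / M))" by simp
    then show ?thesis using z by (simp add: powr_def C_def exp_diff exp_minus field_simps)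
  qed
  then show ?thesis by (intro exI[of _ C]) (auto simp: C_def)
qed

lemma has_bochner_integral_Gamma:
  fixes b \<mu> :: real
  assumes "b > 0" "\<mu> > 0"
  shows "has_bochner_integral lborel (\<lambda>t. indicator {0<..} t * (t powr (b - 1) * exp (- (\<mu> * t))))
           (Gamma b / \<mu> powr b)"
proof -
  have "ennreal (Gamma b) = (\<integral>\<^sup>+ t. ennreal (indicator {0..} t * t powr (b - 1) / exp t) \<partial>lborel)"
    using Gamma_conv_nn_integral_real[OF assms(1)] by simp
  also have "\<dots> = ennreal \<mu> * (\<integral>\<^sup>+ t. ennreal (indicator {0..} (\<mu> * t) * (\<mu> * t) powr (b - 1) / exp (\<mu> * t)) \<partial>lborel)"
    using assms(2) by (subst nn_integral_real_affine[where c = \<mu> and t = 0]) auto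
  also have "(\<integral>\<^sup>+ t. ennreal (indicator {0..} (\<mu> * t) * (\<mu> * t) powr (b - 1) / exp (\<mu> * t)) \<partial>lborel) =
     (\<integral>\<^sup>+ t. ennreal (\<mu> powr (b - 1)) * ennreal (indicator {0<..} t * (t powr (b - 1) * exp (- (\<mu> * t)))) \<partial>lborel)"
    by (intro nn_integral_cong)
       (use assms in \<open>auto simp: indicator_def powr_mult exp_minus field_simps zero_le_mult_iff
          simp flip: ennreal_mult'' intro!: arg_cong[where f = ennreal]\<close>)
  also have "\<dots> = ennreal (\<mu> powr (b - 1)) * (\<integral>\<^sup>+ t. ennreal (indicator {0<..} t * (t powr (b - 1) * exp (- (\<mu> * t)))) \<partial>lborel)"
    by (intro nn_integral_cmult) auto
  also have "ennreal \<mu> * (ennreal (\<mu> powr (b - 1)) * (\<integral>\<^sup>+ t. ennreal (indicator {0<..} t * (t powr (b - 1) * exp (- (\<mu> * t)))) \<partial>lborel))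
     = ennreal (\<mu> powr b) * (\<integral>\<^sup>+ t. ennreal (indicator {0<..} t * (t powr (b - 1) * exp (- (\<mu> * t)))) \<partial>lborel)"
    using assms by (simp add: mult.assoc[symmetric] ennreal_mult''[symmetric] powr_diff)
  finally have eq: "ennreal (Gamma b) = ennreal (\<mu> powr b) * (\<integral>\<^sup>+ t. ennreal (indicator {0<..} t * (t powr (b - 1) * exp (- (\<mu> * t)))) \<partial>lborel)" .
  have "ennreal (1 / \<mu> powr b) * ennreal (Gamma b) = (ennreal (1 / \<mu> powr b) * ennreal (\<mu> powr b)) * (\<integral>\<^sup>+ t. ennreal (indicator {0<..} t * (t powr (b - 1) * exp (- (\<mu> * t)))) \<partial>lborel)"
    by (simp add: eq mult.assoc)
  also have "ennreal (1 / \<mu> powr b) * ennreal (\<mu> powr b) = 1"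
    using assms by (simp flip: ennreal_mult'')
  finally have "(\<integral>\<^sup>+ t. ennreal (indicator {0<..} t * (t powr (b - 1) * exp (- (\<mu> * t)))) \<partial>lborel) = ennreal (Gamma b / \<mu> powr b)"
    using assms by (simp add: ennreal_mult''[symmetric] Gamma_real_pos less_imp_le)
  then show ?thesis
    using assms by (intro has_bochner_integral_nn_integral) (auto simp: Gamma_real_pos less_imp_le)
qed

text \<open>A rescaling of the characteristic function of the standard normal law. With
  \<open>a * s\<close> in place of \<open>s\<close> its density has the exponent
  \<open>- (\<theta> * s\<^sup>2)\<close>, which fixes \<open>a\<close>.\<close>

lemma has_bochner_integral_gaussian_1d:
  fixes x \<theta> :: real
  assumes "\<theta> > 0"
  shows "has_bochner_integral lborel (\<lambda>s. cis (x * s) * of_real (exp (- (\<theta> * s\<^sup>2))))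
           (of_real (sqrt (pi / \<theta>) * exp (- (x\<^sup>2 / (4 * \<theta>)))))"
proof -
  define a where "a = sqrt (2 * \<theta>)"
  have a: "a > 0" "a\<^sup>2 = 2 * \<theta>" using assms by (auto simp: a_def)
  have eq: "std_normal_density (0 + a * s) *\<^sub>R cis (x / a * (0 + a * s)) =
      (1 / sqrt (2 * pi)) *\<^sub>R (cis (x * s) * of_real (exp (- (\<theta> * s\<^sup>2))))" for s
    using a by (simp add: std_normal_density_def power_mult_distrib scaleR_conv_of_real)
  have "integrable lborel (\<lambda>s. std_normal_density s *\<^sub>R cis (x / a * s))"
    by (rule Bochner_Integration.integrable_bound[OF integrable_normal_moment[of 1 0 0]])
       (auto simp: norm_mult cis_conv_exp)
  from lborel_integrable_real_affine[OF this, of a 0] a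
  have "integrable lborel (\<lambda>s. (1 / sqrt (2 * pi)) *\<^sub>R (cis (x * s) * of_real (exp (- (\<theta> * s\<^sup>2)))))"
    unfolding eq by blast
  from integrable_scaleR_right[OF this, of "sqrt (2 * pi)"]
  have int: "integrable lborel (\<lambda>s. cis (x * s) * of_real (exp (- (\<theta> * s\<^sup>2))))"
    unfolding scaleR_scaleR by simp
  have "of_real (exp (- ((x / a)\<^sup>2) / 2)) = (CLINT s|density lborel std_normal_density. cis (x / a * s))"
    using fun_cong[OF char_std_normal_distribution, of "x / a"] by (simp add: char_def cis_conv_exp)
  also have "\<dots> = (CLINT s|lborel. std_normal_density s *\<^sub>R cis (x / a * s))"
    by (intro integral_density) (auto simp: cis_conv_exp)
  also have "\<dots> = a *\<^sub>R (CLINT s|lborel. std_normal_density (0 + a * s) *\<^sub>R cis (x / a * (0 + a * s)))"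
    using a by (subst lborel_integral_real_affine[where c = a and t = 0]) auto
  also have "\<dots> = a *\<^sub>R (CLINT s|lborel. (1 / sqrt (2 * pi)) *\<^sub>R (cis (x * s) * of_real (exp (- (\<theta> * s\<^sup>2)))))"
    unfolding eq ..
  also have "\<dots> = (a / sqrt (2 * pi)) *\<^sub>R (CLINT s|lborel. cis (x * s) * of_real (exp (- (\<theta> * s\<^sup>2))))"
    by simp
  finally have "(CLINT s|lborel. cis (x * s) * of_real (exp (- (\<theta> * s\<^sup>2)))) =
     (sqrt (2 * pi) / a) *\<^sub>R of_real (exp (- ((x / a)\<^sup>2) / 2))"
    using a by (simp add: scaleR_conv_of_real field_simps)
  also have "\<dots> = of_real (sqrt (pi / \<theta>) * exp (- (x\<^sup>2 / (4 * \<theta>))))"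
    using a assms by (simp add: scaleR_conv_of_real power_divide a_def real_sqrt_divide real_sqrt_mult)
  finally show ?thesis using int by (simp add: has_bochner_integral_iff)
qed

text \<open>In an orthonormal basis the phase and the Gaussian both factor into functions of single
  coordinates, and \<open>lborel\<close> is the image of a product measure.\<close>

lemma has_bochner_integral_gaussian:
  fixes x :: "'a::euclidean_space" and \<theta> :: real
  assumes "\<theta> > 0"
  shows "has_bochner_integral lborel (\<lambda>\<xi>::'a. cis (x \<bullet> \<xi>) * of_real (exp (- (\<theta> * (norm \<xi>)\<^sup>2))))
           (of_real ((pi / \<theta>) powr (DIM('a) / 2) * exp (- ((norm x)\<^sup>2 / (4 * \<theta>)))))"
proof -
  interpret product_sigma_finite "\<lambda>_::'a. lborel :: real measure" ..
  define f where "f b s = cis ((x \<bullet> b) * s) * complex_of_real (exp (- (\<theta> * s\<^sup>2)))" for b s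
  have f: "has_bochner_integral lborel (f b) (of_real (sqrt (pi / \<theta>) * exp (- ((x \<bullet> b)\<^sup>2 / (4 * \<theta>)))))" for b
    unfolding f_def by (rule has_bochner_integral_gaussian_1d[OF assms])
  have eq: "cis (x \<bullet> (\<Sum>b\<in>Basis. g b *\<^sub>R b)) * of_real (exp (- (\<theta> * (norm (\<Sum>b\<in>Basis. g b *\<^sub>R b))\<^sup>2)))
      = (\<Prod>b\<in>Basis. f b (g b))" for g :: "'a \<Rightarrow> real"
  proof -
    have 1: "(norm (\<Sum>b\<in>Basis. g b *\<^sub>R b))\<^sup>2 = (\<Sum>b\<in>Basis. (g b)\<^sup>2)"
      by (simp add: norm_sum_Pythagorean pairwise_def inner_not_same_Basis power_mult_distrib orthogonal_def)
    have 2: "x \<bullet> (\<Sum>b\<in>Basis. g b *\<^sub>R b) = (\<Sum>b\<in>Basis. (x \<bullet> b) * g b)"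
      by (simp add: inner_sum_right mult.commute)
    show ?thesis
      unfolding 1 2 f_def prod.distrib cis_conv_exp
      by (simp add: exp_sum sum_distrib_left sum_negf[symmetric] of_real_prod exp_of_real[symmetric] del: exp_of_real)
  qed
  have I: "(\<integral>g. (\<Prod>b\<in>Basis. f b (g b)) \<partial>(\<Pi>\<^sub>M b\<in>Basis. lborel)) =
     (\<Prod>b\<in>(Basis::'a set). of_real (sqrt (pi / \<theta>) * exp (- ((x \<bullet> b)\<^sup>2 / (4 * \<theta>)))))"
    using f by (subst product_integral_prod) (auto simp: has_bochner_integral_iff)
  have J: "integrable (\<Pi>\<^sub>M b\<in>(Basis::'a set). lborel) (\<lambda>g. (\<Prod>b\<in>Basis. f b (g b)))"
    using f by (intro product_integrable_prod) (auto simp: has_bochner_integral_iff)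
  have "(\<Prod>b\<in>(Basis::'a set). sqrt (pi / \<theta>) * exp (- ((x \<bullet> b)\<^sup>2 / (4 * \<theta>)))) =
     (pi / \<theta>) powr (DIM('a) / 2) * exp (- ((norm x)\<^sup>2 / (4 * \<theta>)))"
  proof -
    have "(norm x)\<^sup>2 = (\<Sum>b\<in>Basis. (x \<bullet> b)\<^sup>2)"
      unfolding power2_norm_eq_inner by (subst euclidean_inner) (simp add: power2_eq_square)
    moreover have "sqrt (pi / \<theta>) ^ DIM('a) = (pi / \<theta>) powr (DIM('a) / 2)"
      using assms by (simp add: powr_half_sqrt[symmetric] powr_realpow[symmetric] powr_powr)
    ultimately show ?thesis
      by (simp add: prod.distrib exp_sum sum_negf[symmetric] sum_divide_distrib)
  qed
  note K = this
  have m: "(\<lambda>\<xi>::'a. cis (x \<bullet> \<xi>) * of_real (exp (- (\<theta> * (norm \<xi>)\<^sup>2)))) \<in> borel_measurable borel"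
    unfolding cis_conv_exp by measurable
  show ?thesis
    unfolding has_bochner_integral_iff
    using I[unfolded of_real_prod[symmetric] K] J m
    by (subst (1 2) lborel_eq) (simp add: integrable_distr_eq integral_distr eq)
qed

lemma nn_integral_Gamma:
  fixes b \<mu> :: real
  assumes "b > 0" "\<mu> > 0"
  shows "(\<integral>\<^sup>+ t. ennreal (indicator {0<..} t * (t powr (b - 1) * exp (- (\<mu> * t)))) \<partial>lborel) = ennreal (Gamma b / \<mu> powr b)"
  using has_bochner_integral_Gamma[OF assms]
  by (subst nn_integral_eq_integral) (auto simp: has_bochner_integral_iff)

text \<open>The power of \<open>A + t\<close> is itself a Gamma integral in a second variable
  \<open>z\<close>; after exchanging the order, the integral in \<open>t\<close> is again of Gamma
  type, and so is the remaining one in \<open>z\<close>. It serves to integrate a decay rate over a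
  shift \<open>t\<close>.\<close>

lemma has_bochner_integral_Beta:
  fixes c N A :: real
  assumes "0 < c" "c < N" "A > 0"
  shows "has_bochner_integral lborel (\<lambda>t. indicator {0<..} t * (t powr (c - 1) * (A + t) powr (- N)))
           (Beta c (N - c) * A powr (c - N))"
proof -
  define F where "F t z = indicator {0<..} t * indicator {0<..} z *
    (t powr (c - 1) * z powr (N - 1) * exp (- ((A + t) * z))) / Gamma N" for t z :: real
  have N: "N > 0" "Gamma N > 0" using assms by (auto intro: Gamma_real_pos)
  have N0: "inverse (Gamma N) * Gamma N = 1" using N(2) by simp
  have F[measurable]: "(\<lambda>(t, z). F t z) \<in> borel_measurable (lborel \<Otimes>\<^sub>M lborel)"
    unfolding F_def by measurable
  have 1: "(\<integral>\<^sup>+ z. ennreal (F t z) \<partial>lborel) = ennreal (indicator {0<..} t * (t powr (c - 1) * (A + t) powr (- N)))" for t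
  proof (cases "t > 0")
    case True
    have "(\<integral>\<^sup>+ z. ennreal (F t z) \<partial>lborel) = (\<integral>\<^sup>+ z. ennreal (t powr (c - 1) / Gamma N) *
        ennreal (indicator {0<..} z * (z powr (N - 1) * exp (- ((A + t) * z)))) \<partial>lborel)"
      using True N by (intro nn_integral_cong) (auto simp: F_def ennreal_mult''[symmetric] indicator_def)
    also have "\<dots> = ennreal (t powr (c - 1) / Gamma N) * ennreal (Gamma N / (A + t) powr N)"
      using True assms N by (subst nn_integral_cmult, simp, subst nn_integral_Gamma) auto
    also have "\<dots> = ennreal (indicator {0<..} t * (t powr (c - 1) * (A + t) powr (- N)))"
      using True N N0 by (subst ennreal_mult''[symmetric]) (auto simp: powr_minus divide_inverse)
    finally show ?thesis .
  qed (auto simp: F_def)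
  have e: "exp (- ((A + t) * z)) = exp (- (A * z)) * exp (- (z * t))" for t z
    by (simp add: exp_add[symmetric] algebra_simps)
  have 2: "(\<integral>\<^sup>+ t. ennreal (F t z) \<partial>lborel) = ennreal (Gamma c / Gamma N) *
      ennreal (indicator {0<..} z * (z powr ((N - c) - 1) * exp (- (A * z))))" for z
  proof (cases "z > 0")
    case True
    have "(\<integral>\<^sup>+ t. ennreal (F t z) \<partial>lborel) = (\<integral>\<^sup>+ t. ennreal (z powr (N - 1) * exp (- (A * z)) / Gamma N) *
        ennreal (indicator {0<..} t * (t powr (c - 1) * exp (- (z * t)))) \<partial>lborel)"
      using True N unfolding F_def e by (intro nn_integral_cong)
        (auto simp: ennreal_mult''[symmetric] indicator_def mult_ac)
    also have "\<dots> = ennreal (z powr (N - 1) * exp (- (A * z)) / Gamma N) * ennreal (Gamma c / z powr c)"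
      using True assms N by (subst nn_integral_cmult, simp, subst nn_integral_Gamma) auto
    also have "\<dots> = ennreal (z powr (N - 1) * exp (- (A * z)) / Gamma N * (Gamma c / z powr c))"
      using assms by (subst ennreal_mult''[symmetric]) (auto simp: Gamma_real_pos less_imp_le)
    also have "z powr (N - 1) * exp (- (A * z)) / Gamma N * (Gamma c / z powr c) =
       (Gamma c / Gamma N) * (indicator {0<..} z * (z powr ((N - c) - 1) * exp (- (A * z))))"
      using True by (simp add: powr_diff powr_add field_simps)
    also have "ennreal \<dots> = ennreal (Gamma c / Gamma N) *
      ennreal (indicator {0<..} z * (z powr ((N - c) - 1) * exp (- (A * z))))"
      by (subst ennreal_mult'') auto
    finally show ?thesis .
  qed (auto simp: F_def)
  have "(\<integral>\<^sup>+ t. ennreal (indicator {0<..} t * (t powr (c - 1) * (A + t) powr (- N))) \<partial>lborel) =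
     (\<integral>\<^sup>+ t. (\<integral>\<^sup>+ z. ennreal (F t z) \<partial>lborel) \<partial>lborel)"
    unfolding 1 ..
  also have "\<dots> = (\<integral>\<^sup>+ z. (\<integral>\<^sup>+ t. ennreal (F t z) \<partial>lborel) \<partial>lborel)"
    using lborel_pair.Fubini'[of "\<lambda>t z. ennreal (F t z)"] by (simp add: case_prod_unfold)
  also have "\<dots> = ennreal (Gamma c / Gamma N) * (\<integral>\<^sup>+ z. ennreal (indicator {0<..} z * (z powr ((N - c) - 1) * exp (- (A * z)))) \<partial>lborel)"
    unfolding 2 by (intro nn_integral_cmult) auto
  also have "\<dots> = ennreal (Gamma c / Gamma N) * ennreal (Gamma (N - c) / A powr (N - c))"
    using assms by (subst nn_integral_Gamma) auto
  also have "\<dots> = ennreal (Gamma c / Gamma N * (Gamma (N - c) / A powr (N - c)))"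
    using assms by (subst ennreal_mult''[symmetric]) (auto simp: Gamma_real_pos less_imp_le)
  also have "Gamma c / Gamma N * (Gamma (N - c) / A powr (N - c)) = Beta c (N - c) * A powr (c - N)"
    using assms by (simp add: Beta_def powr_diff)
  finally show ?thesis
    using assms by (intro has_bochner_integral_nn_integral) (auto simp: Beta_def Gamma_real_pos less_imp_le)
qed

lemma has_bochner_integral_gaussian_real:
  fixes \<theta> :: real
  assumes "\<theta> > 0"
  shows "has_bochner_integral lborel (\<lambda>\<xi>::'a::euclidean_space. exp (- (\<theta> * (norm \<xi>)\<^sup>2))) ((pi / \<theta>) powr (DIM('a) / 2))"
proof -
  have "has_bochner_integral lborel (\<lambda>\<xi>::'a. Re (cis (0 \<bullet> \<xi>) * of_real (exp (- (\<theta> * (norm \<xi>)\<^sup>2)))))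
           (Re (of_real ((pi / \<theta>) powr (DIM('a) / 2) * exp (- ((norm (0::'a))\<^sup>2 / (4 * \<theta>))))))"
    by (intro has_bochner_integral_bounded_linear[OF bounded_linear_Re] has_bochner_integral_gaussian assms)
  then show ?thesis by simp
qed

section \<open>Fourier integrals of a power times a Gaussian\<close>

lemma norm_powr_le_exp:
  fixes s \<theta> :: real
  assumes "s \<ge> 0" "\<theta> > 0"
  shows "\<exists>C>0. \<forall>\<xi>::'a::real_normed_vector. norm \<xi> powr (2 * s) \<le> C * exp (\<theta> * (norm \<xi>)\<^sup>2)"
proof -
  have "norm \<xi> powr (2 * s) = ((norm \<xi>)\<^sup>2) powr s" for \<xi> :: 'a
    by (cases "\<xi> = 0") (auto simp: powr_powr[symmetric])
  then show ?thesis using powr_le_exp[OF assms] by auto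
qed

lemma integrable_gauss_symbol:
  fixes s \<theta> :: real
  assumes "s \<ge> 0" "\<theta> > 0"
  shows "integrable lborel (\<lambda>\<xi>::'a::euclidean_space. norm \<xi> powr (2 * s) * exp (- (\<theta> * (norm \<xi>)\<^sup>2)))"
proof -
  \<comment> \<open>Half of the Gaussian pays for the power of the norm; the other half remains
    integrable.\<close>
  obtain C where C: "C > 0" "\<And>\<xi>::'a. norm \<xi> powr (2 * s) \<le> C * exp (\<theta> / 2 * (norm \<xi>)\<^sup>2)"
    using norm_powr_le_exp[of s "\<theta> / 2", where 'a = 'a] assms by auto
  have "integrable lborel (\<lambda>\<xi>::'a. C * exp (- (\<theta> / 2 * (norm \<xi>)\<^sup>2)))"
    using has_bochner_integral_gaussian_real[of "\<theta> / 2", where 'a = 'a] assms by (auto simp: has_bochner_integral_iff)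
  then show ?thesis
  proof (rule Bochner_Integration.integrable_bound)
    show "AE \<xi>::'a in lborel. norm (norm \<xi> powr (2 * s) * exp (- (\<theta> * (norm \<xi>)\<^sup>2))) \<le> norm (C * exp (- (\<theta> / 2 * (norm \<xi>)\<^sup>2)))"
    proof (intro AE_I2)
      fix \<xi> :: 'a
      have "norm \<xi> powr (2 * s) * exp (- (\<theta> * (norm \<xi>)\<^sup>2)) \<le> C * exp (\<theta> / 2 * (norm \<xi>)\<^sup>2) * exp (- (\<theta> * (norm \<xi>)\<^sup>2))"
        by (intro mult_right_mono C) auto
      also have "\<dots> = C * exp (- (\<theta> / 2 * (norm \<xi>)\<^sup>2))"
        by (simp add: exp_add[symmetric] mult.assoc)
      finally show "norm (norm \<xi> powr (2 * s) * exp (- (\<theta> * (norm \<xi>)\<^sup>2))) \<le> norm (C * exp (- (\<theta> / 2 * (norm \<xi>)\<^sup>2)))"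
        using C(1) by (simp add: abs_mult)
    qed
  qed auto
qed

text \<open>Up to a power of 2 pi, this is (-Delta)^s applied to the heat kernel at time
  \<open>\<theta>\<close>. Each derivative in \<open>\<theta>\<close> raises \<open>s\<close> by one
  and changes the sign.\<close>

definition gauss_symbol :: "real \<Rightarrow> real \<Rightarrow> 'a::euclidean_space \<Rightarrow> complex" where
  "gauss_symbol s \<theta> x =
     (LINT \<xi>|lborel. cis (x \<bullet> \<xi>) * of_real (norm \<xi> powr (2 * s) * exp (- (\<theta> * (norm \<xi>)\<^sup>2))))"

lemma measurable_cis_inner [measurable]:
  "(\<lambda>\<xi>. cis (x \<bullet> \<xi>)) \<in> borel_measurable (borel :: 'a::euclidean_space measure)"
  unfolding cis_conv_exp by measurable

lemma integrable_cis_mult: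
  fixes f :: "'a::euclidean_space \<Rightarrow> real"
  assumes "integrable lborel f"
  shows "integrable lborel (\<lambda>\<xi>. cis (x \<bullet> \<xi>) * of_real (f \<xi>))"
  using assms(1) by (rule Bochner_Integration.integrable_bound) (use assms in \<open>auto simp: norm_mult\<close>)

lemma gauss_symbol_0:
  assumes "\<theta> > 0"
  shows "gauss_symbol 0 \<theta> (x :: 'a::euclidean_space) =
     of_real ((pi / \<theta>) powr (DIM('a) / 2) * exp (- ((norm x)\<^sup>2 / (4 * \<theta>))))"
proof -
  \<comment> \<open>The origin is removed because \<open>0 powr 0 = 0\<close>, whereas the symbol of
    order 0 is 1 everywhere else.\<close>
  have "AE \<xi>::'a in lborel. \<xi> \<noteq> 0"
    by (simp add: AE_lborel_singleton)
  then have "gauss_symbol 0 \<theta> x = (LINT \<xi>|lborel. cis (x \<bullet> \<xi>) * of_real (exp (- (\<theta> * (norm \<xi>)\<^sup>2))))"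
    unfolding gauss_symbol_def by (intro integral_cong_AE) (auto elim!: eventually_mono)
  then show ?thesis
    using has_bochner_integral_gaussian[OF assms, of x] by (simp add: has_bochner_integral_iff)
qed

text \<open>An explicit second-order remainder replaces limits of difference quotients. This serves
  both the Fourier integrals and the time cut-off at the end of its support.\<close>

lemma has_vector_derivative_quadratic_bound:
  fixes f :: "real \<Rightarrow> 'b::real_normed_vector"
  assumes "d > 0" and "\<And>h. \<bar>h\<bar> \<le> d \<Longrightarrow> norm (f (x + h) - f x - h *\<^sub>R f') \<le> C * h\<^sup>2"
  shows "(f has_vector_derivative f') (at x)"
  unfolding has_vector_derivative_def has_derivative_at
proof (intro conjI bounded_linear_scaleR_left)
  have lim: "((\<lambda>h. \<bar>C\<bar> * \<bar>h\<bar>) \<longlongrightarrow> \<bar>C\<bar> * \<bar>0\<bar>) (at (0::real))"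
    by (intro tendsto_intros)
  have "\<forall>\<^sub>F h in at 0. \<bar>h\<bar> \<le> d \<and> h \<noteq> 0"
    using assms(1) unfolding eventually_at by (intro exI[of _ d]) (auto simp: dist_real_def)
  then have "\<forall>\<^sub>F h in at 0. norm (norm (f (x + h) - f x - h *\<^sub>R f') / norm h) \<le> \<bar>C\<bar> * \<bar>h\<bar>"
  proof eventually_elim
    case (elim h)
    have "norm (f (x + h) - f x - h *\<^sub>R f') \<le> C * h\<^sup>2" using assms(2) elim by blast
    also have "\<dots> \<le> \<bar>C\<bar> * h\<^sup>2" by (intro mult_right_mono) auto
    also have "\<dots> = (\<bar>C\<bar> * \<bar>h\<bar>) * \<bar>h\<bar>" by (simp add: power2_eq_square)
    finally show ?case using elim by (simp add: divide_le_eq)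
  qed
  then show "(\<lambda>h. norm (f (x + h) - f x - h *\<^sub>R f') / norm h) \<midarrow>0\<rightarrow> 0"
    by (rule Lim_null_comparison) (use lim in simp)
qed

lemma exp_remainder_bound:
  fixes u :: real
  shows "\<bar>exp u - 1 - u\<bar> \<le> u\<^sup>2 * exp \<bar>u\<bar>"
proof -
  obtain t where t: "\<bar>t\<bar> \<le> \<bar>u\<bar>" "exp u = (\<Sum>m<2. u ^ m / fact m) + exp t / fact 2 * u ^ 2"
    using Maclaurin_exp_le[of u 2] by blast
  have "\<bar>exp u - 1 - u\<bar> = exp t / 2 * u\<^sup>2"
    unfolding t(2) by (simp add: numeral_2_eq_2)
  also have "\<dots> \<le> exp \<bar>u\<bar> * u\<^sup>2"
  proof (intro mult_right_mono)
    have "exp t \<le> exp \<bar>u\<bar>" using t(1) by simp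
    then show "exp t / 2 \<le> exp \<bar>u\<bar>" using exp_gt_zero[of t] by linarith
  qed auto
  finally show ?thesis by (simp add: mult.commute)
qed

text \<open>Differentiation under the integral: \<open>\<theta>\<close> occurs only in the
  exponential, which yields the factor -|xi|^2. For |h| <= theta/2 the remainder is at most h^2
  |xi|^4 times a Gaussian of half the rate.\<close>

lemma has_vector_derivative_gauss_symbol:
  assumes s: "s \<ge> 0" and \<theta>: "\<theta> > 0"
  shows "((\<lambda>\<theta>. gauss_symbol s \<theta> (x::'a::euclidean_space)) has_vector_derivative - gauss_symbol (s + 1) \<theta> x) (at \<theta>)"
proof (rule has_vector_derivative_quadratic_bound[where d = "\<theta> / 2"])
  fix h :: real assume h: "\<bar>h\<bar> \<le> \<theta> / 2"
  define g where "g s \<theta> \<xi> = norm \<xi> powr (2 * s) * exp (- (\<theta> * (norm \<xi>)\<^sup>2))" for s \<theta> and \<xi> :: 'a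
  have int: "integrable lborel (g s \<theta>)" if "s \<ge> 0" "\<theta> > 0" for s \<theta>
    unfolding g_def using that by (rule integrable_gauss_symbol)
  have G: "gauss_symbol s \<theta> x = (LINT \<xi>|lborel. cis (x \<bullet> \<xi>) * of_real (g s \<theta> \<xi>))" for s \<theta>
    unfolding gauss_symbol_def g_def ..
  have mul: "norm \<xi> powr (2 * (s + 1)) = norm \<xi> powr (2 * s) * (norm \<xi>)\<^sup>2" if "s \<ge> 0" for s and \<xi> :: 'a
    using that by (cases "\<xi> = 0") (auto simp: powr_add distrib_left)
  have "has_bochner_integral lborel (\<lambda>\<xi>. cis (x \<bullet> \<xi>) * of_real (g s \<theta> \<xi>)) (gauss_symbol s \<theta> x)" if "s \<ge> 0" "\<theta> > 0" for s \<theta>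
    using integrable_cis_mult[OF int[OF that]] by (simp add: has_bochner_integral_iff G)
  note hb = this
  have "has_bochner_integral lborel (\<lambda>\<xi>. cis (x \<bullet> \<xi>) * of_real (g s (\<theta> + h) \<xi>) - cis (x \<bullet> \<xi>) * of_real (g s \<theta> \<xi>)
         - h *\<^sub>R (- (cis (x \<bullet> \<xi>) * of_real (g (s + 1) \<theta> \<xi>))))
      (gauss_symbol s (\<theta> + h) x - gauss_symbol s \<theta> x - h *\<^sub>R (- gauss_symbol (s + 1) \<theta> x))"
    using s \<theta> h by (intro has_bochner_integral_diff has_bochner_integral_scaleR_right has_bochner_integral_minus hb) auto
  then have "gauss_symbol s (\<theta> + h) x - gauss_symbol s \<theta> x - h *\<^sub>R (- gauss_symbol (s + 1) \<theta> x) =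
     (LINT \<xi>|lborel. cis (x \<bullet> \<xi>) * of_real (g s (\<theta> + h) \<xi>) - cis (x \<bullet> \<xi>) * of_real (g s \<theta> \<xi>)
         - h *\<^sub>R (- (cis (x \<bullet> \<xi>) * of_real (g (s + 1) \<theta> \<xi>))))"
    by (simp add: has_bochner_integral_iff)
  also have "\<dots> = (LINT \<xi>|lborel. cis (x \<bullet> \<xi>) * of_real (g s (\<theta> + h) \<xi> - g s \<theta> \<xi> + h * g (s + 1) \<theta> \<xi>))"
    by (intro Bochner_Integration.integral_cong) (auto simp: algebra_simps scaleR_conv_of_real)
  also have "norm \<dots> \<le> (LINT \<xi>|lborel. h\<^sup>2 * g (s + 2) (\<theta> / 2) (\<xi>::'a))"
  proof (rule Bochner_Integration.integral_norm_bound_integral)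
    show "integrable lborel (\<lambda>\<xi>. cis (x \<bullet> \<xi>) * of_real (g s (\<theta> + h) \<xi> - g s \<theta> \<xi> + h * g (s + 1) \<theta> \<xi>))"
      using s \<theta> h by (intro integrable_cis_mult Bochner_Integration.integrable_add Bochner_Integration.integrable_diff int integrable_mult_right) auto
    show "integrable lborel (\<lambda>\<xi>::'a. h\<^sup>2 * g (s + 2) (\<theta> / 2) \<xi>)"
      using s \<theta> by (intro integrable_mult_right int) auto
    fix \<xi> :: 'a
    define L where "L = (norm \<xi>)\<^sup>2"
    have "L \<ge> 0" by (simp add: L_def)
    have e: "exp (- ((\<theta> + h) * L)) = exp (- (\<theta> * L)) * exp (- (h * L))"
      by (simp add: exp_add[symmetric] algebra_simps)
    have "g s (\<theta> + h) \<xi> - g s \<theta> \<xi> + h * g (s + 1) \<theta> \<xi> =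
       norm \<xi> powr (2 * s) * exp (- (\<theta> * L)) * (exp (- (h * L)) - 1 - (- (h * L)))"
      unfolding g_def mul[OF s] L_def[symmetric] e by (simp add: algebra_simps)
    then have "\<bar>g s (\<theta> + h) \<xi> - g s \<theta> \<xi> + h * g (s + 1) \<theta> \<xi>\<bar> =
       norm \<xi> powr (2 * s) * exp (- (\<theta> * L)) * \<bar>exp (- (h * L)) - 1 - (- (h * L))\<bar>"
      by (simp add: abs_mult)
    also have "\<dots> \<le> norm \<xi> powr (2 * s) * exp (- (\<theta> * L)) * ((- (h * L))\<^sup>2 * exp \<bar>- (h * L)\<bar>)"
      by (intro mult_left_mono exp_remainder_bound) auto
    also have "\<dots> \<le> norm \<xi> powr (2 * s) * exp (- (\<theta> * L)) * ((- (h * L))\<^sup>2 * exp (\<theta> / 2 * L))"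
      using h \<open>L \<ge> 0\<close> mult_right_mono[OF h \<open>L \<ge> 0\<close>] by (intro mult_left_mono) (auto simp: abs_mult)
    also have "\<dots> = h\<^sup>2 * (norm \<xi> powr (2 * s) * L * L) * (exp (- (\<theta> * L)) * exp (\<theta> / 2 * L))"
      by (simp add: power2_eq_square)
    also have "exp (- (\<theta> * L)) * exp (\<theta> / 2 * L) = exp (- (\<theta> / 2 * L))"
      by (simp add: exp_add[symmetric])
    also have "norm \<xi> powr (2 * s) * L * L = norm \<xi> powr (2 * (s + 2))"
      using mul[of s \<xi>] mul[of "s + 1" \<xi>] s by (simp add: L_def add.assoc)
    finally show "norm (cis (x \<bullet> \<xi>) * of_real (g s (\<theta> + h) \<xi> - g s \<theta> \<xi> + h * g (s + 1) \<theta> \<xi>)) \<le> h\<^sup>2 * g (s + 2) (\<theta> / 2) \<xi>"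
      by (simp add: norm_mult g_def L_def flip: of_real_mult of_real_add of_real_diff)
  qed
  also have "\<dots> = (LINT \<xi>|lborel. g (s + 2) (\<theta> / 2) (\<xi>::'a)) * h\<^sup>2"
    by simp
  finally show "norm (gauss_symbol s (\<theta> + h) x - gauss_symbol s \<theta> x - h *\<^sub>R (- gauss_symbol (s + 1) \<theta> x)) \<le>
    (LINT \<xi>|lborel. g (s + 2) (\<theta> / 2) (\<xi>::'a)) * h\<^sup>2" .
qed (use \<theta> in auto)

subsection \<open>Decay of the fractional Laplacian of Gaussians\<close>

text \<open>The functions that arise from iterated time derivatives of the heat kernel, with \<open>y = |x|\<^sup>2\<close>.\<close>

inductive heat_deriv :: "real \<Rightarrow> (real \<Rightarrow> real \<Rightarrow> real) \<Rightarrow> bool" where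
  monom: "heat_deriv N (\<lambda>\<theta> y. c * y ^ j * \<theta> powr (- N - real j) * exp (- (y / (4 * \<theta>))))"
| add: "heat_deriv N F \<Longrightarrow> heat_deriv N G \<Longrightarrow> heat_deriv N (\<lambda>\<theta> y. F \<theta> y + G \<theta> y)"

text \<open>A monomial produces two monomials, one from the power of \<open>\<theta>\<close> and one
  from the exponential; in the second \<open>j\<close> grows by one, but both have the weight
  \<open>N + 1\<close>. \<open>F'\<close> is minus the derivative, to match the sign with which
  \<open>gauss_symbol\<close> passes from \<open>s\<close> to \<open>s + 1\<close>.\<close>

lemma heat_deriv_deriv:
  assumes "heat_deriv N F"
  shows "\<exists>F'. heat_deriv (N + 1) F' \<and> (\<forall>\<theta>>0. \<forall>y. ((\<lambda>\<theta>. F \<theta> y) has_real_derivative - F' \<theta> y) (at \<theta>))"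
  using assms
proof induction
  case (monom N c j)
  define F' where "F' \<theta> y = c * (N + j) * y ^ j * \<theta> powr (- (N + 1) - real j) * exp (- (y / (4 * \<theta>)))
      + (- c / 4) * y ^ Suc j * \<theta> powr (- (N + 1) - real (Suc j)) * exp (- (y / (4 * \<theta>)))" for \<theta> y :: real
  have "heat_deriv (N + 1) F'"
    unfolding F'_def by (intro heat_deriv.intros)
  moreover have "((\<lambda>\<theta>. c * y ^ j * \<theta> powr (- N - real j) * exp (- (y / (4 * \<theta>)))) has_real_derivative - F' \<theta> y) (at \<theta>)"
    if "\<theta> > 0" for \<theta> y
  proof -
    have "\<theta> powr (- N - real j - 1) = \<theta> powr (- (N + 1) - real j)"
      "\<theta> powr (- (N + 1) - real (Suc j)) = \<theta> powr (- N - real j) / \<theta>\<^sup>2"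
      "\<theta> powr (- (N + 1) - real j) = \<theta> powr (- N - real j) / \<theta>"
      using that by (auto simp: powr_diff powr_minus powr_add field_simps power2_eq_square)
    then show ?thesis
      using that unfolding F'_def
      by (auto intro!: derivative_eq_intros simp: power2_eq_square field_simps)
  qed
  ultimately show ?case by blast
next
  case (add N F G)
  then obtain F' G' where FG: "heat_deriv (N + 1) F'" "heat_deriv (N + 1) G'"
    "\<And>\<theta> y. \<theta> > 0 \<Longrightarrow> ((\<lambda>\<theta>. F \<theta> y) has_real_derivative - F' \<theta> y) (at \<theta>)"
    "\<And>\<theta> y. \<theta> > 0 \<Longrightarrow> ((\<lambda>\<theta>. G \<theta> y) has_real_derivative - G' \<theta> y) (at \<theta>)" by blast
  then show ?case
    by (intro exI[of _ "\<lambda>\<theta> y. F' \<theta> y + G' \<theta> y"])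
       (auto intro!: heat_deriv.add derivative_eq_intros)
qed

text \<open>For a monomial put z = 1 + y/theta. Its polynomial part is at most z^(N+j) times the
  claimed power of theta + y, and exp (-y/(4 theta)) = exp ((1-z)/4) absorbs the power of z. Only z
  matters, so the constant is uniform in theta.\<close>

lemma heat_deriv_bound:
  assumes "heat_deriv N F" "N \<ge> 0"
  shows "\<exists>C\<ge>0. \<forall>\<theta>>0. \<forall>y\<ge>0. \<bar>F \<theta> y\<bar> \<le> C * (\<theta> + y) powr (- N)"
  using assms
proof induction
  case (monom N c j)
  obtain C where C: "C > 0" "\<And>z. z \<ge> 0 \<Longrightarrow> z powr (N + j) \<le> C * exp (1 / 4 * z)"
    using powr_le_exp[of "N + j" "1 / 4"] monom by auto
  define D where "D = \<bar>c\<bar> * (C * exp (1 / 4))"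
  have "\<bar>c * y ^ j * \<theta> powr (- N - real j) * exp (- (y / (4 * \<theta>)))\<bar> \<le> D * (\<theta> + y) powr (- N)"
    if "\<theta> > 0" "y \<ge> 0" for \<theta> y
  proof -
    define z where "z = 1 + y / \<theta>"
    have z: "z > 0" "\<theta> + y = \<theta> * z" using that by (auto simp: z_def field_simps intro: add_pos_nonneg)
    have "y ^ j * \<theta> powr (- N - real j) = (y / \<theta>) ^ j * \<theta> powr (- N)"
      using that by (simp add: powr_diff powr_realpow power_divide)
    also have "\<dots> \<le> z ^ j * \<theta> powr (- N)"
      using that by (intro mult_right_mono power_mono) (auto simp: z_def)
    also have "\<dots> = z powr (N + j) * (\<theta> * z) powr (- N)"
      using z that by (simp add: powr_mult powr_add powr_realpow powr_minus)
    also have "\<dots> \<le> C * exp (1 / 4 * z) * (\<theta> * z) powr (- N)"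
      using z by (intro mult_right_mono C) auto
    also have "exp (1 / 4 * z) = exp (1 / 4) * exp (y / (4 * \<theta>))"
      unfolding exp_add[symmetric] by (simp add: z_def field_simps)
    finally have "y ^ j * \<theta> powr (- N - real j) * exp (- (y / (4 * \<theta>))) \<le> C * exp (1 / 4) * (\<theta> + y) powr (- N)"
      unfolding z(2) by (simp add: exp_minus field_simps)
    then have "\<bar>c\<bar> * (y ^ j * \<theta> powr (- N - real j) * exp (- (y / (4 * \<theta>)))) \<le> \<bar>c\<bar> * (C * exp (1 / 4) * (\<theta> + y) powr (- N))"
      by (intro mult_left_mono) auto
    then show ?thesis using that by (simp add: D_def abs_mult mult.assoc)
  qed
  moreover have "D \<ge> 0" using C by (simp add: D_def)
  ultimately show ?case by blast
next
  case (add N F G)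
  obtain C where C: "C \<ge> 0" "\<And>\<theta> y. \<theta> > 0 \<Longrightarrow> y \<ge> 0 \<Longrightarrow> \<bar>F \<theta> y\<bar> \<le> C * (\<theta> + y) powr (- N)"
    using add.IH(1)[OF add.prems] by blast
  obtain D where D: "D \<ge> 0" "\<And>\<theta> y. \<theta> > 0 \<Longrightarrow> y \<ge> 0 \<Longrightarrow> \<bar>G \<theta> y\<bar> \<le> D * (\<theta> + y) powr (- N)"
    using add.IH(2)[OF add.prems] by blast
  have "\<bar>F \<theta> y + G \<theta> y\<bar> \<le> (C + D) * (\<theta> + y) powr (- N)" if "\<theta> > 0" "y \<ge> 0" for \<theta> y
    using C(2)[OF that] D(2)[OF that] by (simp add: distrib_right)
  then show ?case using C D by (intro exI[of _ "C + D"]) auto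
qed

text \<open>For \<open>k = 0\<close> this is the heat kernel. In the step both the closed form and
  the Fourier integral are differentiated in \<open>\<theta>\<close>, and uniqueness of the
  derivative identifies the results.\<close>

lemma gauss_symbol_nat:
  "\<exists>F. heat_deriv (DIM('a) / 2 + real k) F \<and>
     (\<forall>\<theta>>0. \<forall>x::'a::euclidean_space. gauss_symbol (real k) \<theta> x = of_real (F \<theta> ((norm x)\<^sup>2)))"
proof (induction k)
  case 0
  define F where "F \<theta> y = pi powr (DIM('a) / 2) * y ^ 0 * \<theta> powr (- (DIM('a) / 2 + real 0) - real 0) * exp (- (y / (4 * \<theta>)))"
    for \<theta> y :: real
  have "heat_deriv (DIM('a) / 2 + real 0) F"
    unfolding F_def by (rule heat_deriv.monom)
  moreover have "gauss_symbol (real 0) \<theta> x = of_real (F \<theta> ((norm x)\<^sup>2))" if "\<theta> > 0" for \<theta> and x :: 'a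
  proof -
    have "(pi / \<theta>) powr (DIM('a) / 2) = pi powr (DIM('a) / 2) * \<theta> powr (- (DIM('a) / 2))"
      using that by (subst powr_divide) (auto simp: powr_minus_divide)
    then show ?thesis unfolding F_def of_nat_0 gauss_symbol_0[OF that] by simp
  qed
  ultimately show ?case by blast
next
  case (Suc k)
  then obtain F where F: "heat_deriv (DIM('a) / 2 + real k) F"
    "\<And>\<theta> x::'a. \<theta> > 0 \<Longrightarrow> gauss_symbol (real k) \<theta> x = of_real (F \<theta> ((norm x)\<^sup>2))" by blast
  obtain F' where F': "heat_deriv (DIM('a) / 2 + real k + 1) F'"
     "\<And>\<theta> y. \<theta> > 0 \<Longrightarrow> ((\<lambda>\<theta>. F \<theta> y) has_real_derivative - F' \<theta> y) (at \<theta>)"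
    using heat_deriv_deriv[OF F(1)] by blast
  have "gauss_symbol (real (Suc k)) \<theta> x = of_real (F' \<theta> ((norm x)\<^sup>2))" if "\<theta> > 0" for \<theta> and x :: 'a
  proof -
    have "((\<lambda>\<theta>. complex_of_real (F \<theta> ((norm x)\<^sup>2))) has_vector_derivative of_real (- F' \<theta> ((norm x)\<^sup>2))) (at \<theta>)"
      using F'(2)[OF that] by (intro has_vector_derivative_of_real) (simp add: has_real_derivative_iff_has_vector_derivative)
    then have "((\<lambda>\<theta>. gauss_symbol (real k) \<theta> x) has_vector_derivative of_real (- F' \<theta> ((norm x)\<^sup>2))) (at \<theta>)"
      by (rule has_vector_derivative_transform_within_open[where S = "{0<..}"]) (use that F(2) in auto)
    from vector_derivative_unique_at[OF this has_vector_derivative_gauss_symbol[of "real k" \<theta> x]] that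
    have "gauss_symbol (real k + 1) \<theta> x = of_real (F' \<theta> ((norm x)\<^sup>2))" by simp
    then show ?thesis by (simp add: add.commute)
  qed
  then show ?case using F'(1) by (intro exI[of _ F']) (auto simp: add_ac)
qed

lemma gauss_symbol_nat_bound:
  "\<exists>C\<ge>0. \<forall>\<theta>>0. \<forall>x::'a::euclidean_space.
     norm (gauss_symbol (real k) \<theta> x) \<le> C * (\<theta> + (norm x)\<^sup>2) powr (- (DIM('a) / 2 + real k))"
proof -
  obtain F where F: "heat_deriv (DIM('a) / 2 + real k) F"
    "\<And>\<theta> x::'a. \<theta> > 0 \<Longrightarrow> gauss_symbol (real k) \<theta> x = of_real (F \<theta> ((norm x)\<^sup>2))"
    using gauss_symbol_nat by blast
  show ?thesis using heat_deriv_bound[OF F(1)] by (auto simp: F(2))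
qed

text \<open>Moves a mixture through a Fourier integral. It is used for the transform of the weight,
  for the inverse transform, and for the Gamma representation of a negative power of the
  frequency.\<close>

lemma fourier_mixture:
  fixes w :: "real \<Rightarrow> 'a::euclidean_space \<Rightarrow> real"
  assumes "integrable (lborel \<Otimes>\<^sub>M lborel) (\<lambda>(t, \<xi>). w t \<xi>)"
  shows "(LINT \<xi>|lborel. cis (x \<bullet> \<xi>) * of_real (LINT t|lborel. w t \<xi>)) =
         (LINT t|lborel. LINT \<xi>|lborel. cis (x \<bullet> \<xi>) * of_real (w t \<xi>))"
proof -
  have [measurable]: "(\<lambda>(t, \<xi>). w t \<xi>) \<in> borel_measurable (lborel \<Otimes>\<^sub>M lborel)"
    using assms by (rule borel_measurable_integrable)
  have "integrable (lborel \<Otimes>\<^sub>M lborel) (\<lambda>(t, \<xi>). cis (x \<bullet> \<xi>) * complex_of_real (w t \<xi>))"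
    using assms by (rule Bochner_Integration.integrable_bound) (auto simp: norm_mult)
  from lborel_pair.Fubini_integral[OF this] show ?thesis
    by simp
qed

lemma integrable_pair_lborel_swap:
  fixes f :: "real \<Rightarrow> 'a::euclidean_space \<Rightarrow> real"
  assumes [measurable]: "(\<lambda>(t, \<xi>). f t \<xi>) \<in> borel_measurable (lborel \<Otimes>\<^sub>M lborel)"
    and "integrable lborel (\<lambda>\<xi>. LINT t|lborel. \<bar>f t \<xi>\<bar>)"
    and "AE \<xi> in lborel. integrable lborel (\<lambda>t. f t \<xi>)"
  shows "integrable (lborel \<Otimes>\<^sub>M lborel) (\<lambda>(t, \<xi>). f t \<xi>)"
proof -
  have "integrable (lborel \<Otimes>\<^sub>M lborel) (\<lambda>(\<xi>, t). f t \<xi>)"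
    by (rule lborel_pair.Fubini_integrable) (use assms in auto)
  from lborel_pair.integrable_product_swap[OF this] show ?thesis
    by (simp add: case_prod_unfold)
qed

text \<open>The Gamma integral only shifts theta to theta + t, so the integer bound of order k
  applies under the integral. Integrating (theta + t + |x|^2)^(-n/2-k) against t^(c-1) then loses
  exactly the power c = k - s. Descending from the next integer makes c > 0, as the Gamma integral
  requires.\<close>

lemma gauss_symbol_bound:
  assumes "s \<ge> 0"
  shows "\<exists>C\<ge>0. \<forall>\<theta>>0. \<forall>x::'a::euclidean_space.
     norm (gauss_symbol s \<theta> x) \<le> C * (\<theta> + (norm x)\<^sup>2) powr (- (DIM('a) / 2 + s))"
proof (cases "s = real (nat \<lfloor>s\<rfloor>)")
  case True
  then show ?thesis using gauss_symbol_nat_bound[where 'a = 'a and k = "nat \<lfloor>s\<rfloor>"] by simp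
next
  case False
  define k where "k = Suc (nat \<lfloor>s\<rfloor>)"
  define c where "c = real k - s"
  have "real (nat \<lfloor>s\<rfloor>) = of_int \<lfloor>s\<rfloor>" using assms by simp
  then have c: "0 < c" "c < 1" "s = real k - c" "real k \<ge> 1"
    using False unfolding c_def k_def by linarith+
  define N where "N = DIM('a) / 2 + real k"
  have N: "c < N" using c by (simp add: N_def add.commute add_strict_increasing)
  obtain C where C: "C \<ge> 0" "\<And>\<theta> x::'a. \<theta> > 0 \<Longrightarrow> norm (gauss_symbol (real k) \<theta> x) \<le> C * (\<theta> + (norm x)\<^sup>2) powr (- N)"
    using gauss_symbol_nat_bound[where 'a = 'a and k = k] unfolding N_def by blast
  have "norm (gauss_symbol s \<theta> x) \<le> C * Beta c (N - c) / Gamma c * (\<theta> + (norm x)\<^sup>2) powr (- (DIM('a) / 2 + s))"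
    if \<theta>: "\<theta> > 0" for \<theta> and x :: 'a
  proof -
    define w where "w t \<xi> = indicator {0<..} t * (t powr (c - 1)) / Gamma c *
      (norm \<xi> powr (2 * real k) * exp (- ((\<theta> + t) * (norm \<xi>)\<^sup>2)))" for t and \<xi> :: 'a
    have weq: "w t \<xi> = norm \<xi> powr (2 * real k) * exp (- (\<theta> * (norm \<xi>)\<^sup>2)) / Gamma c *
        (indicator {0<..} t * (t powr (c - 1) * exp (- ((norm \<xi>)\<^sup>2 * t))))" for t \<xi>
      by (simp add: w_def exp_add[symmetric] algebra_simps)
    have w0: "w t \<xi> \<ge> 0" for t \<xi>
      using c by (auto simp: w_def Gamma_real_pos less_imp_le)
    have wI: "has_bochner_integral lborel (\<lambda>t. w t \<xi>) (norm \<xi> powr (2 * s) * exp (- (\<theta> * (norm \<xi>)\<^sup>2)))" for \<xi>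
    proof (cases "\<xi> = 0")
      case True
      then show ?thesis using c by (simp add: w_def has_bochner_integral_zero)
    next
      case False
      have "has_bochner_integral lborel (\<lambda>t. w t \<xi>) (norm \<xi> powr (2 * real k) * exp (- (\<theta> * (norm \<xi>)\<^sup>2)) / Gamma c *
          (Gamma c / ((norm \<xi>)\<^sup>2) powr c))"
        unfolding weq using c False by (intro has_bochner_integral_mult_right has_bochner_integral_Gamma) auto
      also have "norm \<xi> powr (2 * real k) * exp (- (\<theta> * (norm \<xi>)\<^sup>2)) / Gamma c * (Gamma c / ((norm \<xi>)\<^sup>2) powr c) =
         norm \<xi> powr (2 * s) * exp (- (\<theta> * (norm \<xi>)\<^sup>2))"
      proof -
        have "((norm \<xi>)\<^sup>2) powr c = norm \<xi> powr (2 * c)"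
          using False by (simp add: powr_powr[symmetric])
        moreover have "Gamma c > 0" using c by (simp add: Gamma_real_pos)
        ultimately show ?thesis using False by (simp add: c(3) right_diff_distrib powr_diff)
      qed
      finally show ?thesis .
    qed
    have "integrable (lborel \<Otimes>\<^sub>M lborel) (\<lambda>(t, \<xi>). w t \<xi>)"
    proof (rule integrable_pair_lborel_swap)
      show "(\<lambda>(t, \<xi>). w t \<xi>) \<in> borel_measurable (lborel \<Otimes>\<^sub>M lborel)"
        unfolding w_def by measurable
      show "AE \<xi> in lborel. integrable lborel (\<lambda>t. w t \<xi>)"
        using wI by (auto simp: has_bochner_integral_iff)
      show "integrable lborel (\<lambda>\<xi>. LINT t|lborel. \<bar>w t \<xi>\<bar>)"
        using wI integrable_gauss_symbol[OF assms \<theta>, where 'a = 'a] w0 by (simp add: has_bochner_integral_iff)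
    qed
    from fourier_mixture[OF this, of x]
    have "gauss_symbol s \<theta> x = (LINT t|lborel. LINT \<xi>|lborel. cis (x \<bullet> \<xi>) * of_real (w t \<xi>))"
      using wI by (simp add: gauss_symbol_def has_bochner_integral_iff)
    also have "\<dots> = (LINT t|lborel. of_real (indicator {0<..} t * (t powr (c - 1)) / Gamma c) * gauss_symbol (real k) (\<theta> + t) x)"
      unfolding gauss_symbol_def w_def integral_mult_right_zero[symmetric]
      by (intro Bochner_Integration.integral_cong refl) (simp add: mult_ac)
    finally have eq: "gauss_symbol s \<theta> x = \<dots>" .
    have hb: "has_bochner_integral lborel (\<lambda>t. C / Gamma c * (indicator {0<..} t * (t powr (c - 1) * (\<theta> + (norm x)\<^sup>2 + t) powr (- N))))
         (C / Gamma c * (Beta c (N - c) * (\<theta> + (norm x)\<^sup>2) powr (c - N)))"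
      using c N \<theta> by (intro has_bochner_integral_mult_right has_bochner_integral_Beta) (auto intro: add_pos_nonneg)
    have "norm (gauss_symbol s \<theta> x) \<le> (LINT t|lborel. norm (of_real (indicator {0<..} t * (t powr (c - 1)) / Gamma c) * gauss_symbol (real k) (\<theta> + t) x))"
      unfolding eq by (rule integral_norm_bound)
    also have "\<dots> \<le> (LINT t|lborel. C / Gamma c * (indicator {0<..} t * (t powr (c - 1) * (\<theta> + (norm x)\<^sup>2 + t) powr (- N))))"
    proof (rule integral_mono')
      show "integrable lborel (\<lambda>t. C / Gamma c * (indicator {0<..} t * (t powr (c - 1) * (\<theta> + (norm x)\<^sup>2 + t) powr (- N))))"
        using hb by (simp add: has_bochner_integral_iff)
      fix t :: real
      have G: "Gamma c > 0" using c by (simp add: Gamma_real_pos)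
      show "0 \<le> C / Gamma c * (indicator {0<..} t * (t powr (c - 1) * (\<theta> + (norm x)\<^sup>2 + t) powr (- N)))"
        using C(1) G by simp
      show "norm (of_real (indicator {0<..} t * (t powr (c - 1)) / Gamma c) * gauss_symbol (real k) (\<theta> + t) x)
        \<le> C / Gamma c * (indicator {0<..} t * (t powr (c - 1) * (\<theta> + (norm x)\<^sup>2 + t) powr (- N)))"
      proof (cases "t > 0")
        case True
        have "t powr (c - 1) / Gamma c * norm (gauss_symbol (real k) (\<theta> + t) x) \<le>
            t powr (c - 1) / Gamma c * (C * (\<theta> + t + (norm x)\<^sup>2) powr (- N))"
          using True \<theta> G by (intro mult_left_mono C(2)) auto
        then show ?thesis using True G by (simp add: norm_mult norm_divide add_ac mult_ac)
      qed auto
    qed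
    also have "\<dots> = C / Gamma c * (Beta c (N - c) * (\<theta> + (norm x)\<^sup>2) powr (c - N))"
      using hb by (simp add: has_bochner_integral_iff)
    also have "c - N = - (DIM('a) / 2 + s)" by (simp add: N_def c(3))
    finally show ?thesis by simp
  qed
  moreover have "C * Beta c (N - c) / Gamma c \<ge> 0"
    using C c N by (simp add: Beta_def Gamma_real_pos less_imp_le)
  ultimately show ?thesis by blast
qed

subsection \<open>Powers of \<open>\<mu> + |x|\<^sup>2\<close> as mixtures of Gaussians\<close>

text \<open>The parameter \<open>\<mu>\<close> carries the dilation:
  \<open>\<mu> = R\<^sup>2\<close> corresponds to x/R. Estimates for all \<open>\<mu>\<close> at
  once avoid a change of variables in the Fourier integrals.\<close>

definition weight :: "real \<Rightarrow> real \<Rightarrow> 'a::euclidean_space \<Rightarrow> real" where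
  "weight p \<mu> x = (\<mu> + (norm x)\<^sup>2) powr (- p)"

definition weight_mix :: "real \<Rightarrow> real \<Rightarrow> real \<Rightarrow> 'a::euclidean_space \<Rightarrow> real" where
  "weight_mix p \<mu> t x = indicator {0<..} t * (t powr (p - 1) * exp (- (\<mu> * t))) / Gamma p * exp (- (t * (norm x)\<^sup>2))"

lemma weight_mix_nonneg: "p > 0 \<Longrightarrow> weight_mix p \<mu> t x \<ge> 0"
  by (auto simp: weight_mix_def Gamma_real_pos less_imp_le)

lemma has_bochner_integral_weight_mix:
  fixes x :: "'a::euclidean_space"
  assumes "p > 0" "\<mu> > 0"
  shows "has_bochner_integral lborel (\<lambda>t. weight_mix p \<mu> t x) (weight p \<mu> x)"
proof -
  have "Gamma p > 0" using assms by (simp add: Gamma_real_pos)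
  have pos: "\<mu> + (norm x)\<^sup>2 > 0" using assms by (intro add_pos_nonneg) auto
  have "has_bochner_integral lborel (\<lambda>t. 1 / Gamma p * (indicator {0<..} t * (t powr (p - 1) * exp (- ((\<mu> + (norm x)\<^sup>2) * t)))))
     (1 / Gamma p * (Gamma p / (\<mu> + (norm x)\<^sup>2) powr p))"
    using assms(1) pos by (intro has_bochner_integral_mult_right has_bochner_integral_Gamma)
  also have "(\<lambda>t. 1 / Gamma p * (indicator {0<..} t * (t powr (p - 1) * exp (- ((\<mu> + (norm x)\<^sup>2) * t))))) = (\<lambda>t. weight_mix p \<mu> t x)"
    by (auto simp: weight_mix_def exp_add[symmetric] algebra_simps)
  also have "1 / Gamma p * (Gamma p / (\<mu> + (norm x)\<^sup>2) powr p) = weight p \<mu> x"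
    using \<open>Gamma p > 0\<close> by (simp add: weight_def powr_minus divide_inverse)
  finally show ?thesis .
qed

lemma integral_weight_mix:
  assumes "p > DIM('a) / 2" "\<mu> > 0"
  shows "(LINT x|lborel. weight_mix p \<mu> t (x::'a::euclidean_space)) =
    pi powr (DIM('a) / 2) / Gamma p * (indicator {0<..} t * (t powr (p - DIM('a) / 2 - 1) * exp (- (\<mu> * t))))"
proof (cases "t > 0")
  case True
  have "(LINT x|lborel. weight_mix p \<mu> t (x::'a)) = t powr (p - 1) * exp (- (\<mu> * t)) / Gamma p * (pi / t) powr (DIM('a) / 2)"
    using has_bochner_integral_gaussian_real[OF True, where 'a = 'a] True
    by (simp add: weight_mix_def has_bochner_integral_iff)
  also have "(pi / t) powr (DIM('a) / 2) = pi powr (DIM('a) / 2) / t powr (DIM('a) / 2)"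
    using True by (subst powr_divide) auto
  finally show ?thesis using True by (simp add: powr_diff mult_ac)
qed (simp add: weight_mix_def)

lemma integrable_weight_mix:
  assumes "p > DIM('a) / 2" "\<mu> > 0"
  shows "integrable (lborel \<Otimes>\<^sub>M lborel) (\<lambda>(t, x). weight_mix p \<mu> t (x::'a::euclidean_space))"
proof (rule lborel_pair.Fubini_integrable)
  have p: "p > 0" using assms(1) by (smt (verit) of_nat_0_le_iff divide_nonneg_nonneg)
  show "(\<lambda>(t, x). weight_mix p \<mu> t (x::'a)) \<in> borel_measurable (lborel \<Otimes>\<^sub>M lborel)"
    unfolding weight_mix_def by measurable
  have "integrable lborel (\<lambda>t. pi powr (DIM('a) / 2) / Gamma p * (indicator {0<..} t * (t powr (p - DIM('a) / 2 - 1) * exp (- (\<mu> * t)))))"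
    using has_bochner_integral_Gamma[of "p - DIM('a) / 2" \<mu>] assms
    by (intro integrable_mult_right) (auto simp: has_bochner_integral_iff)
  then show "integrable lborel (\<lambda>t. LINT x|lborel. norm (case (t, x) of (t, x) \<Rightarrow> weight_mix p \<mu> t (x::'a)))"
    using p by (simp add: weight_mix_nonneg integral_weight_mix[OF assms])
  show "AE t in lborel. integrable lborel (\<lambda>x. case (t, x) of (t, x) \<Rightarrow> weight_mix p \<mu> t (x::'a))"
  proof (intro AE_I2)
    fix t :: real
    show "integrable lborel (\<lambda>x. case (t, x) of (t, x) \<Rightarrow> weight_mix p \<mu> t (x::'a))"
      using has_bochner_integral_gaussian_real[of t, where 'a = 'a]
      by (cases "t > 0") (auto simp: weight_mix_def has_bochner_integral_iff)
  qed
qed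

lemma has_bochner_integral_weight:
  assumes "p > DIM('a) / 2" "\<mu> > 0"
  shows "has_bochner_integral lborel (weight p \<mu> :: 'a::euclidean_space \<Rightarrow> real)
     (pi powr (DIM('a) / 2) / Gamma p * Gamma (p - DIM('a) / 2) * \<mu> powr (DIM('a) / 2 - p))"
proof -
  have p: "p > 0" using assms(1) by (smt (verit) of_nat_0_le_iff divide_nonneg_nonneg)
  note int = integrable_weight_mix[OF assms]
  have w: "(LINT t|lborel. weight_mix p \<mu> t x) = weight p \<mu> x" for x :: 'a
    using has_bochner_integral_weight_mix[OF p assms(2), of x] by (simp add: has_bochner_integral_iff)
  have "integrable lborel (\<lambda>x::'a. LINT t|lborel. weight_mix p \<mu> t x)"
    using lborel_pair.integrable_snd[OF int] .
  then have 1: "integrable lborel (weight p \<mu> :: 'a \<Rightarrow> real)"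
    unfolding w .
  have "(LINT x|lborel. weight p \<mu> (x::'a)) = (LINT x|lborel. LINT t|lborel. weight_mix p \<mu> t (x::'a))"
    unfolding w ..
  also have "\<dots> = (LINT t|lborel. LINT x|lborel. weight_mix p \<mu> t (x::'a))"
    using lborel_pair.Fubini_integral[OF int] .
  also have "\<dots> = pi powr (DIM('a) / 2) / Gamma p * (Gamma (p - DIM('a) / 2) / \<mu> powr (p - DIM('a) / 2))"
    unfolding integral_weight_mix[OF assms]
    using has_bochner_integral_Gamma[of "p - DIM('a) / 2" \<mu>] assms by (simp add: has_bochner_integral_iff)
  also have "\<dots> = pi powr (DIM('a) / 2) / Gamma p * Gamma (p - DIM('a) / 2) * \<mu> powr (DIM('a) / 2 - p)"
    using assms by (simp add: powr_diff)
  finally show ?thesis using 1 by (simp add: has_bochner_integral_iff)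
qed

lemma measurable_weight [measurable]: "weight p \<mu> \<in> borel_measurable borel"
  unfolding weight_def by measurable

lemma measurable_cis_minus_inner [measurable]:
  "(\<lambda>x. cis (- (\<xi> \<bullet> x))) \<in> borel_measurable (borel :: 'a::euclidean_space measure)"
  unfolding cis_conv_exp by measurable

text \<open>The transform is a Bessel potential kernel. It is left as a superposition of Gaussians
  in the frequency, so that the inverse transform can be taken Gaussian by Gaussian.\<close>

lemma fourier_weight:
  fixes \<xi> :: "real^'n"
  defines "h \<equiv> real CARD('n) / 2"
  assumes "p > h" "\<mu> > 0"
  shows "fourier (\<lambda>x. of_real (weight p \<mu> x)) \<xi> = of_real (LINT t|lborel.
    2 powr (- h) / Gamma p * (indicator {0<..} t * (t powr (p - h - 1) * exp (- (\<mu> * t))) * exp (- (1 / (4 * t) * (norm \<xi>)\<^sup>2))))"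
proof -
  have p: "p > 0" "p > DIM(real^'n) / 2"
    using assms by (auto simp: h_def intro: le_less_trans[rotated])
  have w: "(LINT t|lborel. weight_mix p \<mu> t x) = weight p \<mu> x" for x :: "real^'n"
    using has_bochner_integral_weight_mix[OF p(1) assms(3), of x] by (simp add: has_bochner_integral_iff)
  have "(LINT x|lebesgue. cis (- (x \<bullet> \<xi>)) * complex_of_real (weight p \<mu> x)) =
        (LINT x|lborel. cis ((- \<xi>) \<bullet> x) * of_real (weight p \<mu> x))"
    unfolding inner_commute[of _ \<xi>] inner_minus_left by (rule integral_completion) measurable
  also have "\<dots> = (LINT x|lborel. cis ((- \<xi>) \<bullet> x) * of_real (LINT t|lborel. weight_mix p \<mu> t x))"
    unfolding w ..
  also have "\<dots> = (LINT t|lborel. LINT x|lborel. cis ((- \<xi>) \<bullet> x) * of_real (weight_mix p \<mu> t x))"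
    by (rule fourier_mixture[OF integrable_weight_mix[OF p(2) assms(3)]])
  also have "\<dots> = (LINT t|lborel. complex_of_real (pi powr h / Gamma p *
     (indicator {0<..} t * (t powr (p - h - 1) * exp (- (\<mu> * t))) * exp (- (1 / (4 * t) * (norm \<xi>)\<^sup>2)))))"
  proof (intro Bochner_Integration.integral_cong refl)
    fix t :: real
    show "(LINT x|lborel. cis ((- \<xi>) \<bullet> x) * of_real (weight_mix p \<mu> t x)) =
       complex_of_real (pi powr h / Gamma p * (indicator {0<..} t * (t powr (p - h - 1) * exp (- (\<mu> * t))) * exp (- (1 / (4 * t) * (norm \<xi>)\<^sup>2))))"
    proof (cases "t > 0")
      case True
      have "(LINT x|lborel. cis ((- \<xi>) \<bullet> x) * of_real (weight_mix p \<mu> t x)) =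
         (LINT x|lborel. of_real (t powr (p - 1) * exp (- (\<mu> * t)) / Gamma p) * (cis ((- \<xi>) \<bullet> x) * of_real (exp (- (t * (norm x)\<^sup>2)))))"
        using True by (intro Bochner_Integration.integral_cong) (auto simp: weight_mix_def)
      also have "\<dots> = of_real (t powr (p - 1) * exp (- (\<mu> * t)) / Gamma p) * of_real ((pi / t) powr (DIM(real^'n) / 2) * exp (- ((norm (- \<xi>))\<^sup>2 / (4 * t))))"
        using has_bochner_integral_gaussian[OF True, of "- \<xi>"] by (subst integral_mult_right_zero) (simp add: has_bochner_integral_iff)
      also have "\<dots> = of_real (t powr (p - 1) * exp (- (\<mu> * t)) / Gamma p * ((pi / t) powr h * exp (- (1 / (4 * t) * (norm \<xi>)\<^sup>2))))"
        by (simp add: h_def)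
      also have "(pi / t) powr h = pi powr h / t powr h"
        using True by (subst powr_divide) auto
      finally show ?thesis using True by (simp add: powr_diff mult_ac)
    qed (simp add: weight_mix_def)
  qed
  finally have "(LINT x|lebesgue. cis (- (x \<bullet> \<xi>)) * complex_of_real (weight p \<mu> x)) = \<dots>" .
  then have "fourier (\<lambda>x. of_real (weight p \<mu> x)) \<xi> = (2 * pi) powr (- h) *\<^sub>R of_real (LINT t|lborel. (pi powr h / Gamma p *
     (indicator {0<..} t * (t powr (p - h - 1) * exp (- (\<mu> * t))) * exp (- (1 / (4 * t) * (norm \<xi>)\<^sup>2)))))"
    by (simp only: fourier_def integral_complex_of_real h_def minus_divide_left)
  also have "\<dots> = of_real (LINT t|lborel. (2 * pi) powr (- h) * (pi powr h / Gamma p *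
     (indicator {0<..} t * (t powr (p - h - 1) * exp (- (\<mu> * t))) * exp (- (1 / (4 * t) * (norm \<xi>)\<^sup>2)))))"
    by (simp only: scaleR_conv_of_real of_real_mult[symmetric] integral_mult_right_zero[symmetric])
  also have "(2 * pi) powr (- h) = 2 powr (- h) * pi powr (- h)"
    by (rule powr_mult)
  also have "(\<lambda>t. 2 powr (- h) * pi powr (- h) * (pi powr h / Gamma p *
     (indicator {0<..} t * (t powr (p - h - 1) * exp (- (\<mu> * t))) * exp (- (1 / (4 * t) * (norm \<xi>)\<^sup>2))))) =
      (\<lambda>t. 2 powr (- h) / Gamma p * (indicator {0<..} t * (t powr (p - h - 1) * exp (- (\<mu> * t))) * exp (- (1 / (4 * t) * (norm \<xi>)\<^sup>2))))"
    by (auto simp: powr_minus_divide)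
  finally show ?thesis .
qed

text \<open>In the transformed mixture the Gaussian exp (-|xi|^2/(4t)) is the heat multiplier at
  time 1/(4t), whence the argument of \<open>gauss_symbol\<close>.\<close>

lemma frac_laplacian_weight:
  fixes x :: "real^'n"
  defines "h \<equiv> real CARD('n) / 2"
  assumes "p > h" "\<mu> > 0" "s \<ge> 0"
  shows "frac_laplacian s (\<lambda>x. of_real (weight p \<mu> x)) x = (LINT t|lborel.
    of_real ((2 * pi) powr (- h) * 2 powr (- h) / Gamma p * (indicator {0<..} t * (t powr (p - h - 1) * exp (- (\<mu> * t))))) * gauss_symbol s (1 / (4 * t)) x)"
proof -
  have p: "p > 0" "p > DIM(real^'n) / 2"
    using assms by (auto simp: h_def intro: le_less_trans[rotated])
  define a where "a t = 2 powr (- h) / Gamma p * (indicator {0<..} t * (t powr (p - h - 1) * exp (- (\<mu> * t))))" for t :: real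
  have a0: "a t \<ge> 0" for t using p by (auto simp: a_def Gamma_real_pos less_imp_le)
  have [measurable]: "a \<in> borel_measurable borel" unfolding a_def by measurable
  define v where "v t \<xi> = a t * (norm \<xi> powr (2 * s) * exp (- (1 / (4 * t) * (norm \<xi>)\<^sup>2)))" for t and \<xi> :: "real^'n"
  have v[measurable]: "(\<lambda>(t, \<xi>). v t \<xi>) \<in> borel_measurable (lborel \<Otimes>\<^sub>M lborel)"
    unfolding v_def by measurable
  have v0: "v t \<xi> \<ge> 0" for t \<xi> by (auto simp: v_def a0)
  have intv: "integrable lborel (\<lambda>\<xi>. v t \<xi>)" for t
  proof (cases "t > 0")
    case True
    then show ?thesis unfolding v_def using assms by (intro integrable_mult_right integrable_gauss_symbol) auto
  qed (simp add: v_def a_def)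
  obtain C where C: "C \<ge> 0" "\<And>\<theta> x::real^'n. \<theta> > 0 \<Longrightarrow> norm (gauss_symbol s \<theta> x) \<le> C * (\<theta> + (norm x)\<^sup>2) powr (- (h + s))"
    using gauss_symbol_bound[OF assms(4), where 'a = "real^'n"] unfolding h_def by auto
  have int: "integrable (lborel \<Otimes>\<^sub>M lborel) (\<lambda>(t, \<xi>). v t \<xi>)"
  proof (rule lborel_pair.Fubini_integrable)
    show "(\<lambda>(t, \<xi>). v t \<xi>) \<in> borel_measurable (lborel \<Otimes>\<^sub>M lborel)" by (rule v)
    show "AE t in lborel. integrable lborel (\<lambda>\<xi>. case (t, \<xi>) of (t, \<xi>) \<Rightarrow> v t \<xi>)"
      using intv by simp
    have bd: "norm (LINT \<xi>|lborel. v t \<xi>) \<le> norm (2 powr (- h) / Gamma p * C * 4 powr (h + s) * (indicator {0<..} t * (t powr (p + s - 1) * exp (- (\<mu> * t)))))" for t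
    proof (cases "t > 0")
      case True
      \<comment> \<open>At \<open>x = 0\<close> there is no phase, so the decay bound measures the
        integral of the positive symbol over all frequencies. Its growth t^(h+s) turns t^(p-h-1)
        into t^(p+s-1), which is still a Gamma integrand.\<close>
      have "norm (gauss_symbol s (1 / (4 * t)) (0 :: real^'n)) \<le> C * (1 / (4 * t) + (norm (0::real^'n))\<^sup>2) powr (- (h + s))"
        using True by (intro C) auto
      also have "(1 / (4 * t) + (norm (0::real^'n))\<^sup>2) powr (- (h + s)) = 4 powr (h + s) * t powr (h + s)"
        using True by (simp add: powr_minus_divide powr_divide powr_mult del: minus_add_distrib)
      also have "gauss_symbol s (1 / (4 * t)) (0 :: real^'n) = of_real (LINT \<xi>|lborel. norm (\<xi>::real^'n) powr (2 * s) * exp (- (1 / (4 * t) * (norm \<xi>)\<^sup>2)))"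
        unfolding gauss_symbol_def integral_complex_of_real[symmetric] by simp
      finally have I: "(LINT \<xi>|lborel. norm (\<xi>::real^'n) powr (2 * s) * exp (- (1 / (4 * t) * (norm \<xi>)\<^sup>2))) \<le> C * (4 powr (h + s) * t powr (h + s))"
        by simp
      have "norm (LINT \<xi>|lborel. v t \<xi>) = (LINT \<xi>|lborel. v t \<xi>)"
        using v0 by simp
      also have "\<dots> = a t * (LINT \<xi>|lborel. norm (\<xi>::real^'n) powr (2 * s) * exp (- (1 / (4 * t) * (norm \<xi>)\<^sup>2)))"
        unfolding v_def by simp
      also have "\<dots> \<le> a t * (C * (4 powr (h + s) * t powr (h + s)))"
        by (intro mult_left_mono I a0)
      also have "\<dots> = 2 powr (- h) / Gamma p * C * 4 powr (h + s) * (indicator {0<..} t * ((t powr (p - h - 1) * t powr (h + s)) * exp (- (\<mu> * t))))"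
        by (simp add: a_def)
      also have "t powr (p - h - 1) * t powr (h + s) = t powr (p + s - 1)"
        by (simp add: powr_add[symmetric] algebra_simps)
      finally show ?thesis by (rule order_trans) (simp only: real_norm_def abs_ge_self)
    qed (simp add: v_def a_def)
    have "integrable lborel (\<lambda>t. 2 powr (- h) / Gamma p * C * 4 powr (h + s) * (indicator {0<..} t * (t powr (p + s - 1) * exp (- (\<mu> * t)))))"
      using has_bochner_integral_Gamma[of "p + s" \<mu>] assms p
      by (intro integrable_mult_right) (auto simp: has_bochner_integral_iff)
    then have "integrable lborel (\<lambda>t. LINT \<xi>|lborel. v t \<xi>)"
      by (rule Bochner_Integration.integrable_bound) (use bd in auto)
    then show "integrable lborel (\<lambda>t. LINT \<xi>|lborel. norm (case (t, \<xi>) of (t, \<xi>) \<Rightarrow> v t \<xi>))"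
      using v0 by simp
  qed
  have "complex_of_real (norm \<xi> powr (2 * s)) * fourier (\<lambda>x. of_real (weight p \<mu> x)) \<xi> = of_real (LINT t|lborel. v t \<xi>)" for \<xi> :: "real^'n"
    unfolding fourier_weight[OF assms(2)[unfolded h_def] assms(3)] of_real_mult[symmetric]
    by (subst integral_mult_right_zero[symmetric]) (simp add: v_def a_def h_def mult_ac)
  then have "frac_laplacian s (\<lambda>x. of_real (weight p \<mu> x)) x = (2 * pi) powr (- h) *\<^sub>R (LINT \<xi>|lebesgue. cis (x \<bullet> \<xi>) * of_real (LINT t|lborel. v t \<xi>))"
    by (simp add: frac_laplacian_def inverse_fourier_def h_def)
  also have "(LINT \<xi>|lebesgue. cis (x \<bullet> \<xi>) * complex_of_real (LINT t|lborel. v t \<xi>)) = (LINT \<xi>|lborel. cis (x \<bullet> \<xi>) * of_real (LINT t|lborel. v t \<xi>))"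
    by (rule integral_completion) measurable
  also have "\<dots> = (LINT t|lborel. LINT \<xi>|lborel. cis (x \<bullet> \<xi>) * of_real (v t \<xi>))"
    by (rule fourier_mixture[OF int])
  also have "\<dots> = (LINT t|lborel. of_real (a t) * gauss_symbol s (1 / (4 * t)) x)"
    unfolding gauss_symbol_def integral_mult_right_zero[symmetric]
    by (intro Bochner_Integration.integral_cong) (auto simp: v_def mult_ac)
  also have "(2 * pi) powr (- h) *\<^sub>R \<dots> = (LINT t|lborel. of_real ((2 * pi) powr (- h) * a t) * gauss_symbol s (1 / (4 * t)) x)"
    unfolding integral_scaleR_right[symmetric] by (simp add: scaleR_conv_of_real mult.assoc)
  finally show ?thesis by (simp add: a_def mult.assoc)
qed

text \<open>Covers \<open>\<sigma>\<^sub>1 = 0\<close>, where no b > 0 satisfies b <= s. Each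
  Gaussian returns to itself by the explicit formula, and the mixture reassembles.\<close>

lemma frac_laplacian_0_weight:
  fixes x :: "real^'n"
  assumes "p > real CARD('n) / 2" "\<mu> > 0"
  shows "frac_laplacian 0 (\<lambda>x. of_real (weight p \<mu> x)) x = of_real (weight p \<mu> x)"
proof -
  define h where "h = real CARD('n) / 2"
  have p: "p > 0" using assms by (auto intro: le_less_trans[rotated])
  have "frac_laplacian 0 (\<lambda>x. of_real (weight p \<mu> x)) x = (LINT t|lborel. complex_of_real (weight_mix p \<mu> t x))"
    unfolding frac_laplacian_weight[OF assms order_refl] h_def[symmetric]
  proof (intro Bochner_Integration.integral_cong refl)
    fix t :: real
    show "complex_of_real ((2 * pi) powr - h * 2 powr - h / Gamma p * (indicator {0<..} t * (t powr (p - h - 1) * exp (- (\<mu> * t))))) *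
         gauss_symbol 0 (1 / (4 * t)) x = complex_of_real (weight_mix p \<mu> t x)"
    proof (cases "t > 0")
      case True
      have "(pi / (1 / (4 * t))) powr h = ((2 * pi) * (2 * t)) powr h" by (simp add: mult_ac)
      also have "\<dots> = (2 * pi) powr h * (2 powr h * t powr h)"
        by (simp only: powr_mult)
      finally have "gauss_symbol 0 (1 / (4 * t)) x = of_real ((2 * pi) powr h * (2 powr h * t powr h) * exp (- (t * (norm x)\<^sup>2)))"
        using True by (subst gauss_symbol_0) (auto simp: h_def mult_ac)
      moreover have "t powr (p - h - 1) = t powr (p - 1) / t powr h"
        using True by (simp add: powr_diff)
      ultimately show ?thesis
        using True by (simp add: weight_mix_def powr_minus_divide del: powr_mult)
    qed (simp add: weight_mix_def)
  qed
  also have "\<dots> = of_real (weight p \<mu> x)"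
    using has_bochner_integral_weight_mix[OF p assms(2), of x] by (simp add: has_bochner_integral_iff)
  finally show ?thesis .
qed

text \<open>With A = mu + |x|^2 and h = n/2, the fractional Laplacian decays like A^(-h-s), the
  weight only like A^(-h-b). As b <= s, the surplus A^(-(s-b)) is at most mu^(-(s-b)). The factor
  mu^(-s) is the one dictated by dilation: for mu = R^2 it is R^(-2s).\<close>

lemma frac_laplacian_weight_bound:
  fixes b s :: real
  assumes "b > 0" "s = 0 \<or> b \<le> s"
  shows "\<exists>C\<ge>0. \<forall>\<mu>>0. \<forall>x::real^'n.
    norm (frac_laplacian s (\<lambda>x. of_real (weight (real CARD('n) / 2 + b) \<mu> x)) x) \<le>
      C * \<mu> powr (- s) * weight (real CARD('n) / 2 + b) \<mu> x"
proof (cases "s = 0")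
  case True
  have "norm (frac_laplacian 0 (\<lambda>x. of_real (weight (real CARD('n) / 2 + b) \<mu> x)) x) = weight (real CARD('n) / 2 + b) \<mu> x"
    if "\<mu> > 0" for \<mu> and x :: "real^'n"
    using assms(1) that by (subst frac_laplacian_0_weight) (auto simp: weight_def)
  then show ?thesis using True
    by (intro exI[of _ 1]) auto
next
  case False
  then have s: "b \<le> s" "s \<ge> 0" using assms by auto
  define h where "h = real CARD('n) / 2"
  define p where "p = h + b"
  have p: "p > h" "p > 0" "h \<ge> 0" using assms(1) by (auto simp: p_def h_def add_nonneg_pos)
  obtain C where C: "C \<ge> 0" "\<And>\<theta> x::real^'n. \<theta> > 0 \<Longrightarrow> norm (gauss_symbol s \<theta> x) \<le> C * (\<theta> + (norm x)\<^sup>2) powr (- (h + s))"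
    using gauss_symbol_bound[OF s(2), where 'a = "real^'n"] unfolding h_def by auto
  \<comment> \<open>The rate 1/8 is made for z = 1 + 4 mu t below: exp (z/8) is a constant times exp
    (mu t/2), which uses up half of the decay exp (-mu t) of the Gamma weight.\<close>
  obtain D where D: "D > 0" "\<And>z. z \<ge> 0 \<Longrightarrow> z powr (h + s) \<le> D * exp (1 / 8 * z)"
    using powr_le_exp[of "h + s" "1 / 8"] p s by auto
  define K where "K = (2 * pi) powr (- h) * 2 powr (- h) / Gamma p"
  have K: "K \<ge> 0" using p by (auto simp: K_def Gamma_real_pos less_imp_le)
  define E where "E = K * (C * (D * exp (1 / 8)))"
  have E: "E \<ge> 0" using K C D by (simp add: E_def)
  define E' where "E' = E * (Gamma b * 2 powr b)"
  have "norm (frac_laplacian s (\<lambda>x. of_real (weight p \<mu> x)) x) \<le> E' * \<mu> powr (- s) * weight p \<mu> x"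
    if \<mu>: "\<mu> > 0" for \<mu> and x :: "real^'n"
  proof -
    define A where "A = \<mu> + (norm x)\<^sup>2"
    have A: "A > 0" "A \<ge> \<mu>" using \<mu> by (auto simp: A_def intro: add_pos_nonneg)
    have hb: "has_bochner_integral lborel (\<lambda>t. E * A powr (- (h + s)) * (indicator {0<..} t * (t powr (b - 1) * exp (- (\<mu> / 2 * t)))))
        (E * A powr (- (h + s)) * (Gamma b / (\<mu> / 2) powr b))"
      using assms(1) \<mu> by (intro has_bochner_integral_mult_right has_bochner_integral_Gamma) auto
    have "norm (frac_laplacian s (\<lambda>x. of_real (weight p \<mu> x)) x) \<le> (LINT t|lborel.
      norm (complex_of_real (K * (indicator {0<..} t * (t powr (b - 1) * exp (- (\<mu> * t))))) * gauss_symbol s (1 / (4 * t)) x))"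
    proof -
      have "p - h - 1 = b - 1" by (simp add: p_def)
      with frac_laplacian_weight[of p \<mu> s x, folded h_def, OF p(1) \<mu> s(2), folded K_def]
      show ?thesis by (simp only: integral_norm_bound)
    qed
    also have "\<dots> \<le> (LINT t|lborel. E * A powr (- (h + s)) * (indicator {0<..} t * (t powr (b - 1) * exp (- (\<mu> / 2 * t)))))"
    proof (rule integral_mono')
      show "integrable lborel (\<lambda>t. E * A powr (- (h + s)) * (indicator {0<..} t * (t powr (b - 1) * exp (- (\<mu> / 2 * t)))))"
        using hb by (simp add: has_bochner_integral_iff)
      fix t :: real
      show "0 \<le> E * A powr (- (h + s)) * (indicator {0<..} t * (t powr (b - 1) * exp (- (\<mu> / 2 * t))))"
        using E by simp
      show "norm (complex_of_real (K * (indicator {0<..} t * (t powr (b - 1) * exp (- (\<mu> * t))))) * gauss_symbol s (1 / (4 * t)) x)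
        \<le> E * A powr (- (h + s)) * (indicator {0<..} t * (t powr (b - 1) * exp (- (\<mu> / 2 * t))))"
      proof (cases "t > 0")
        case True
        define B where "B = 1 / (4 * t) + (norm x)\<^sup>2"
        \<comment> \<open>This factor trades 1/(4t) for mu: in \<open>B * z\<close> the product of
          1/(4t) and 4 mu t supplies mu, and |x|^2 times 1 supplies |x|^2, so
          \<open>A \<le> B * z\<close>.\<close>
        define z where "z = 1 + 4 * \<mu> * t"
        have B: "B > 0" using True by (auto simp: B_def intro: add_pos_nonneg)
        have z: "z > 0" using True \<mu> by (auto simp: z_def intro: add_pos_pos)
        have "B * z = 1 / (4 * t) + (norm x)\<^sup>2 + \<mu> + 4 * \<mu> * t * (norm x)\<^sup>2"
          using True by (simp add: B_def z_def field_simps)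
        then have "A \<le> B * z" using True \<mu> by (simp add: A_def)
        then have "(A / z) powr (h + s) \<le> B powr (h + s)"
          using z A p s by (intro powr_mono2) (auto simp: field_simps)
        then have "B powr (- (h + s)) \<le> A powr (- (h + s)) * z powr (h + s)"
          using A B z by (simp add: powr_minus_divide powr_divide divide_simps mult_ac del: minus_add_distrib)
        also have "\<dots> \<le> A powr (- (h + s)) * (D * exp (1 / 8 * z))"
          using z by (intro mult_left_mono D) auto
        also have "exp (1 / 8 * z) = exp (1 / 8) * exp (\<mu> / 2 * t)"
          unfolding exp_add[symmetric] by (simp add: z_def algebra_simps)
        finally have "B powr (- (h + s)) \<le> A powr (- (h + s)) * (D * (exp (1 / 8) * exp (\<mu> / 2 * t)))" .
        then have "C * B powr (- (h + s)) \<le> C * (A powr (- (h + s)) * (D * (exp (1 / 8) * exp (\<mu> / 2 * t))))"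
          using C(1) by (rule mult_left_mono)
        with C(2)[of "1 / (4 * t)" x] True
        have G: "norm (gauss_symbol s (1 / (4 * t)) x) \<le> C * (A powr (- (h + s)) * (D * (exp (1 / 8) * exp (\<mu> / 2 * t))))"
          by (simp add: B_def)
        have "K * (t powr (b - 1) * exp (- (\<mu> * t))) * norm (gauss_symbol s (1 / (4 * t)) x) \<le>
          K * (t powr (b - 1) * exp (- (\<mu> * t))) * (C * (A powr (- (h + s)) * (D * (exp (1 / 8) * exp (\<mu> / 2 * t)))))"
          using K by (intro mult_left_mono G) auto
        also have "\<dots> = E * A powr (- (h + s)) * (t powr (b - 1) * (exp (- (\<mu> * t)) * exp (\<mu> / 2 * t)))"
          by (simp add: E_def mult_ac)
        also have "exp (- (\<mu> * t)) * exp (\<mu> / 2 * t) = exp (- (\<mu> / 2 * t))"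
          by (simp add: exp_add[symmetric])
        finally show ?thesis using True K by (simp add: norm_mult)
      qed simp
    qed
    also have "\<dots> = E * A powr (- (h + s)) * (Gamma b / (\<mu> / 2) powr b)"
      using hb by (simp add: has_bochner_integral_iff)
    also have "\<dots> = E' * \<mu> powr (- b) * A powr (- (h + s))"
      using \<mu> by (simp add: E'_def powr_divide powr_minus_divide)
    also have "A powr (- (h + s)) = A powr (- p) * A powr (- (s - b))"
      by (simp add: powr_add[symmetric] p_def)
    also have "E' * \<mu> powr (- b) * (A powr (- p) * A powr (- (s - b))) \<le> E' * \<mu> powr (- b) * (A powr (- p) * \<mu> powr (- (s - b)))"
      using E assms(1) s \<mu> A by (intro mult_left_mono powr_mono2') (auto simp: E'_def Gamma_real_pos less_imp_le)
    also have "\<dots> = E' * (\<mu> powr (- b) * \<mu> powr (- (s - b))) * A powr (- p)"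
      by (simp add: mult_ac)
    also have "\<mu> powr (- b) * \<mu> powr (- (s - b)) = \<mu> powr (- s)"
      by (simp add: powr_add[symmetric])
    finally show ?thesis by (simp add: weight_def A_def)
  qed
  moreover have "E' \<ge> 0" using E assms(1) by (auto simp: E'_def Gamma_real_pos less_imp_le)
  ultimately show ?thesis unfolding p_def h_def by blast
qed

subsection \<open>Test functions\<close>

text \<open>Symbols of order \<open>d\<close>: they grow at most like \<open>|x|\<^sup>d\<close>, and so do all their derivatives.\<close>

inductive symbol_fun :: "real \<Rightarrow> real \<Rightarrow> (real^'n \<Rightarrow> real) \<Rightarrow> bool" for \<mu> where
  const: "symbol_fun \<mu> 0 (\<lambda>_. c)"
| coord: "symbol_fun \<mu> 1 (\<lambda>x. x $ k)"
| weight: "symbol_fun \<mu> (- 2 * r) (weight r \<mu>)"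
| add: "symbol_fun \<mu> d f \<Longrightarrow> symbol_fun \<mu> d g \<Longrightarrow> symbol_fun \<mu> d (\<lambda>x. f x + g x)"
| mult: "symbol_fun \<mu> d f \<Longrightarrow> symbol_fun \<mu> e g \<Longrightarrow> symbol_fun \<mu> (d + e) (\<lambda>x. f x * g x)"
| mono: "symbol_fun \<mu> d f \<Longrightarrow> d \<le> e \<Longrightarrow> symbol_fun \<mu> e f"

lemma has_derivative_weight:
  assumes "\<mu> > 0"
  shows "(weight r \<mu> has_derivative (\<lambda>h. - 2 * r * weight (r + 1) \<mu> x * (x \<bullet> h))) (at x)"
proof -
  have pos: "\<mu> + (norm x)\<^sup>2 > 0" using assms by (intro add_pos_nonneg) auto
  have "((\<lambda>u. u powr (- r)) has_real_derivative (- r) * (\<mu> + x \<bullet> x) powr (- r - 1)) (at (\<mu> + x \<bullet> x))"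
    using pos by (intro has_real_derivative_powr) (simp add: power2_norm_eq_inner)
  then have 1: "((\<lambda>u. u powr (- r)) has_derivative (\<lambda>d. d * ((- r) * (\<mu> + x \<bullet> x) powr (- r - 1)))) (at (\<mu> + x \<bullet> x))"
    unfolding has_field_derivative_def by (rule has_derivative_eq_rhs) (auto simp: mult.commute)
  have 2: "((\<lambda>x. \<mu> + x \<bullet> x) has_derivative (\<lambda>h. 0 + (x \<bullet> h + h \<bullet> x))) (at x)"
    by (intro derivative_intros)
  have eq: "weight r \<mu> = (\<lambda>x. (\<mu> + x \<bullet> x) powr (- r))"
    by (auto simp: weight_def power2_norm_eq_inner)
  have e: "- r - 1 = - (r + 1)" by simp
  show ?thesis
    unfolding eq
    by (rule has_derivative_eq_rhs[OF has_derivative_compose[OF 2 1]])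
       (auto simp: weight_def power2_norm_eq_inner inner_commute e simp del: minus_add_distrib)
qed

text \<open>Derivatives of classical symbols gain one order; here only the order d is kept, which is
  enough for integrability and boundedness. This is why the constant derivative of a coordinate is
  raised to order 1.\<close>

lemma symbol_fun_has_derivative:
  fixes f :: "real^'n \<Rightarrow> real"
  assumes "symbol_fun \<mu> d f" "\<mu> > 0"
  shows "\<exists>f'. (\<forall>x. (f has_derivative f' x) (at x)) \<and> (\<forall>k. symbol_fun \<mu> d (\<lambda>x. f' x (axis k 1)))"
  using assms
proof induction
  case (const c)
  show ?case by (intro exI[of _ "\<lambda>_ _. 0"]) (auto intro: symbol_fun.const)
next
  case (coord k)
  have "symbol_fun \<mu> 1 (\<lambda>x. axis j 1 $ k)" for j
    by (rule symbol_fun.mono[OF symbol_fun.const]) simp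
  then show ?case
    by (intro exI[of _ "\<lambda>_ h. h $ k"]) (auto intro!: derivative_eq_intros bounded_linear_imp_has_derivative bounded_linear_vec_nth)
next
  case (weight r)
  have "symbol_fun \<mu> (- 2 * r) (\<lambda>x::real^'n. - 2 * r * weight (r + 1) \<mu> x * (x \<bullet> axis j 1))" for j
  proof -
    have "symbol_fun \<mu> ((0 + - 2 * (r + 1)) + 1) (\<lambda>x::real^'n. - 2 * r * weight (r + 1) \<mu> x * x $ j)"
      by (intro symbol_fun.mult symbol_fun.const symbol_fun.weight symbol_fun.coord)
    then have "symbol_fun \<mu> (- 2 * r) (\<lambda>x::real^'n. - 2 * r * weight (r + 1) \<mu> x * x $ j)"
      by (rule symbol_fun.mono) simp
    then show ?thesis by (simp add: inner_axis)
  qed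
  then show ?case
    using has_derivative_weight[OF weight.prems, of r]
    by (intro exI[of _ "\<lambda>x h. - 2 * r * weight (r + 1) \<mu> x * (x \<bullet> h)"]) auto
next
  case (add d f g)
  then obtain f' g' where "\<And>x. (f has_derivative f' x) (at x)" "\<And>x. (g has_derivative g' x) (at x)"
    "\<And>k. symbol_fun \<mu> d (\<lambda>x. f' x (axis k 1))" "\<And>k. symbol_fun \<mu> d (\<lambda>x. g' x (axis k 1))"
    by blast
  then show ?case
    by (intro exI[of _ "\<lambda>x h. f' x h + g' x h"]) (auto intro!: derivative_intros symbol_fun.add)
next
  case (mult d f e g)
  then obtain f' g' where fg: "\<And>x. (f has_derivative f' x) (at x)" "\<And>x. (g has_derivative g' x) (at x)"
    "\<And>k. symbol_fun \<mu> d (\<lambda>x. f' x (axis k 1))" "\<And>k. symbol_fun \<mu> e (\<lambda>x. g' x (axis k 1))"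
    by blast
  have "symbol_fun \<mu> (d + e) (\<lambda>x. f x * g' x (axis k 1) + f' x (axis k 1) * g x)" for k
    using mult.hyps fg by (intro symbol_fun.add symbol_fun.mult)
  then show ?case using fg(1,2)
    by (intro exI[of _ "\<lambda>x h. f x * g' x h + f' x h * g x"]) (auto intro!: derivative_intros)
next
  case (mono d f e)
  then obtain f' where "\<And>x. (f has_derivative f' x) (at x)" "\<And>k. symbol_fun \<mu> d (\<lambda>x. f' x (axis k 1))"
    by blast
  then show ?case using symbol_fun.mono[OF _ mono.hyps(2)] by (intro exI[of _ f']) auto
qed

lemma symbol_fun_bound:
  fixes f :: "real^'n \<Rightarrow> real"
  assumes "symbol_fun \<mu> d f" "\<mu> > 0"
  shows "\<exists>C\<ge>0. \<forall>x. \<bar>f x\<bar> \<le> C * weight (- d / 2) \<mu> x"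
  using assms
proof induction
  case (const c)
  show ?case by (intro exI[of _ "\<bar>c\<bar>"]) (use const.prems in \<open>auto simp: weight_def add_pos_nonneg add_nonneg_eq_0_iff\<close>)
next
  case (coord k)
  have "\<bar>x $ k\<bar> \<le> weight (- 1 / 2) \<mu> x" for x :: "real^'n"
  proof -
    have "\<bar>x $ k\<bar> \<le> sqrt ((norm x)\<^sup>2)" using component_le_norm_cart[of x k] by simp
    also have "\<dots> \<le> sqrt (\<mu> + (norm x)\<^sup>2)" using coord by (intro real_sqrt_le_mono) auto
    also have "\<dots> = weight (- 1 / 2) \<mu> x" using coord by (simp add: weight_def powr_half_sqrt)
    finally show ?thesis .
  qed
  then show ?case by (intro exI[of _ 1]) auto
next
  case (weight r)
  show ?case by (intro exI[of _ 1]) (auto simp: weight_def)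
next
  case (add d f g)
  then obtain C D where "C \<ge> 0" "D \<ge> 0"
    "\<And>x. \<bar>f x\<bar> \<le> C * weight (- d / 2) \<mu> x" "\<And>x. \<bar>g x\<bar> \<le> D * weight (- d / 2) \<mu> x" by blast
  then show ?case
    by (intro exI[of _ "C + D"] conjI allI) (auto simp: distrib_right intro: order_trans[OF abs_triangle_ineq add_mono])
next
  case (mult d f e g)
  then obtain C D where CD: "C \<ge> 0" "D \<ge> 0"
    "\<And>x. \<bar>f x\<bar> \<le> C * weight (- d / 2) \<mu> x" "\<And>x. \<bar>g x\<bar> \<le> D * weight (- e / 2) \<mu> x" by blast
  have "\<bar>f x * g x\<bar> \<le> C * D * weight (- (d + e) / 2) \<mu> x" for x
  proof -
    have "\<bar>f x * g x\<bar> \<le> (C * weight (- d / 2) \<mu> x) * (D * weight (- e / 2) \<mu> x)"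
      unfolding abs_mult using CD by (intro mult_mono) (auto simp: weight_def)
    also have "\<dots> = C * D * weight (- (d + e) / 2) \<mu> x"
    proof -
      have "- (- (d + e) / 2) = d / 2 + e / 2" by (simp add: field_simps)
      then show ?thesis unfolding weight_def by (simp only: powr_add) (simp add: mult_ac)
    qed
    finally show ?thesis .
  qed
  then show ?case using CD by (intro exI[of _ "C * D"]) auto
next
  case (mono d f e)
  then obtain C where C: "C \<ge> 0" "\<And>x. \<bar>f x\<bar> \<le> C * weight (- d / 2) \<mu> x" by blast
  have "\<bar>f x\<bar> \<le> C * \<mu> powr ((d - e) / 2) * weight (- e / 2) \<mu> x" for x
  proof -
    have "weight (- d / 2) \<mu> x = (\<mu> + (norm x)\<^sup>2) powr ((d - e) / 2) * weight (- e / 2) \<mu> x"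
      by (simp add: weight_def powr_add[symmetric] diff_divide_distrib)
    also have "\<dots> \<le> \<mu> powr ((d - e) / 2) * weight (- e / 2) \<mu> x"
      using mono by (intro mult_right_mono powr_mono2') (auto simp: weight_def)
    finally have "C * weight (- d / 2) \<mu> x \<le> C * (\<mu> powr ((d - e) / 2) * weight (- e / 2) \<mu> x)"
      using C(1) by (rule mult_left_mono)
    then show ?thesis using C(2)[of x] by (simp add: mult.assoc)
  qed
  then show ?case using C(1) by (intro exI[of _ "C * \<mu> powr ((d - e) / 2)"]) auto
qed

lemma weight_nonneg: "weight p \<mu> x \<ge> 0"
  by (simp add: weight_def)

lemma weight_le:
  assumes "p \<ge> 0" "\<mu> > 0"
  shows "weight p \<mu> x \<le> \<mu> powr (- p)"
  unfolding weight_def using assms by (intro powr_mono2') auto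

text \<open>The order \<open>- 2 * p\<close> lies below -n and is inherited by every iterated
  partial derivative, so all of them are integrable and bounded at once.\<close>

lemma space_test_fun_symbol:
  fixes f :: "real^'n \<Rightarrow> real"
  assumes "symbol_fun \<mu> (- 2 * p) f" "\<mu> > 0" "p > real CARD('n) / 2"
  shows "space_test_fun f"
  unfolding space_test_fun_def
proof (intro allI conjI)
  fix ks :: "'n list"
  have sym: "symbol_fun \<mu> (- 2 * p) (iter_partial ks f)"
  proof (induction ks)
    case (Cons k ks)
    then obtain f' where f': "\<And>x. (iter_partial ks f has_derivative f' x) (at x)"
      "symbol_fun \<mu> (- 2 * p) (\<lambda>x. f' x (axis k 1))"
      using symbol_fun_has_derivative[OF Cons assms(2)] by blast
    have "frechet_derivative (iter_partial ks f) (at x) = f' x" for x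
      using frechet_derivative_at[OF f'(1)] by simp
    then show ?case using f'(2) by simp
  qed (use assms in simp)
  show diff: "iter_partial ks f differentiable at x" for x
    using symbol_fun_has_derivative[OF sym assms(2)] by (auto simp: differentiable_def)
  then have "continuous_on UNIV (iter_partial ks f)"
    by (intro differentiable_imp_continuous_on) (auto simp: differentiable_on_def)
  then have m: "iter_partial ks f \<in> borel_measurable borel"
    by (rule borel_measurable_continuous_onI)
  obtain C where C: "C \<ge> 0" "\<And>x. \<bar>iter_partial ks f x\<bar> \<le> C * weight p \<mu> x"
    using symbol_fun_bound[OF sym assms(2)] by auto
  have p: "p > 0" using assms(3) by (auto intro: le_less_trans[rotated])
  have "integrable lborel (\<lambda>x::real^'n. C * weight p \<mu> x)"
    using has_bochner_integral_weight[of p \<mu>, where 'a = "real^'n"] assms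
    by (intro integrable_mult_right) (auto simp: has_bochner_integral_iff)
  then have "integrable lborel (iter_partial ks f)"
    by (rule Bochner_Integration.integrable_bound) (use m C in \<open>auto simp: abs_mult abs_of_nonneg[OF weight_nonneg]\<close>)
  then show "integrable lebesgue (iter_partial ks f)"
    using m by (simp add: integrable_completion)
  have "norm (iter_partial ks f x) \<le> C * \<mu> powr (- p)" for x
    using C(2)[of x] mult_left_mono[OF weight_le[of p \<mu> x] C(1)] p assms(2) by simp
  then show "bounded (range (iter_partial ks f))"
    unfolding bounded_iff by (intro exI[of _ "C * \<mu> powr (- p)"]) blast
qed

section \<open>The time cut-off\<close>

lemma poly_le_exp:
  fixes P :: "real poly"
  assumes "c > 0"
  shows "\<exists>C\<ge>0. \<forall>y\<ge>0. \<bar>poly P y\<bar> \<le> C * exp (c * y)"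
  using assms
proof (induction P arbitrary: c)
  case 0
  then show ?case by (intro exI[of _ 0]) auto
next
  case (pCons a P)
  obtain C where C: "C \<ge> 0" "\<And>y. y \<ge> 0 \<Longrightarrow> \<bar>poly P y\<bar> \<le> C * exp (c / 2 * y)"
    using pCons.IH[of "c / 2"] pCons.prems by auto
  obtain D where D: "D > 0" "\<And>y. y \<ge> 0 \<Longrightarrow> y powr 1 \<le> D * exp (c / 2 * y)"
    using powr_le_exp[of 1 "c / 2"] pCons.prems by auto
  have "\<bar>poly (pCons a P) y\<bar> \<le> (\<bar>a\<bar> + D * C) * exp (c * y)" if "y \<ge> 0" for y
  proof -
    have "\<bar>poly (pCons a P) y\<bar> \<le> \<bar>a\<bar> * 1 + y * \<bar>poly P y\<bar>"
      using that abs_triangle_ineq[of a "y * poly P y"] by (simp add: abs_mult)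
    also have "\<dots> \<le> \<bar>a\<bar> * exp (c * y) + (D * exp (c / 2 * y)) * (C * exp (c / 2 * y))"
      using that pCons.prems C D(2)[OF that] by (intro add_mono mult_mono) auto
    also have "\<dots> = (\<bar>a\<bar> + D * C) * exp (c * y)"
      by (simp add: algebra_simps exp_add[symmetric])
    finally show ?thesis .
  qed
  then show ?case using C D by (intro exI[of _ "\<bar>a\<bar> + D * C"]) auto
qed

text \<open>For \<open>P = 1\<close> this is eta(t/T) with eta(s) = exp (-1/(1-s)) for s < 1. It is
  flat at s = 1 and equals 1/e, not 1, at s = 0, which is the source of the factors
  \<open>exp (- 1)\<close> below.\<close>

definition cutoff :: "real poly \<Rightarrow> real \<Rightarrow> real \<Rightarrow> real" where
  "cutoff P T t = (if t < T then poly P (T / (T - t)) * exp (- (T / (T - t))) else 0)"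

text \<open>With \<open>y = T / (T - t)\<close>, \<open>dy/dt = y\<^sup>2 / T\<close>, so derivatives of \<open>P(y) exp(-y)\<close> keep this shape.\<close>

definition cutoff_pderiv :: "real poly \<Rightarrow> real poly" where
  "cutoff_pderiv P = [:0, 0, 1:] * (pderiv P - P)"

lemma has_real_derivative_cutoff:
  assumes "T > 0"
  shows "(cutoff P T has_real_derivative (1 / T) * cutoff (cutoff_pderiv P) T t) (at t)"
proof -
  consider "t < T" | "t = T" | "t > T" by linarith
  then show ?thesis
  proof cases
    case 1
    define y where "y = T / (T - t)"
    have y: "((\<lambda>t. T / (T - t)) has_real_derivative y\<^sup>2 / T) (at t)"
      using 1 assms by (auto intro!: derivative_eq_intros simp: y_def power2_eq_square)
    have "((\<lambda>t. poly P (T / (T - t))) has_real_derivative poly (pderiv P) y * (y\<^sup>2 / T)) (at t)"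
      by (rule DERIV_chain2[OF _ y]) (simp add: y_def)
    moreover have "((\<lambda>t. exp (- (T / (T - t)))) has_real_derivative - exp (- y) * (y\<^sup>2 / T)) (at t)"
      by (rule DERIV_chain2[OF _ y]) (auto intro!: derivative_eq_intros simp: y_def)
    ultimately have "((\<lambda>t. poly P (T / (T - t)) * exp (- (T / (T - t)))) has_real_derivative
       poly P y * (- exp (- y) * (y\<^sup>2 / T)) + poly (pderiv P) y * (y\<^sup>2 / T) * exp (- y)) (at t)"
      by (intro DERIV_mult'[THEN DERIV_cong]) (auto simp: y_def)
    also have "poly P y * (- exp (- y) * (y\<^sup>2 / T)) + poly (pderiv P) y * (y\<^sup>2 / T) * exp (- y) =
       (1 / T) * cutoff (cutoff_pderiv P) T t"
      using 1 by (simp add: cutoff_def cutoff_pderiv_def y_def[symmetric] power2_eq_square algebra_simps add_divide_distrib diff_divide_distrib)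
    finally have "((\<lambda>t. poly P (T / (T - t)) * exp (- (T / (T - t)))) has_real_derivative (1 / T) * cutoff (cutoff_pderiv P) T t) (at t)" .
    then show ?thesis
      by (rule has_field_derivative_transform_within_open[where S = "{..<T}"])
         (use 1 in \<open>auto simp: cutoff_def\<close>)
  next
    case 2
    \<comment> \<open>Bounding y^2 P(y) instead of P(y) by the exponential makes |P(y)| exp (-y) of
      order y^(-2). To the left of \<open>T\<close> one has y = T/|h|, so this is the quadratic
      smallness that gives derivative 0.\<close>
    obtain C where C: "C \<ge> 0" "\<And>y. y \<ge> 0 \<Longrightarrow> \<bar>poly ([:0, 0, 1:] * P) y\<bar> \<le> C * exp (1 * y)"
      using poly_le_exp[of 1 "[:0, 0, 1:] * P"] by auto
    have "norm (cutoff P T (T + h) - cutoff P T T - h *\<^sub>R 0) \<le> C / T\<^sup>2 * h\<^sup>2" for h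
    proof (cases "h < 0")
      case True
      define y where "y = T / (- h)"
      have y: "y > 0" using True assms by (simp add: y_def divide_pos_pos del: divide_minus_right)
      have "y\<^sup>2 * \<bar>poly P y\<bar> \<le> C * exp y"
        using C(2)[of y] y by (simp add: abs_mult power2_eq_square mult.assoc)
      then have "\<bar>poly P y\<bar> * exp (- y) \<le> C / y\<^sup>2"
        using y by (simp add: exp_minus field_simps)
      also have "C / y\<^sup>2 = C / T\<^sup>2 * h\<^sup>2"
        by (simp add: y_def power_divide)
      finally show ?thesis using True by (simp add: cutoff_def abs_mult y_def)
    qed (use C in \<open>auto simp: cutoff_def\<close>)
    then have "(cutoff P T has_vector_derivative 0) (at T)"
      by (intro has_vector_derivative_quadratic_bound[where d = 1 and C = "C / T\<^sup>2"]) auto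
    then show ?thesis using 2
      by (simp add: has_real_derivative_iff_has_vector_derivative cutoff_def[of _ T T])
  next
    case 3
    have "((\<lambda>_. 0) has_real_derivative (1 / T) * cutoff (cutoff_pderiv P) T t) (at t)"
      using 3 by (simp add: cutoff_def)
    then show ?thesis
      by (rule has_field_derivative_transform_within_open[where S = "{T<..}"])
         (use 3 in \<open>auto simp: cutoff_def\<close>)
  qed
qed

lemma time_test_fun_cutoff:
  assumes "T > 0"
  shows "time_test_fun \<infinity> (cutoff P T)"
  unfolding time_test_fun_def
\<comment> \<open>The compact set may start at 0: vanishing is demanded only for
  \<open>t \<ge> 0\<close>, and at negative times the cut-off need not vanish.\<close>
proof (intro conjI allI exI[of _ "{0..T}"] impI)
  fix k t
  have "\<exists>c Q. (deriv ^^ k) (cutoff P T) = (\<lambda>t. c * cutoff Q T t)"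
  proof (induction k)
    case 0
    show ?case by (intro exI[of _ 1] exI[of _ P]) auto
  next
    case (Suc k)
    then obtain c Q where Q: "(deriv ^^ k) (cutoff P T) = (\<lambda>t. c * cutoff Q T t)" by blast
    have "deriv (\<lambda>t. c * cutoff Q T t) t = c * (1 / T) * cutoff (cutoff_pderiv Q) T t" for t
      by (intro DERIV_imp_deriv) (auto intro!: derivative_eq_intros has_real_derivative_cutoff assms)
    then show ?case by (intro exI[of _ "c * (1 / T)"] exI[of _ "cutoff_pderiv Q"]) (auto simp: Q)
  qed
  then obtain c Q where Q: "(deriv ^^ k) (cutoff P T) = (\<lambda>t. c * cutoff Q T t)" by blast
  show "(deriv ^^ k) (cutoff P T) field_differentiable at t"
    unfolding Q field_differentiable_def
    by (intro exI) (auto intro!: derivative_eq_intros has_real_derivative_cutoff assms)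
qed (auto simp: time_interval_def cutoff_def)

text \<open>With y = T/(T-t) the right-hand side is C exp (-y/p); the remaining factor exp (-(1-1/p)
  y) absorbs the polynomial. \<open>T\<close> enters only through y, so the constant does not depend
  on it.\<close>

lemma cutoff_bound:
  assumes "p > 1"
  shows "\<exists>C\<ge>0. \<forall>T>0. \<forall>t. \<bar>cutoff P T t\<bar> \<le> C * cutoff 1 T t powr (1 / p)"
proof -
  obtain C where C: "C \<ge> 0" "\<And>y. y \<ge> 0 \<Longrightarrow> \<bar>poly P y\<bar> \<le> C * exp ((1 - 1 / p) * y)"
    using poly_le_exp[of "1 - 1 / p" P] assms by auto
  have "\<bar>cutoff P T t\<bar> \<le> C * cutoff 1 T t powr (1 / p)" if "T > 0" for T t
  proof (cases "t < T")
    case True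
    define y where "y = T / (T - t)"
    have "\<bar>poly P y\<bar> * exp (- y) \<le> C * exp ((1 - 1 / p) * y) * exp (- y)"
      using True that by (intro mult_right_mono C) (auto simp: y_def)
    also have "\<dots> = C * exp (- y) powr (1 / p)"
      by (simp add: mult.assoc exp_add[symmetric] exp_powr_real algebra_simps)
    finally show ?thesis using True by (simp add: cutoff_def y_def abs_mult)
  qed (simp add: cutoff_def)
  then show ?thesis using C(1) by blast
qed

text \<open>Up to an error \<open>\<delta>\<^sup>q h\<^sup>q\<close>, Young's inequality dominates \<open>f h\<close> by a multiple of \<open>f\<^sup>p\<close>.\<close>

lemma tendsto_integral_mult_0:
  fixes f :: "'a \<Rightarrow> real" and h g :: "nat \<Rightarrow> 'a \<Rightarrow> real"
  assumes p: "p > 1" "q > 1" "1 / p + 1 / q = 1"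
    and f [measurable]: "f \<in> borel_measurable M" and f0: "\<And>x. f x \<ge> 0" and fp: "integrable M (\<lambda>x. f x powr p)"
    and h [measurable]: "\<And>n. h n \<in> borel_measurable M" and h0: "\<And>n x. h n x \<ge> 0"
    and g: "\<And>n. integrable M (g n)" "\<And>n. (LINT x|M. g n x) \<le> K" "\<And>n x. h n x powr q \<le> g n x"
    and lim: "\<And>x. (\<lambda>n. h n x) \<longlonglongrightarrow> 0"
  shows "(\<lambda>n. LINT x|M. f x * h n x) \<longlonglongrightarrow> 0"
proof (rule tendstoI)
  fix e :: real assume e: "e > 0"
  \<comment> \<open>Chosen so that the error, \<open>\<delta> powr q\<close> times the integral of
    \<open>g n\<close>, costs at most e/2; the summand 1 keeps the denominator positive.\<close>
  define \<delta> where "\<delta> = (e / (2 * (\<bar>K\<bar> + 1))) powr (1 / q)"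
  have \<delta>: "\<delta> > 0" using e by (simp add: \<delta>_def)
  have \<delta>q: "\<delta> powr q = e / (2 * (\<bar>K\<bar> + 1))" using e p by (simp add: \<delta>_def powr_powr)
  define F where "F n x = max 0 (f x * h n x - \<delta> powr q * h n x powr q)" for n x
  have Fle: "F n x \<le> (1 / \<delta>) powr p * f x powr p" for n x
  proof -
    have "f x * h n x = (f x / \<delta>) * (\<delta> * h n x)" using \<delta> by simp
    also have "\<dots> \<le> (f x / \<delta>) powr p / p + (\<delta> * h n x) powr q / q"
      using p \<delta> f0 h0 by (intro Youngs_inequality) auto
    also have "\<dots> \<le> (f x / \<delta>) powr p / 1 + (\<delta> * h n x) powr q / 1"
      using p by (intro add_mono divide_left_mono) auto
    also have "\<dots> = (1 / \<delta>) powr p * f x powr p + \<delta> powr q * h n x powr q"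
      using \<delta> f0[of x] h0[of n x] by (simp add: powr_mult powr_divide)
    finally show ?thesis unfolding F_def by auto
  qed
  have [measurable]: "F n \<in> borel_measurable M" for n unfolding F_def by measurable
  have "(\<lambda>n. LINT x|M. F n x) \<longlonglongrightarrow> (LINT x|M. 0)"
  proof (rule integral_dominated_convergence[where w = "\<lambda>x. (1 / \<delta>) powr p * f x powr p"])
    show "integrable M (\<lambda>x. (1 / \<delta>) powr p * f x powr p)" using fp by (intro integrable_mult_right) auto
    show "AE x in M. norm (F n x) \<le> (1 / \<delta>) powr p * f x powr p" for n
      using Fle by (intro AE_I2) (auto simp: F_def)
    show "AE x in M. (\<lambda>n. F n x) \<longlonglongrightarrow> 0"
    proof (intro AE_I2)
      fix x
      have "(\<lambda>n. f x * h n x) \<longlonglongrightarrow> f x * 0" by (intro tendsto_intros lim)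
      then show "(\<lambda>n. F n x) \<longlonglongrightarrow> 0"
        by (rule Lim_null_comparison[rotated, OF tendsto_eq_rhs]) (use f0 h0 in \<open>auto simp: F_def intro!: always_eventually\<close>)
    qed
  qed auto
  then have "\<forall>\<^sub>F n in sequentially. (LINT x|M. F n x) < e / 2"
    by (intro order_tendstoD) (use e in auto)
  then show "\<forall>\<^sub>F n in sequentially. dist (LINT x|M. f x * h n x) 0 < e"
  proof eventually_elim
    case (elim n)
    have "integrable M (\<lambda>x. (1 / \<delta>) powr p * f x powr p)" using fp by (intro integrable_mult_right) auto
    then have intF: "integrable M (F n)"
      by (rule Bochner_Integration.integrable_bound)
         (use Fle f0 in \<open>auto intro!: AE_I2 simp: F_def abs_mult\<close>)
    have g0: "g n x \<ge> 0" for x using g(3)[of n x] powr_ge_zero order_trans by blast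
    have "(LINT x|M. f x * h n x) \<le> (LINT x|M. F n x + \<delta> powr q * g n x)"
    proof (rule integral_mono')
      show "integrable M (\<lambda>x. F n x + \<delta> powr q * g n x)"
        using intF g(1) by (intro Bochner_Integration.integrable_add integrable_mult_right) auto
      show "f x * h n x \<le> F n x + \<delta> powr q * g n x" for x
        using mult_left_mono[OF g(3)[of n x], of "\<delta> powr q"] by (auto simp: F_def)
      show "0 \<le> F n x + \<delta> powr q * g n x" for x using g0 by (auto simp: F_def)
    qed
    also have "\<dots> = (LINT x|M. F n x) + \<delta> powr q * (LINT x|M. g n x)"
      using intF g(1) by simp
    also have "\<delta> powr q * (LINT x|M. g n x) \<le> \<delta> powr q * (\<bar>K\<bar> + 1)"
      using g(2)[of n] by (intro mult_left_mono) auto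
    also have "\<delta> powr q * (\<bar>K\<bar> + 1) = e / 2" unfolding \<delta>q by (simp add: field_simps)
    finally have "(LINT x|M. f x * h n x) < e" using elim by simp
    moreover have "(LINT x|M. f x * h n x) \<ge> 0" using f0 h0 by (intro Bochner_Integration.integral_nonneg) auto
    ultimately show ?case by (simp add: dist_real_def)
  qed
qed

text \<open>Fatou's lemma: since the weights have a positive limit, a bound on the weighted
  integrals controls the integral of \<open>F\<close> itself.\<close>

lemma integrable_bounded_weights:
  fixes F :: "'a \<Rightarrow> real" and k :: "nat \<Rightarrow> 'a \<Rightarrow> real"
  assumes [measurable]: "F \<in> borel_measurable M" and F0: "\<And>x. F x \<ge> 0"
    and k0: "\<And>n x. k n x \<ge> 0" and int: "\<And>n. integrable M (\<lambda>x. F x * k n x)"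
    and K: "\<forall>\<^sub>F n in sequentially. (LINT x|M. F x * k n x) \<le> K"
    and lim: "\<And>x. x \<in> space M \<Longrightarrow> (\<lambda>n. k n x) \<longlonglongrightarrow> c" and c: "c > 0"
  shows "integrable M F"
proof -
  have "(\<integral>\<^sup>+ x. ennreal (F x * c) \<partial>M) = (\<integral>\<^sup>+ x. liminf (\<lambda>n. ennreal (F x * k n x)) \<partial>M)"
  proof (intro nn_integral_cong)
    fix x assume "x \<in> space M"
    then have "(\<lambda>n. ennreal (F x * k n x)) \<longlonglongrightarrow> ennreal (F x * c)"
      by (intro tendsto_ennrealI tendsto_intros lim)
    then show "ennreal (F x * c) = liminf (\<lambda>n. ennreal (F x * k n x))"
      using lim_imp_Liminf[OF trivial_limit_sequentially] by metis
  qed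
  also have "\<dots> \<le> liminf (\<lambda>n. \<integral>\<^sup>+ x. ennreal (F x * k n x) \<partial>M)"
    using int by (intro nn_integral_liminf) auto
  also have "\<dots> = liminf (\<lambda>n. ennreal (LINT x|M. F x * k n x))"
    using F0 k0 int by (subst nn_integral_eq_integral) auto
  also have "\<dots> \<le> limsup (\<lambda>n. ennreal (LINT x|M. F x * k n x))"
    by (intro Liminf_le_Limsup) auto
  also have "\<dots> \<le> ennreal K"
    using K by (intro Limsup_bounded) (auto elim!: eventually_mono intro: ennreal_leI)
  finally have "(\<integral>\<^sup>+ x. ennreal (F x * c) \<partial>M) < \<infinity>" by (simp add: le_less_trans)
  then have "integrable M (\<lambda>x. F x * c)"
    using F0 c by (intro integrableI_bounded) auto
  then show ?thesis using c by simp
qed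

section \<open>The adjoint operator on products of a time and a space function\<close>

lemma fourier_mult: "fourier (\<lambda>x. c * f x) \<xi> = c * fourier f \<xi>"
  \<comment> \<open>The scalar comes out for every \<open>f\<close>: if the integrand is not
    integrable, both sides are 0 by convention.\<close>
  unfolding fourier_def by (simp add: mult.left_commute[of _ c])

lemma frac_laplacian_mult: "frac_laplacian s (\<lambda>x. c * f x) x = c * frac_laplacian s f x"
  unfolding frac_laplacian_def inverse_fourier_def fourier_mult by (simp add: mult.left_commute[of _ c])

lemma time_deriv_of_real:
  assumes "(f has_real_derivative f') (at t)"
  shows "time_deriv (\<lambda>s x. complex_of_real (f s) * c x) t x = of_real f' * c x"
proof -
  have "((\<lambda>s. complex_of_real (f s) * c x) has_vector_derivative of_real f' * c x) (at t)"
    using assms by (intro has_vector_derivative_mult_left has_vector_derivative_of_real)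
      (simp add: has_real_derivative_iff_has_vector_derivative)
  then show ?thesis unfolding time_deriv_def by (rule vector_derivative_at)
qed

lemma adjoint_operator_product:
  fixes \<phi> :: "real^'n \<Rightarrow> real"
  assumes "\<And>t. (\<eta> has_real_derivative \<eta>' t) (at t)" "\<And>t. (\<eta>' has_real_derivative \<eta>'' t) (at t)"
  defines "L \<equiv> \<lambda>s. frac_laplacian s (\<lambda>x. of_real (\<phi> x))"
  shows "adjoint_operator \<sigma> \<sigma>\<^sub>1 \<sigma>\<^sub>2 (\<lambda>t x. complex_of_real (\<eta> t * \<phi> x)) t x =
    of_real (\<eta>'' t * \<phi> x) - of_real (\<eta>' t) * L \<sigma>\<^sub>1 x - of_real (\<eta>' t) * L \<sigma>\<^sub>2 x + of_real (\<eta> t) * L \<sigma> x"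
proof -
  have "time_deriv (\<lambda>t x. complex_of_real (\<eta> t * \<phi> x)) = (\<lambda>t x. of_real (\<eta>' t) * of_real (\<phi> x))"
    unfolding of_real_mult by (intro ext time_deriv_of_real assms)
  moreover have "frac_laplacian s (\<lambda>x. complex_of_real (\<eta> t * \<phi> x)) x = of_real (\<eta> t) * L s x" for s t x
    unfolding of_real_mult L_def by (rule frac_laplacian_mult)
  then have "(\<lambda>t. frac_laplacian s (\<lambda>x. complex_of_real (\<eta> t * \<phi> x))) = (\<lambda>t x. of_real (\<eta> t) * L s x)" for s
    by (intro ext)
  ultimately show ?thesis
    unfolding adjoint_operator_def
    by (simp add: time_deriv_of_real[OF assms(1)] time_deriv_of_real[OF assms(2)] del: of_real_mult)
       (simp add: fun_eq_iff)
qed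

section \<open>The dilated space weight\<close>

definition scaled_weight :: "real \<Rightarrow> real \<Rightarrow> 'a::euclidean_space \<Rightarrow> real" where
  "scaled_weight q R x = (R\<^sup>2) powr q * weight q (R\<^sup>2) x"

lemma scaled_weight_nonneg: "scaled_weight q R x \<ge> 0"
  by (simp add: scaled_weight_def weight_nonneg)

text \<open>So \<open>scaled_weight\<close> is phi(x/R). Its definition as a constant multiple of
  \<open>weight\<close> lets the fractional Laplacian estimates transfer by linearity alone.\<close>

lemma scaled_weight_eq:
  assumes "R > 0"
  shows "scaled_weight q R x = (1 + (norm x / R)\<^sup>2) powr (- q)"
proof -
  have "(R\<^sup>2 + (norm x)\<^sup>2) = R\<^sup>2 * (1 + (norm x / R)\<^sup>2)"
    using assms by (simp add: power_divide field_simps)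
  then show ?thesis
    using assms by (simp add: scaled_weight_def weight_def powr_mult powr_minus_divide)
qed

lemma scaled_weight_le_1:
  assumes "R > 0" "q \<ge> 0"
  shows "scaled_weight q R x \<le> 1"
  using powr_mono2'[of "- q" 1 "1 + (norm x / R)\<^sup>2"] assms by (simp add: scaled_weight_eq)

lemma scaled_weight_tendsto: "(\<lambda>n. scaled_weight q (real (Suc n)) x) \<longlonglongrightarrow> 1"
proof -
  have "(\<lambda>n. inverse (real (Suc n))) \<longlonglongrightarrow> 0" by (rule LIMSEQ_inverse_real_of_nat)
  then have "(\<lambda>n. (1 + (norm x * inverse (real (Suc n)))\<^sup>2) powr (- q)) \<longlonglongrightarrow> (1 + (norm x * 0)\<^sup>2) powr (- q)"
    by (intro tendsto_intros) auto
  then show ?thesis by (simp add: scaled_weight_eq divide_inverse)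
qed

lemma cutoff_nonneg: "T > 0 \<Longrightarrow> cutoff 1 T t \<ge> 0"
  by (simp add: cutoff_def)

lemma cutoff_le_1: "T > 0 \<Longrightarrow> cutoff 1 T t \<le> 1"
  by (simp add: cutoff_def)

lemma cutoff_eq_0: "t \<ge> T \<Longrightarrow> cutoff P T t = 0"
  by (simp add: cutoff_def)

lemma cutoff_tendsto:
  assumes "filterlim T at_top F"
  shows "((\<lambda>n. cutoff 1 (T n) t) \<longlongrightarrow> exp (- 1)) F"
proof -
  have "((\<lambda>n. exp (- (1 / (1 - t / T n)))) \<longlongrightarrow> exp (- (1 / (1 - 0)))) F"
    by (intro tendsto_intros real_tendsto_divide_at_top[OF tendsto_const assms]) auto
  moreover have "\<forall>\<^sub>F n in F. T n > max 0 t"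
    by (intro eventually_compose_filterlim[OF eventually_gt_at_top assms])
  then have "\<forall>\<^sub>F n in F. exp (- (1 / (1 - t / T n))) = cutoff 1 (T n) t"
    by eventually_elim (auto simp: cutoff_def field_simps)
  ultimately have "((\<lambda>n. cutoff 1 (T n) t) \<longlongrightarrow> exp (- (1 / (1 - 0)))) F"
    by (rule Lim_transform_eventually)
  then show ?thesis by simp
qed

lemma measurable_cutoff [measurable]: "cutoff 1 T \<in> borel_measurable borel"
  unfolding cutoff_def[abs_def] poly_1 by measurable

lemma measurable_scaled_weight [measurable]: "scaled_weight q R \<in> borel_measurable borel"
  unfolding scaled_weight_def[abs_def] by measurable

lemma space_test_fun_scaled_weight:
  assumes "R > 0" "q > real CARD('n) / 2"
  shows "space_test_fun (scaled_weight q R :: real^'n \<Rightarrow> real)"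
proof (rule space_test_fun_symbol[where \<mu> = "R\<^sup>2" and p = q])
  have "symbol_fun (R\<^sup>2) (0 + - 2 * q) (\<lambda>x::real^'n. (R\<^sup>2) powr q * weight q (R\<^sup>2) x)"
    by (intro symbol_fun.mult symbol_fun.const symbol_fun.weight)
  then show "symbol_fun (R\<^sup>2) (- 2 * q) (scaled_weight q R :: real^'n \<Rightarrow> real)"
    by (simp add: scaled_weight_def[abs_def])
qed (use assms in auto)

text \<open>The space factor keeps the power 1, since the fractional Laplacians are bounded by phi
  itself. The time factor drops to the power 1/p, which is all that the derivatives of the cut-off
  allow and all that Young's inequality will need.\<close>

lemma adjoint_operator_test_bound:
  fixes \<sigma> \<sigma>\<^sub>1 \<sigma>\<^sub>2 b p :: real
  assumes "p > 1" "b > 0" "\<sigma>\<^sub>1 = 0 \<or> b \<le> \<sigma>\<^sub>1" "b \<le> \<sigma>\<^sub>2" "b \<le> \<sigma>" "\<sigma>\<^sub>1 < \<sigma> / 2" "\<sigma>\<^sub>1 \<le> \<sigma>\<^sub>2"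
  defines "q \<equiv> real CARD('n) / 2 + b"
  shows "\<exists>C\<ge>0. \<forall>R\<ge>1. \<forall>t. \<forall>x::real^'n.
    norm (adjoint_operator \<sigma> \<sigma>\<^sub>1 \<sigma>\<^sub>2 (\<lambda>t x. complex_of_real (cutoff 1 (R powr (2 * (\<sigma> - \<sigma>\<^sub>1))) t * scaled_weight q R x)) t x) \<le>
      C * R powr (- 2 * \<sigma>) * cutoff 1 (R powr (2 * (\<sigma> - \<sigma>\<^sub>1))) t powr (1 / p) * scaled_weight q R x"
proof -
  have L: "\<exists>C\<ge>0. \<forall>R\<ge>1. \<forall>x::real^'n. norm (frac_laplacian s (\<lambda>x. of_real (scaled_weight q R x)) x) \<le> C * R powr (- 2 * s) * scaled_weight q R x"
    if s: "s = 0 \<or> b \<le> s" for s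
  proof -
    obtain C where C: "C \<ge> 0" "\<And>\<mu> x::real^'n. \<mu> > 0 \<Longrightarrow> norm (frac_laplacian s (\<lambda>x. of_real (weight q \<mu> x)) x) \<le>
      C * \<mu> powr (- s) * weight q \<mu> x"
      using frac_laplacian_weight_bound[OF assms(2) s, where 'n = 'n] unfolding q_def by blast
    have "norm (frac_laplacian s (\<lambda>x. of_real (scaled_weight q R x)) x) \<le> C * R powr (- 2 * s) * scaled_weight q R x"
      if "R \<ge> 1" for R and x :: "real^'n"
    proof -
      have "norm (frac_laplacian s (\<lambda>x. of_real (scaled_weight q R x)) x) = (R\<^sup>2) powr q * norm (frac_laplacian s (\<lambda>x. of_real (weight q (R\<^sup>2) x)) x)"
        unfolding scaled_weight_def of_real_mult frac_laplacian_mult by (simp add: norm_mult)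
      also have "\<dots> \<le> (R\<^sup>2) powr q * (C * (R\<^sup>2) powr (- s) * weight q (R\<^sup>2) x)"
        using that by (intro mult_left_mono C) auto
      also have "(R\<^sup>2) powr (- s) = R powr (- 2 * s)"
      proof -
        have "R\<^sup>2 = R powr 2" using that by simp
        then show ?thesis by (simp only: powr_powr) simp
      qed
      finally show ?thesis by (simp add: scaled_weight_def mult_ac)
    qed
    then show ?thesis using C(1) by blast
  qed
  obtain C1 where C1: "C1 \<ge> 0" "\<And>R x::real^'n. R \<ge> 1 \<Longrightarrow> norm (frac_laplacian \<sigma>\<^sub>1 (\<lambda>x. of_real (scaled_weight q R x)) x) \<le> C1 * R powr (- 2 * \<sigma>\<^sub>1) * scaled_weight q R x"
    using L[of \<sigma>\<^sub>1] assms by blast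
  obtain C2 where C2: "C2 \<ge> 0" "\<And>R x::real^'n. R \<ge> 1 \<Longrightarrow> norm (frac_laplacian \<sigma>\<^sub>2 (\<lambda>x. of_real (scaled_weight q R x)) x) \<le> C2 * R powr (- 2 * \<sigma>\<^sub>2) * scaled_weight q R x"
    using L[of \<sigma>\<^sub>2] assms by blast
  obtain C3 where C3: "C3 \<ge> 0" "\<And>R x::real^'n. R \<ge> 1 \<Longrightarrow> norm (frac_laplacian \<sigma> (\<lambda>x. of_real (scaled_weight q R x)) x) \<le> C3 * R powr (- 2 * \<sigma>) * scaled_weight q R x"
    using L[of \<sigma>] assms by blast
  define P1 where "P1 = cutoff_pderiv 1"
  define P2 where "P2 = cutoff_pderiv P1"
  obtain D1 where D1: "D1 \<ge> 0" "\<And>T t. T > 0 \<Longrightarrow> \<bar>cutoff P1 T t\<bar> \<le> D1 * cutoff 1 T t powr (1 / p)"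
    using cutoff_bound[OF assms(1)] by blast
  obtain D2 where D2: "D2 \<ge> 0" "\<And>T t. T > 0 \<Longrightarrow> \<bar>cutoff P2 T t\<bar> \<le> D2 * cutoff 1 T t powr (1 / p)"
    using cutoff_bound[OF assms(1)] by blast
  have "norm (adjoint_operator \<sigma> \<sigma>\<^sub>1 \<sigma>\<^sub>2 (\<lambda>t x. complex_of_real (cutoff 1 (R powr (2 * (\<sigma> - \<sigma>\<^sub>1))) t * scaled_weight q R x)) t x) \<le>
      (D2 + D1 * C1 + D1 * C2 + C3) * R powr (- 2 * \<sigma>) * cutoff 1 (R powr (2 * (\<sigma> - \<sigma>\<^sub>1))) t powr (1 / p) * scaled_weight q R x"
    if R: "R \<ge> 1" for R t and x :: "real^'n"
  proof -
    define T where "T = R powr (2 * (\<sigma> - \<sigma>\<^sub>1))"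
    have T: "T > 0" using R by (simp add: T_def)
    have iT: "1 / T = R powr (- 2 * (\<sigma> - \<sigma>\<^sub>1))"
      by (simp add: T_def powr_minus_divide[symmetric] algebra_simps)
    define \<eta> where "\<eta> = cutoff 1 T t powr (1 / p)"
    define \<phi> where "\<phi> = scaled_weight q R x"
    have pos: "\<eta> \<ge> 0" "\<phi> \<ge> 0" "R powr a \<ge> 0" for a by (auto simp: \<eta>_def \<phi>_def scaled_weight_nonneg)
    \<comment> \<open>All powers of \<open>R\<close> that occur are at most -2 sigma, and
      \<open>R \<ge> 1\<close> turns this into a common bound. The second time derivative brings -4
      (sigma - sigma_1), which is where sigma_1 < sigma/2 enters.\<close>
    have mono: "R powr a * R powr c \<le> R powr (- 2 * \<sigma>)" if "a + c \<le> - 2 * \<sigma>" for a c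
      using R that by (simp add: powr_add[symmetric] powr_mono)
    have d1: "(cutoff 1 T has_real_derivative (1 / T) * cutoff P1 T t) (at t)" for t
      unfolding P1_def by (rule has_real_derivative_cutoff[OF T])
    have d2: "((\<lambda>t. (1 / T) * cutoff P1 T t) has_real_derivative (1 / T) * ((1 / T) * cutoff P2 T t)) (at t)" for t
      unfolding P2_def by (intro DERIV_cmult has_real_derivative_cutoff[OF T])
    have e1: "\<bar>(1 / T) * cutoff P1 T t\<bar> \<le> R powr (- 2 * (\<sigma> - \<sigma>\<^sub>1)) * (D1 * \<eta>)"
      using D1(2)[OF T, of t] T unfolding iT \<eta>_def by (simp add: abs_mult mult_left_mono)
    have e2: "\<bar>(1 / T) * ((1 / T) * cutoff P2 T t)\<bar> \<le> R powr (- 2 * (\<sigma> - \<sigma>\<^sub>1)) * (R powr (- 2 * (\<sigma> - \<sigma>\<^sub>1)) * (D2 * \<eta>))"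
      using D2(2)[OF T, of t] T unfolding iT \<eta>_def by (simp add: abs_mult mult_left_mono)
    have e3: "\<bar>cutoff 1 T t\<bar> \<le> \<eta>"
    proof -
      have "cutoff 1 T t powr 1 \<le> cutoff 1 T t powr (1 / p)"
        using cutoff_nonneg[OF T, of t] cutoff_le_1[OF T, of t] assms(1) by (intro powr_mono') auto
      then show ?thesis using cutoff_nonneg[OF T, of t] by (simp add: \<eta>_def)
    qed
    have "norm (adjoint_operator \<sigma> \<sigma>\<^sub>1 \<sigma>\<^sub>2 (\<lambda>t x. complex_of_real (cutoff 1 T t * scaled_weight q R x)) t x) \<le>
       \<bar>(1 / T) * ((1 / T) * cutoff P2 T t)\<bar> * \<phi>
       + \<bar>(1 / T) * cutoff P1 T t\<bar> * norm (frac_laplacian \<sigma>\<^sub>1 (\<lambda>x. of_real (scaled_weight q R x)) x)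
       + \<bar>(1 / T) * cutoff P1 T t\<bar> * norm (frac_laplacian \<sigma>\<^sub>2 (\<lambda>x. of_real (scaled_weight q R x)) x)
       + \<bar>cutoff 1 T t\<bar> * norm (frac_laplacian \<sigma> (\<lambda>x. of_real (scaled_weight q R x)) x)"
      unfolding adjoint_operator_product[OF d1 d2]
      by (rule order_trans[OF norm_triangle_ineq] add_mono order_trans[OF norm_triangle_ineq4])+
         (use pos(2) in \<open>simp_all only: norm_mult norm_of_real abs_mult \<phi>_def abs_of_nonneg order_refl\<close>)
    also have "\<dots> \<le> R powr (- 2 * (\<sigma> - \<sigma>\<^sub>1)) * (R powr (- 2 * (\<sigma> - \<sigma>\<^sub>1)) * (D2 * \<eta>)) * \<phi>
       + R powr (- 2 * (\<sigma> - \<sigma>\<^sub>1)) * (D1 * \<eta>) * (C1 * R powr (- 2 * \<sigma>\<^sub>1) * \<phi>)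
       + R powr (- 2 * (\<sigma> - \<sigma>\<^sub>1)) * (D1 * \<eta>) * (C2 * R powr (- 2 * \<sigma>\<^sub>2) * \<phi>)
       + \<eta> * (C3 * R powr (- 2 * \<sigma>) * \<phi>)"
      using C1 C2 C3 D1(1) D2(1) pos R unfolding \<phi>_def
      by (intro add_mono mult_mono e1 e2 e3 order_refl) auto
    also have "\<dots> = (R powr (- 2 * (\<sigma> - \<sigma>\<^sub>1)) * R powr (- 2 * (\<sigma> - \<sigma>\<^sub>1))) * (D2 * \<eta> * \<phi>)
       + (R powr (- 2 * (\<sigma> - \<sigma>\<^sub>1)) * R powr (- 2 * \<sigma>\<^sub>1)) * (D1 * C1 * \<eta> * \<phi>)
       + (R powr (- 2 * (\<sigma> - \<sigma>\<^sub>1)) * R powr (- 2 * \<sigma>\<^sub>2)) * (D1 * C2 * \<eta> * \<phi>)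
       + R powr (- 2 * \<sigma>) * (C3 * \<eta> * \<phi>)"
      by (simp only: mult_ac)
    also have "\<dots> \<le> R powr (- 2 * \<sigma>) * (D2 * \<eta> * \<phi>) + R powr (- 2 * \<sigma>) * (D1 * C1 * \<eta> * \<phi>)
       + R powr (- 2 * \<sigma>) * (D1 * C2 * \<eta> * \<phi>) + R powr (- 2 * \<sigma>) * (C3 * \<eta> * \<phi>)"
      using C1(1) C2(1) C3(1) D1(1) D2(1) pos assms
      by (intro add_mono mult_right_mono mono order_refl mult_nonneg_nonneg) (auto simp: algebra_simps)
    also have "\<dots> = (D2 + D1 * C1 + D1 * C2 + C3) * R powr (- 2 * \<sigma>) * \<eta> * \<phi>"
      by (simp only: distrib_left distrib_right mult_ac)
    finally show ?thesis by (simp only: T_def \<eta>_def \<phi>_def)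
  qed
  moreover have "D2 + D1 * C1 + D1 * C2 + C3 \<ge> 0"
    using C1(1) C2(1) C3(1) D1(1) D2(1) by auto
  ultimately show ?thesis by blast
qed

subsection \<open>The weak formulation on the test functions\<close>

abbreviation half_space :: "(real \<times> (real^'n)) measure" where
  "half_space \<equiv> lebesgue_on (time_interval \<infinity> \<times> UNIV)"

definition test_fun :: "real \<Rightarrow> real \<Rightarrow> real \<Rightarrow> real \<times> (real^'n) \<Rightarrow> real" where
  "test_fun q T R z = cutoff 1 T (fst z) * scaled_weight q R (snd z)"

definition dual_fun :: "real \<Rightarrow> real \<Rightarrow> real \<Rightarrow> real \<Rightarrow> real \<times> (real^'n) \<Rightarrow> real" where
  "dual_fun p q T R z = cutoff 1 T (fst z) powr (1 / p) * scaled_weight q R (snd z)"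

text \<open>An integrable majorant for powers of \<open>dual_fun\<close> with exponent at least 1.
  On the half-space it lives on a slab of height \<open>T\<close>, so its integral is of order T
  R^n.\<close>

definition slab_weight :: "real \<Rightarrow> real \<Rightarrow> real \<Rightarrow> real \<times> (real^'n) \<Rightarrow> real" where
  "slab_weight q T R z = indicator {..<T} (fst z) * scaled_weight q R (snd z)"

lemma slab_weight_nonneg: "slab_weight q T R z \<ge> 0"
  by (simp add: slab_weight_def scaled_weight_nonneg)

lemma dual_fun_nonneg: "dual_fun p q T R z \<ge> 0"
  by (simp add: dual_fun_def scaled_weight_nonneg)

lemma test_fun_nonneg: "T > 0 \<Longrightarrow> test_fun q T R z \<ge> 0"
  by (simp add: test_fun_def scaled_weight_nonneg cutoff_nonneg)

lemma dual_fun_le_slab_weight: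
  assumes "T > 0" "R > 0" "q \<ge> 0" "p > 1" "r \<ge> 1"
  shows "dual_fun p q T R z powr r \<le> slab_weight q T R z"
proof (cases "fst z < T")
  case True
  have "dual_fun p q T R z \<le> 1 * scaled_weight q R (snd z)"
    unfolding dual_fun_def using assms cutoff_nonneg[OF assms(1)] cutoff_le_1[OF assms(1)]
    by (intro mult_right_mono powr_le1 scaled_weight_nonneg) auto
  then have "dual_fun p q T R z powr r \<le> scaled_weight q R (snd z) powr r"
    using assms by (intro powr_mono2) (auto simp: dual_fun_nonneg)
  also have "\<dots> \<le> scaled_weight q R (snd z) powr 1"
    using assms scaled_weight_nonneg scaled_weight_le_1 by (intro powr_mono') auto
  finally show ?thesis using True by (simp add: slab_weight_def scaled_weight_nonneg)
qed (simp add: dual_fun_def slab_weight_def cutoff_eq_0)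

text \<open>The splitting w = w^(1/p) w^(1/r) of the space weight pairs \<open>v\<close> with the
  p-th root of \<open>test_fun\<close> and leaves A w^(1/r), whose r-th power is A^r w.\<close>

lemma Young_dual_fun:
  assumes "p > 1" "r > 1" "1 / p + 1 / r = 1" "A \<ge> 0" "v \<ge> 0" "T > 0"
  shows "v * (A * dual_fun p q T R z) \<le> v powr p * test_fun q T R z / p + A powr r * slab_weight q T R z / r"
proof (cases "fst z < T")
  case True
  define c where "c = cutoff 1 T (fst z)"
  define w where "w = scaled_weight q R (snd z)"
  have cw: "c \<ge> 0" "w \<ge> 0" using assms by (auto simp: c_def w_def cutoff_nonneg scaled_weight_nonneg)
  have "w = w powr (1 / p) * w powr (1 / r)"
    using cw assms(3) by (simp add: powr_add[symmetric])
  then have "v * (A * (c powr (1 / p) * w)) = (v * (c * w) powr (1 / p)) * (A * w powr (1 / r))"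
    using cw by (simp add: powr_mult)
  also have "\<dots> \<le> (v * (c * w) powr (1 / p)) powr p / p + (A * w powr (1 / r)) powr r / r"
    using assms by (intro Youngs_inequality) auto
  also have "\<dots> = v powr p * (c * w) / p + A powr r * w / r"
    using assms cw by (simp add: powr_mult powr_powr)
  finally show ?thesis using True by (simp add: dual_fun_def test_fun_def slab_weight_def c_def w_def)
qed (simp add: dual_fun_def test_fun_def slab_weight_def cutoff_eq_0)

lemma measurable_test_fun [measurable]: "test_fun q T R \<in> borel_measurable (borel :: (real \<times> (real^'n)) measure)"
  unfolding test_fun_def[abs_def] borel_prod[symmetric] by measurable

lemma measurable_dual_fun [measurable]: "dual_fun p q T R \<in> borel_measurable (borel :: (real \<times> (real^'n)) measure)"
  unfolding dual_fun_def[abs_def] borel_prod[symmetric] by measurable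

lemma measurable_slab_weight [measurable]: "slab_weight q T R \<in> borel_measurable (borel :: (real \<times> (real^'n)) measure)"
  unfolding slab_weight_def[abs_def] borel_prod[symmetric] by measurable

lemma borel_measurable_half_space:
  assumes "f \<in> borel_measurable (borel :: (real \<times> (real^'n)) measure)"
  shows "f \<in> borel_measurable half_space"
proof -
  have "f \<in> borel_measurable lebesgue"
    using assms by (intro measurable_completion) simp
  then show ?thesis by (rule measurable_restrict_space1)
qed

lemma has_bochner_integral_scaled_weight:
  assumes "q > real CARD('n) / 2"
  shows "\<exists>K\<ge>0. \<forall>R>0. has_bochner_integral lborel (scaled_weight q R :: real^'n \<Rightarrow> real) (K * R powr CARD('n))"
proof -
  define h where "h = real CARD('n) / 2"
  have q: "q > 0" using assms by (auto intro: le_less_trans[rotated])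
  define K where "K = pi powr h / Gamma q * Gamma (q - h)"
  have "has_bochner_integral lborel (scaled_weight q R :: real^'n \<Rightarrow> real) (K * R powr CARD('n))" if "R > 0" for R
  proof -
    have "has_bochner_integral lborel (scaled_weight q R :: real^'n \<Rightarrow> real) ((R\<^sup>2) powr q * (K * (R\<^sup>2) powr (h - q)))"
      using has_bochner_integral_weight[of q "R\<^sup>2", where 'a = "real^'n"] assms that
      unfolding scaled_weight_def[abs_def] h_def K_def by (intro has_bochner_integral_mult_right) auto
    also have "(R\<^sup>2) powr q * (K * (R\<^sup>2) powr (h - q)) = K * (R\<^sup>2) powr h"
      using that by (simp add: powr_diff)
    also have "(R\<^sup>2) powr h = (R powr 2) powr h" using that by simp
    also have "\<dots> = R powr CARD('n)" unfolding powr_powr by (simp add: h_def)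
    finally show ?thesis .
  qed
  moreover have "K \<ge> 0" using q assms by (auto simp: K_def h_def Gamma_real_pos less_imp_le)
  ultimately show ?thesis by blast
qed

lemma has_bochner_integral_slab_weight:
  assumes f: "has_bochner_integral lborel (scaled_weight q R :: real^'n \<Rightarrow> real) c" and T: "T \<ge> 0"
  shows "has_bochner_integral half_space (slab_weight q T R :: real \<times> (real^'n) \<Rightarrow> real) (T * c)"
proof -
  let ?w = "scaled_weight q R :: real^'n \<Rightarrow> real"
  define S where "S = time_interval \<infinity> \<times> (UNIV :: (real^'n) set)"
  have S: "S = {0..} \<times> UNIV" by (auto simp: S_def time_interval_def)
  have "closed S" unfolding S by (intro closed_Times) auto
  then have S': "S \<inter> space lebesgue \<in> sets lebesgue" by simp
  \<comment> \<open>Within t >= 0 the condition t < T becomes membership in [0,T). Fubini is applied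
    to this Borel function on \<open>lborel\<close>, and the result is carried over to the
    completion.\<close>
  define g where "g = (\<lambda>(t, x::real^'n). indicator {0..<T} t * ?w x)"
  have ge: "indicator S z *\<^sub>R slab_weight q T R z = g z" for z
    unfolding S by (cases z) (auto simp: g_def slab_weight_def indicator_def)
  have gm: "g \<in> borel_measurable borel"
    unfolding g_def borel_prod[symmetric] by measurable
  have int: "integrable (lborel \<Otimes>\<^sub>M lborel) (\<lambda>(t, x). indicator {0..<T} t * ?w x)"
  proof (rule lborel_pair.Fubini_integrable)
    show "(\<lambda>(t, x). indicator {0..<T} t * ?w x) \<in> borel_measurable (lborel \<Otimes>\<^sub>M lborel)" by measurable
    show "integrable lborel (\<lambda>t. LINT x|lborel. norm (case (t, x) of (t, x) \<Rightarrow> indicator {0..<T} t * ?w x))"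
      using T by (simp add: abs_mult abs_of_nonneg[OF scaled_weight_nonneg] integrable_indicator_iff)
    show "AE t in lborel. integrable lborel (\<lambda>x. case (t, x) of (t, x) \<Rightarrow> indicator {0..<T} t * ?w x)"
      using f by (auto simp: has_bochner_integral_iff)
  qed
  have "integral\<^sup>L (lborel \<Otimes>\<^sub>M lborel) (\<lambda>(t, x). indicator {0..<T} t * ?w x) = (LINT t|lborel. LINT x|lborel. indicator {0..<T} t * ?w x)"
    using lborel_pair.integral_fst[OF int] by simp
  also have "\<dots> = T * c" using f T by (simp add: has_bochner_integral_iff)
  finally have "has_bochner_integral lborel g (T * c)"
    using int by (simp add: has_bochner_integral_iff lborel_prod g_def)
  then have "has_bochner_integral lebesgue g (T * c)"
    using gm by (simp add: has_bochner_integral_iff integrable_completion integral_completion)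
  then show ?thesis
    unfolding has_bochner_integral_iff S_def[symmetric] integrable_restrict_space[OF S'] integral_restrict_space[OF S'] ge .
qed

lemma continuous_L2_curve_measurable:
  assumes "continuous_L2_curve \<infinity> (u :: real \<Rightarrow> real^'n \<Rightarrow> complex)"
  shows "(\<lambda>z. norm (u (fst z) (snd z))) \<in> borel_measurable half_space"
  using assms unfolding continuous_L2_curve_def by (auto simp: case_prod_unfold intro: borel_measurable_norm)

text \<open>The identity equates the left-hand side, a real number, with a complex integral; a real
  number is at most its modulus, hence at most the integral of the norms. Integrability on the right
  follows by Young's inequality from that of |u|^p times the test function, which is part of the
  notion of weak solution.\<close>

lemma weak_solution_test_inequality:
  fixes u :: "real \<Rightarrow> real^'n \<Rightarrow> complex"
  assumes weak: "global_weak_solution \<sigma> \<sigma>\<^sub>1 \<sigma>\<^sub>2 p \<epsilon> u1 u"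
    and p: "p > 1" "r > 1" "1 / p + 1 / r = 1" and q: "q > real CARD('n) / 2" and T: "T > 0" and R: "R > 0" and A: "A \<ge> 0"
    and bound: "\<And>t (x::real^'n). norm (adjoint_operator \<sigma> \<sigma>\<^sub>1 \<sigma>\<^sub>2 (\<lambda>t x. complex_of_real (cutoff 1 T t * scaled_weight q R x)) t x)
        \<le> A * dual_fun p q T R (t, x)"
  defines "U \<equiv> \<lambda>z. norm (u (fst z) (snd z))"
  shows "integrable half_space (\<lambda>z. U z powr p * test_fun q T R z)"
    and "integrable half_space (\<lambda>z. U z * (A * dual_fun p q T R z))"
    and "(LINT z|half_space. U z powr p * test_fun q T R z) + \<epsilon> * exp (- 1) * (LINT x|lebesgue. u1 x * scaled_weight q R x)
       \<le> (LINT z|half_space. U z * (A * dual_fun p q T R z))"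
proof -
  let ?\<psi> = "\<lambda>t x. complex_of_real (cutoff 1 T t * scaled_weight q R x)"
  have [measurable]: "U \<in> borel_measurable half_space"
    unfolding U_def using weak by (intro continuous_L2_curve_measurable) (simp add: global_weak_solution_def weak_solution_def)
  have [measurable]: "dual_fun p q T R \<in> borel_measurable half_space"
    by (intro borel_measurable_half_space) measurable
  have eq: "(\<lambda>(t, x). complex_of_real (norm (u t x) powr p) * ?\<psi> t x) = (\<lambda>z. complex_of_real (U z powr p * test_fun q T R z))"
    by (auto simp: U_def test_fun_def)
  have "integrable half_space (\<lambda>(t, x). complex_of_real (norm (u t x) powr p) * ?\<psi> t x) \<and>
     (LINT (t, x)|half_space. complex_of_real (norm (u t x) powr p) * ?\<psi> t x)
              + complex_of_real \<epsilon> * (LINT x|lebesgue. complex_of_real (u1 x) * ?\<psi> 0 x)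
            = (LINT (t, x)|half_space. u t x * adjoint_operator \<sigma> \<sigma>\<^sub>1 \<sigma>\<^sub>2 ?\<psi> t x)"
    using weak time_test_fun_cutoff[OF T, of 1] space_test_fun_scaled_weight[OF R q]
    unfolding global_weak_solution_def weak_solution_def Let_def by blast
  then have int: "integrable half_space (\<lambda>z. complex_of_real (U z powr p * test_fun q T R z))"
    and ident: "(LINT z|half_space. complex_of_real (U z powr p * test_fun q T R z))
              + complex_of_real \<epsilon> * (LINT x|lebesgue. complex_of_real (u1 x) * ?\<psi> 0 x)
            = (LINT (t, x)|half_space. u t x * adjoint_operator \<sigma> \<sigma>\<^sub>1 \<sigma>\<^sub>2 ?\<psi> t x)"
    unfolding eq by blast+
  show int': "integrable half_space (\<lambda>z. U z powr p * test_fun q T R z)"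
    using int by (simp only: complex_of_real_integrable_eq)
  obtain K where "has_bochner_integral lborel (scaled_weight q R :: real^'n \<Rightarrow> real) (K * R powr CARD('n))"
    using has_bochner_integral_scaled_weight[OF q] R by blast
  from has_bochner_integral_slab_weight[OF this, of T] T
  have slab: "integrable half_space (slab_weight q T R :: real \<times> (real^'n) \<Rightarrow> real)"
    by (simp add: has_bochner_integral_iff)
  have "integrable half_space (\<lambda>z. U z powr p * test_fun q T R z / p + A powr r * slab_weight q T R z / r)"
    using int' slab by (intro Bochner_Integration.integrable_add) auto
  then show intd: "integrable half_space (\<lambda>z. U z * (A * dual_fun p q T R z))"
  proof (rule Bochner_Integration.integrable_bound)
    show "AE z in half_space. norm (U z * (A * dual_fun p q T R z)) \<le> norm (U z powr p * test_fun q T R z / p + A powr r * slab_weight q T R z / r)"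
    proof (intro AE_I2)
      fix z :: "real \<times> (real^'n)"
      have "norm (U z * (A * dual_fun p q T R z)) = U z * (A * dual_fun p q T R z)"
        using A by (simp add: U_def dual_fun_nonneg)
      also have "\<dots> \<le> U z powr p * test_fun q T R z / p + A powr r * slab_weight q T R z / r"
        using p A T by (intro Young_dual_fun) (auto simp: U_def)
      finally show "norm (U z * (A * dual_fun p q T R z)) \<le> norm (U z powr p * test_fun q T R z / p + A powr r * slab_weight q T R z / r)"
        by simp
    qed
  qed measurable
  have "cutoff 1 T 0 = exp (- 1)" using T by (simp add: cutoff_def)
  then have "(LINT x|lebesgue. complex_of_real (u1 x) * ?\<psi> 0 x) = (LINT x|lebesgue. complex_of_real (exp (- 1) * (u1 x * scaled_weight q R x)))"
    by (intro Bochner_Integration.integral_cong) auto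
  also have "\<dots> = of_real (exp (- 1) * (LINT x|lebesgue. u1 x * scaled_weight q R x))"
    by (simp only: integral_complex_of_real integral_mult_right_zero)
  finally have initial: "(LINT x|lebesgue. complex_of_real (u1 x) * ?\<psi> 0 x) =
      of_real (exp (- 1) * (LINT x|lebesgue. u1 x * scaled_weight q R x))" .
  have eqn: "complex_of_real ((LINT z|half_space. U z powr p * test_fun q T R z) + \<epsilon> * exp (- 1) * (LINT x|lebesgue. u1 x * scaled_weight q R x))
     = (LINT (t, x)|half_space. u t x * adjoint_operator \<sigma> \<sigma>\<^sub>1 \<sigma>\<^sub>2 ?\<psi> t x)"
    using ident[unfolded integral_complex_of_real initial] by (simp only: of_real_add of_real_mult mult.assoc)
  have "(LINT z|half_space. U z powr p * test_fun q T R z) + \<epsilon> * exp (- 1) * (LINT x|lebesgue. u1 x * scaled_weight q R x)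
     \<le> norm (LINT (t, x)|half_space. u t x * adjoint_operator \<sigma> \<sigma>\<^sub>1 \<sigma>\<^sub>2 ?\<psi> t x)"
    by (simp only: norm_of_real abs_ge_self flip: eqn)
  also have "\<dots> \<le> (LINT z|half_space. norm (case z of (t, x) \<Rightarrow> u t x * adjoint_operator \<sigma> \<sigma>\<^sub>1 \<sigma>\<^sub>2 ?\<psi> t x))"
    by (rule integral_norm_bound)
  \<comment> \<open>\<open>integral_mono'\<close> asks for integrability of the nonnegative majorant
    only: a non-integrable smaller function has integral 0, for which the bound is true as
    well.\<close>
  also have "\<dots> \<le> (LINT z|half_space. U z * (A * dual_fun p q T R z))"
  proof (rule integral_mono'[OF intd])
    fix z :: "real \<times> (real^'n)"
    obtain t x where z: "z = (t, x)" by (cases z)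
    show "norm (case z of (t, x) \<Rightarrow> u t x * adjoint_operator \<sigma> \<sigma>\<^sub>1 \<sigma>\<^sub>2 ?\<psi> t x) \<le> U z * (A * dual_fun p q T R z)"
      unfolding z U_def prod.case fst_conv snd_conv norm_mult by (intro mult_left_mono bound norm_ge_zero)
    show "0 \<le> U z * (A * dual_fun p q T R z)" using A by (simp add: U_def dual_fun_nonneg)
  qed
  finally show "(LINT z|half_space. U z powr p * test_fun q T R z) + \<epsilon> * exp (- 1) * (LINT x|lebesgue. u1 x * scaled_weight q R x)
       \<le> (LINT z|half_space. U z * (A * dual_fun p q T R z))" .
qed

section \<open>The initial datum tested with the dilated weight\<close>

lemma integrable_mult_scaled_weight:
  fixes u1 :: "real^'n \<Rightarrow> real"
  assumes "Lp_fun m u1" "m \<ge> 1" "q > real CARD('n) / 2" "R > 0"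
  shows "integrable lebesgue (\<lambda>x. u1 x * scaled_weight q R x)"
proof -
  have q: "q > 0" using assms by (auto intro: le_less_trans[rotated])
  have u1: "u1 \<in> borel_measurable lebesgue" "integrable lebesgue (\<lambda>x. norm (u1 x) powr m)"
    using assms(1) by (auto simp: Lp_fun_def)
  have w: "scaled_weight q R \<in> borel_measurable (lebesgue :: (real^'n) measure)"
    by (intro measurable_completion) simp
  have "integrable lborel (scaled_weight q R :: real^'n \<Rightarrow> real)"
    using has_bochner_integral_scaled_weight[OF assms(3)] assms(4) by (auto simp: has_bochner_integral_iff)
  then have "integrable lebesgue (scaled_weight q R :: real^'n \<Rightarrow> real)"
    by (simp add: integrable_completion)
  then have "integrable lebesgue (\<lambda>x. norm (u1 x) powr m + scaled_weight q R x)"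
    using u1 by (intro Bochner_Integration.integrable_add) auto
  then show ?thesis
  proof (rule Bochner_Integration.integrable_bound)
    show "(\<lambda>x. u1 x * scaled_weight q R x) \<in> borel_measurable lebesgue"
      using u1(1) w by (rule borel_measurable_times)
    show "AE x in lebesgue. norm (u1 x * scaled_weight q R x) \<le> norm (norm (u1 x) powr m + scaled_weight q R x)"
    proof (intro AE_I2)
      fix x :: "real^'n"
      have w: "0 \<le> scaled_weight q R x" "scaled_weight q R x \<le> 1"
        using assms q by (auto intro: scaled_weight_nonneg scaled_weight_le_1)
      \<comment> \<open>A split at |u1| = 1 in place of Hoelder's inequality: the weight dominates
        below, |u1|^m above, because the weight is at most 1 and m >= 1.\<close>
      have "\<bar>u1 x\<bar> * scaled_weight q R x \<le> \<bar>u1 x\<bar> powr m + scaled_weight q R x"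
      proof (cases "\<bar>u1 x\<bar> \<le> 1")
        case True
        have "\<bar>u1 x\<bar> * scaled_weight q R x \<le> 1 * scaled_weight q R x"
          using True w by (intro mult_right_mono) auto
        then show ?thesis by (simp add: add_increasing)
      next
        case False
        have "\<bar>u1 x\<bar> * scaled_weight q R x \<le> \<bar>u1 x\<bar> * 1"
          using w by (intro mult_left_mono) auto
        also have "\<bar>u1 x\<bar> * 1 = \<bar>u1 x\<bar> powr 1" by simp
        also have "\<dots> \<le> \<bar>u1 x\<bar> powr m" using False assms(2) by (intro powr_mono) auto
        finally show ?thesis using w by simp
      qed
      then show "norm (u1 x * scaled_weight q R x) \<le> norm (norm (u1 x) powr m + scaled_weight q R x)"
        using w by (simp add: abs_mult)
    qed
  qed
qed

text \<open>On the ball of radius R the bracket is at most sqrt 2 times R, the logarithm at most its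
  value at R, and the dilated weight at least 2^(-q); so the integrand exceeds a multiple of
  R^(-n/m)/ln (e+R), and the volume contributes R^n. Outside the ball the integrand is nonnegative,
  since the assumption forces u1 >= 0 almost everywhere.\<close>

lemma scaled_weight_integral_lower_bound:
  fixes u1 :: "real^'n \<Rightarrow> real"
  assumes "m > 1" "q > real CARD('n) / 2" "Lp_fun m u1"
    and u1: "AE x in lebesgue. u1 x \<ge> japanese_bracket x powr (- real CARD('n) / m) * inverse (ln (exp 1 + norm x))"
  shows "\<exists>c>0. \<forall>R\<ge>1. c * (R powr (CARD('n) - CARD('n) / m) / ln (exp 1 + R)) \<le> (LINT x|lebesgue. u1 x * scaled_weight q R x)"
proof -
  define k where "k = real CARD('n)"
  have q: "q > 0" using assms(2) by (auto intro: le_less_trans[rotated])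
  \<comment> \<open>The first factor is (sqrt 2)^(-n/m), from the bracket; the second is the lower
    bound of the dilated weight.\<close>
  define a where "a = 2 powr (- (k / m) / 2) * 2 powr (- q)"
  define c where "c = a * unit_ball_vol k"
  have "a > 0" by (simp add: a_def)
  then have "c > 0" by (simp add: c_def k_def)
  have "c * (R powr (k - k / m) / ln (exp 1 + R)) \<le> (LINT x|lebesgue. u1 x * scaled_weight q R x)" if R: "R \<ge> 1" for R
  proof -
    define l where "l = ln (exp 1 + R)"
    have e1: "exp 1 + y > 1" if "y \<ge> 0" for y :: real
      using exp_gt_one[of "1::real"] that by linarith
    have l: "l > 0" unfolding l_def using e1[of R] R by (intro ln_gt_zero) auto
    define v where "v = a * R powr (- (k / m)) / l"
    have v: "v \<ge> 0" using \<open>a > 0\<close> l by (simp add: v_def)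
    have "measure lebesgue (cball (0::real^'n) R) = unit_ball_vol k * R ^ CARD('n)"
      using content_cball[of R "0::real^'n"] R by (simp add: k_def)
    also have "R ^ CARD('n) = R powr k" using R by (simp add: k_def powr_realpow)
    finally have "(LINT x|lebesgue. indicator (cball (0::real^'n) R) x * v) = v * (unit_ball_vol k * R powr k)"
      by simp
    also have "\<dots> = c * (R powr (- (k / m)) * R powr k / l)"
      by (simp add: v_def c_def)
    also have "R powr (- (k / m)) * R powr k = R powr (k - k / m)"
      by (simp add: powr_add[symmetric])
    finally have I: "(LINT x|lebesgue. indicator (cball (0::real^'n) R) x * v) = c * (R powr (k - k / m) / l)" .
    have "(LINT x|lebesgue. indicator (cball (0::real^'n) R) x * v) \<le> (LINT x|lebesgue. u1 x * scaled_weight q R x)"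
    proof (rule integral_mono_AE)
      show "integrable lebesgue (\<lambda>x. u1 x * scaled_weight q R x)"
        using assms R by (intro integrable_mult_scaled_weight[of m]) auto
      show "integrable lebesgue (\<lambda>x. indicator (cball (0::real^'n) R) x * v)"
        using emeasure_bounded_finite[OF bounded_cball, of "0::real^'n" R]
        by (intro integrable_mult_left integrable_real_indicator) (auto simp: top.not_eq_extremum)
      show "AE x in lebesgue. indicator (cball (0::real^'n) R) x * v \<le> u1 x * scaled_weight q R x"
        using u1
      proof eventually_elim
        case (elim x)
        have "1 + (norm x)\<^sup>2 > 0" by (intro add_pos_nonneg) auto
        then have J: "japanese_bracket x > 0" by (simp add: japanese_bracket_def)
        have lx: "ln (exp 1 + norm x) > 0" using e1[of "norm x"] by (intro ln_gt_zero) auto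
        have "japanese_bracket x powr (- real CARD('n) / m) * inverse (ln (exp 1 + norm x)) \<ge> 0"
          using lx by simp
        then have u0: "u1 x \<ge> 0" using elim by linarith
        show ?case
        proof (cases "norm x \<le> R")
          case False
          then show ?thesis using u0 scaled_weight_nonneg[of q R x] by simp
        next
          case True
          then have sq: "(norm x)\<^sup>2 \<le> R\<^sup>2" "1 \<le> R\<^sup>2" using R by (auto intro: power_mono)
          have "japanese_bracket x \<le> (2 * R\<^sup>2) powr (1 / 2)"
            unfolding japanese_bracket_def using sq by (intro powr_mono2) auto
          also have "\<dots> = 2 powr (1 / 2) * R" using R by (simp add: powr_mult powr_half_sqrt)
          finally have "(2 powr (1 / 2) * R) powr (- (k / m)) \<le> japanese_bracket x powr (- (k / m))"
            using assms(1) J by (intro powr_mono2') (auto simp: k_def)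
          then have 1: "2 powr (- (k / m) / 2) * R powr (- (k / m)) \<le> japanese_bracket x powr (- real CARD('n) / m)"
            using R by (simp add: powr_mult powr_powr k_def mult.commute[of m])
          have "ln (exp 1 + norm x) \<le> l" unfolding l_def using True e1[of "norm x"] by (subst ln_le_cancel_iff) auto
          then have 2: "1 / l \<le> inverse (ln (exp 1 + norm x))"
            using lx by (simp add: inverse_eq_divide frac_le)
          have "(norm x / R)\<^sup>2 \<le> 1" using True R by (simp add: power_le_one)
          then have 3: "2 powr (- q) \<le> scaled_weight q R x"
            using R q by (subst scaled_weight_eq) (auto intro!: powr_mono2' simp: add_pos_nonneg)
          have "v = (2 powr (- (k / m) / 2) * R powr (- (k / m))) * (1 / l) * 2 powr (- q)"
            by (simp add: v_def a_def)
          also have "\<dots> \<le> japanese_bracket x powr (- real CARD('n) / m) * inverse (ln (exp 1 + norm x)) * scaled_weight q R x"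
            using l lx by (intro mult_mono 1 2 3) auto
          also have "\<dots> \<le> u1 x * scaled_weight q R x"
            by (intro mult_right_mono elim scaled_weight_nonneg)
          finally show ?thesis using True by simp
        qed
      qed
    qed
    then show ?thesis unfolding I l_def .
  qed
  then show ?thesis using \<open>c > 0\<close> unfolding k_def by blast
qed

lemma scaled_weight_integral_tendsto:
  fixes u1 :: "real^'n \<Rightarrow> real"
  assumes "Lp_fun 1 u1" "q \<ge> 0"
  shows "(\<lambda>n. LINT x|lebesgue. u1 x * scaled_weight q (real (Suc n)) x) \<longlonglongrightarrow> (LINT x|lebesgue. u1 x)"
proof (rule integral_dominated_convergence[where w = "\<lambda>x. \<bar>u1 x\<bar>"])
  show u1: "u1 \<in> borel_measurable lebesgue" using assms by (auto simp: Lp_fun_def)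
  show "integrable lebesgue (\<lambda>x. \<bar>u1 x\<bar>)" using assms by (simp add: Lp_fun_def)
  have w: "scaled_weight q R \<in> borel_measurable (lebesgue :: (real^'n) measure)" for R
    by (intro measurable_completion) simp
  show "(\<lambda>x. u1 x * scaled_weight q (real (Suc n)) x) \<in> borel_measurable lebesgue" for n
    using u1 w by (rule borel_measurable_times)
  show "AE x in lebesgue. (\<lambda>n. u1 x * scaled_weight q (real (Suc n)) x) \<longlonglongrightarrow> u1 x"
    using tendsto_mult[OF tendsto_const scaled_weight_tendsto] by fastforce
  show "AE x in lebesgue. norm (u1 x * scaled_weight q (real (Suc n)) x) \<le> \<bar>u1 x\<bar>" for n
  proof (intro AE_I2)
    fix x :: "real^'n"
    have "\<bar>u1 x\<bar> * scaled_weight q (real (Suc n)) x \<le> \<bar>u1 x\<bar> * 1"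
      using assms by (intro mult_left_mono scaled_weight_le_1) auto
    then show "norm (u1 x * scaled_weight q (real (Suc n)) x) \<le> \<bar>u1 x\<bar>"
      by (simp add: abs_mult abs_of_nonneg[OF scaled_weight_nonneg])
  qed
qed

section \<open>Arithmetic of the exponents\<close>

lemma exponent_bound:
  fixes k m \<sigma> \<sigma>\<^sub>1 p :: real
  assumes "m \<ge> 1" "p > 1" "\<sigma> > 0" "k > 2 * m * \<sigma>\<^sub>1 \<Longrightarrow> p \<le> 1 + 2 * m * \<sigma> / (k - 2 * m * \<sigma>\<^sub>1)"
  shows "k / m - 2 * \<sigma>\<^sub>1 \<le> 2 * \<sigma> / (p - 1)"
proof (cases "k > 2 * m * \<sigma>\<^sub>1")
  case True
  then have "(p - 1) * (k - 2 * m * \<sigma>\<^sub>1) \<le> 2 * m * \<sigma>"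
    using assms(4)[OF True] by (simp add: field_simps)
  then have "(p - 1) * (k / m - 2 * \<sigma>\<^sub>1) \<le> 2 * \<sigma>"
    using assms(1) by (simp add: field_simps)
  then show ?thesis using assms(2) by (simp add: field_simps)
next
  case False
  then have "k / m - 2 * \<sigma>\<^sub>1 \<le> 0" using assms(1) by (simp add: field_simps)
  also have "0 \<le> 2 * \<sigma> / (p - 1)" using assms by simp
  finally show ?thesis .
qed

lemma exponent_bound_strict:
  fixes k m \<sigma> \<sigma>\<^sub>1 p :: real
  assumes "m \<ge> 1" "p > 1" "\<sigma> > 0" "k > 2 * m * \<sigma>\<^sub>1 \<Longrightarrow> p < 1 + 2 * m * \<sigma> / (k - 2 * m * \<sigma>\<^sub>1)"
  shows "k / m - 2 * \<sigma>\<^sub>1 < 2 * \<sigma> / (p - 1)"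
proof (cases "k > 2 * m * \<sigma>\<^sub>1")
  case True
  then have "(p - 1) * (k - 2 * m * \<sigma>\<^sub>1) < 2 * m * \<sigma>"
    using assms(4)[OF True] by (simp add: field_simps)
  then have "(p - 1) * (k / m - 2 * \<sigma>\<^sub>1) < 2 * \<sigma>"
    using assms(1) by (simp add: field_simps)
  then show ?thesis using assms(2) by (simp add: field_simps)
next
  case False
  then have "k / m - 2 * \<sigma>\<^sub>1 \<le> 0" using assms(1) by (simp add: field_simps)
  also have "0 < 2 * \<sigma> / (p - 1)" using assms by simp
  finally show ?thesis .
qed

theorem theorem1p3:
  fixes u1 :: "real^'n \<Rightarrow> real"
    and m \<sigma> \<sigma>\<^sub>1 \<sigma>\<^sub>2 \<epsilon> p :: real
  assumes "m \<ge> 1" and "\<sigma> \<ge> 1"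
    and "0 \<le> \<sigma>\<^sub>1" and "\<sigma>\<^sub>1 < \<sigma> / 2" and "\<sigma> / 2 < \<sigma>\<^sub>2" and "\<sigma>\<^sub>2 \<le> \<sigma>"
    and "\<epsilon> > 0"
    and "Lp_fun m u1"
    and "m = 1 \<Longrightarrow> (LINT x|lebesgue. u1 x) > 0"
    and "m > 1 \<Longrightarrow> AE x in lebesgue.
           u1 x \<ge> japanese_bracket x powr (- real CARD('n) / m) * inverse (ln (exp 1 + norm x))"
    and "1 < p"
    and "m = 1 \<Longrightarrow> real CARD('n) > 2 * \<sigma>\<^sub>1 \<Longrightarrow> p \<le> 1 + 2 * \<sigma> / (real CARD('n) - 2 * \<sigma>\<^sub>1)"
    and "m > 1 \<Longrightarrow> real CARD('n) > 2 * m * \<sigma>\<^sub>1 \<Longrightarrow>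
           p < 1 + 2 * m * \<sigma> / (real CARD('n) - 2 * m * \<sigma>\<^sub>1)"
  shows "\<not> (\<exists>u :: real \<Rightarrow> real^'n \<Rightarrow> complex. global_weak_solution \<sigma> \<sigma>\<^sub>1 \<sigma>\<^sub>2 p \<epsilon> u1 u)"
proof
  assume "\<exists>u :: real \<Rightarrow> real^'n \<Rightarrow> complex. global_weak_solution \<sigma> \<sigma>\<^sub>1 \<sigma>\<^sub>2 p \<epsilon> u1 u"
  then obtain u :: "real \<Rightarrow> real^'n \<Rightarrow> complex" where u: "global_weak_solution \<sigma> \<sigma>\<^sub>1 \<sigma>\<^sub>2 p \<epsilon> u1 u" ..
  define k where "k = real CARD('n)"
  define r where "r = p / (p - 1)"
  have r: "r > 1" "1 / p + 1 / r = 1" using \<open>1 < p\<close> by (auto simp: r_def field_simps)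
  \<comment> \<open>The smallest positive number among the three exponents, hence the largest
    admissible tail parameter.\<close>
  define b where "b = (if \<sigma>\<^sub>1 = 0 then \<sigma>\<^sub>2 else \<sigma>\<^sub>1)"
  have b: "b > 0" "\<sigma>\<^sub>1 = 0 \<or> b \<le> \<sigma>\<^sub>1" "b \<le> \<sigma>\<^sub>2" "b \<le> \<sigma>" "\<sigma>\<^sub>1 \<le> \<sigma>\<^sub>2"
    using assms(2-6) by (auto simp: b_def)
  define q where "q = real CARD('n) / 2 + b"
  have q: "q > real CARD('n) / 2" "q \<ge> 0" using b(1) by (auto simp: q_def)
  define T where "T R = R powr (2 * (\<sigma> - \<sigma>\<^sub>1))" for R
  have T: "T R > 0" if "R \<ge> 1" for R using that by (simp add: T_def)
  obtain C where C: "C \<ge> 0" "\<And>R t x::real^'n. R \<ge> 1 \<Longrightarrow>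
     norm (adjoint_operator \<sigma> \<sigma>\<^sub>1 \<sigma>\<^sub>2 (\<lambda>t x. complex_of_real (cutoff 1 (T R) t * scaled_weight q R x)) t x) \<le>
      C * R powr (- 2 * \<sigma>) * cutoff 1 (T R) t powr (1 / p) * scaled_weight q R x"
    using adjoint_operator_test_bound[OF assms(11) b(1-4) assms(4) b(5), where 'n = 'n] unfolding q_def T_def by blast
  obtain K where K: "K \<ge> 0" "\<And>R. R > 0 \<Longrightarrow> has_bochner_integral lborel (scaled_weight q R :: real^'n \<Rightarrow> real) (K * R powr CARD('n))"
    using has_bochner_integral_scaled_weight[OF q(1)] by blast
  define A where "A R = C * R powr (- 2 * \<sigma>)" for R
  have A: "A R \<ge> 0" for R using C(1) by (simp add: A_def)
  define U where "U z = norm (u (fst z) (snd z))" for z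
  have U0: "U z \<ge> 0" for z by (simp add: U_def)
  have Um: "U \<in> borel_measurable half_space"
    unfolding U_def[abs_def] using u by (intro continuous_L2_curve_measurable) (simp add: global_weak_solution_def weak_solution_def)
  define I where "I R = (LINT z|half_space. U z powr p * test_fun q (T R) R z)" for R
  define J where "J R = (LINT z|half_space. U z * (A R * dual_fun p q (T R) R z))" for R
  define c where "c R = (LINT x|lebesgue. u1 x * scaled_weight q R x)" for R
  define \<epsilon>' where "\<epsilon>' = \<epsilon> * exp (- 1)"
  have \<epsilon>': "\<epsilon>' > 0" using \<open>\<epsilon> > 0\<close> by (simp add: \<epsilon>'_def)
  have test: "integrable half_space (\<lambda>z. U z powr p * test_fun q (T R) R z)"
      "integrable half_space (\<lambda>z. U z * (A R * dual_fun p q (T R) R z))"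
      "I R + \<epsilon>' * c R \<le> J R" if "R \<ge> 1" for R
  proof -
    have "norm (adjoint_operator \<sigma> \<sigma>\<^sub>1 \<sigma>\<^sub>2 (\<lambda>t x. complex_of_real (cutoff 1 (T R) t * scaled_weight q R x)) t x)
        \<le> A R * dual_fun p q (T R) R (t, x)" for t and x :: "real^'n"
      using C(2)[OF that, of t x] by (simp add: A_def dual_fun_def mult.assoc)
    note W = weak_solution_test_inequality[OF u \<open>1 < p\<close> r q(1) T[OF that] _ A this]
    show "integrable half_space (\<lambda>z. U z powr p * test_fun q (T R) R z)"
      "integrable half_space (\<lambda>z. U z * (A R * dual_fun p q (T R) R z))"
      "I R + \<epsilon>' * c R \<le> J R"
      using W that unfolding U_def I_def J_def c_def \<epsilon>'_def by auto
  qed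
  \<comment> \<open>The exponent of \<open>R\<close> in A^r T R^n: with r = 1 + 1/(p-1) the sum -2
    sigma r + 2 (sigma - sigma_1) + k takes this form.\<close>
  define E where "E = k - 2 * \<sigma>\<^sub>1 - 2 * \<sigma> / (p - 1)"
  have slab: "has_bochner_integral half_space (\<lambda>z::real \<times> (real^'n). A R powr r * slab_weight q (T R) R z) (C powr r * K * R powr E)"
    if "R \<ge> 1" for R
  proof -
    have "has_bochner_integral half_space (\<lambda>z::real \<times> (real^'n). A R powr r * slab_weight q (T R) R z) (A R powr r * (T R * (K * R powr CARD('n))))"
      using K(2)[of R] T[OF that] that
      by (intro has_bochner_integral_mult_right has_bochner_integral_slab_weight) auto
    also have "A R powr r * (T R * (K * R powr CARD('n))) = C powr r * K * (R powr (- 2 * \<sigma> * r) * R powr (2 * (\<sigma> - \<sigma>\<^sub>1)) * R powr k)"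
      using C(1) by (simp add: A_def T_def powr_mult powr_powr k_def)
    also have "R powr (- 2 * \<sigma> * r) * R powr (2 * (\<sigma> - \<sigma>\<^sub>1)) * R powr k = R powr E"
    proof -
      have "r = 1 + 1 / (p - 1)" using \<open>1 < p\<close> by (simp add: r_def field_simps)
      then have "- 2 * \<sigma> * r + 2 * (\<sigma> - \<sigma>\<^sub>1) + k = E"
        by (simp add: E_def algebra_simps)
      then show ?thesis by (simp only: powr_add[symmetric])
    qed
    finally show ?thesis .
  qed
  define M where "M = C powr r * K / r"
  \<comment> \<open>Young's inequality returns the fraction I/p of the nonlinear term, which the
    left-hand side absorbs because p > 1.\<close>
  have main: "(1 - 1 / p) * I R + \<epsilon>' * c R \<le> M * R powr E" if R: "R \<ge> 1" for R
  proof -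
    have "J R \<le> (LINT z|half_space. U z powr p * test_fun q (T R) R z / p + A R powr r * slab_weight q (T R) R z / r)"
      unfolding J_def
    proof (rule integral_mono')
      show "integrable half_space (\<lambda>z. U z powr p * test_fun q (T R) R z / p + A R powr r * slab_weight q (T R) R z / r)"
        using test(1)[OF R] slab[OF R] by (intro Bochner_Integration.integrable_add integrable_divide) (auto simp: has_bochner_integral_iff)
      fix z
      show "U z * (A R * dual_fun p q (T R) R z) \<le> U z powr p * test_fun q (T R) R z / p + A R powr r * slab_weight q (T R) R z / r"
        using r \<open>1 < p\<close> A U0 T[OF R] by (intro Young_dual_fun) auto
      show "0 \<le> U z powr p * test_fun q (T R) R z / p + A R powr r * slab_weight q (T R) R z / r"
        using r \<open>1 < p\<close> T[OF R] by (intro add_nonneg_nonneg divide_nonneg_pos mult_nonneg_nonneg test_fun_nonneg slab_weight_nonneg) auto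
    qed
    also have "\<dots> = I R / p + C powr r * K * R powr E / r"
      using test(1)[OF R] slab[OF R] unfolding I_def has_bochner_integral_iff
      by (subst Bochner_Integration.integral_add) auto
    finally show ?thesis using test(3)[OF R] by (simp add: M_def algebra_simps)
  qed
  have p': "1 - 1 / p > 0" using \<open>1 < p\<close> by simp
  have I0: "I R \<ge> 0" if "R \<ge> 1" for R
    unfolding I_def using T[OF that] by (intro Bochner_Integration.integral_nonneg mult_nonneg_nonneg test_fun_nonneg) auto
  show False
  proof (cases "m = 1")
    case False
    then have m: "m > 1" using \<open>m \<ge> 1\<close> by simp
    obtain c0 where c0: "c0 > 0" "\<And>R. R \<ge> 1 \<Longrightarrow> c0 * (R powr (k - k / m) / ln (exp 1 + R)) \<le> c R"
      using scaled_weight_integral_lower_bound[OF m q(1) assms(8) assms(10)[OF m]] unfolding c_def k_def by blast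
    \<comment> \<open>The growth of the datum term minus that of the Young error, without the
      logarithm; it equals 2 sigma/(p-1) - (k/m - 2 sigma_1).\<close>
    define d where "d = k - k / m - E"
    have d: "d > 0"
      using exponent_bound_strict[OF assms(1,11) _ assms(13)[OF m]] assms(2) by (simp add: d_def E_def k_def)
    have le: "\<epsilon>' * c0 * (R powr d / ln (exp 1 + R)) \<le> M" if R: "R \<ge> 1" for R
    proof -
      have "\<epsilon>' * (c0 * (R powr (k - k / m) / ln (exp 1 + R))) \<le> \<epsilon>' * c R"
        using \<epsilon>' by (intro mult_left_mono c0 R) auto
      also have "\<dots> \<le> (1 - 1 / p) * I R + \<epsilon>' * c R"
        using p' I0[OF R] by simp
      also have "\<dots> \<le> M * R powr E" by (rule main[OF R])
      finally have "\<epsilon>' * (c0 * (R powr (k - k / m) / ln (exp 1 + R))) / R powr E \<le> M"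
        using R by (subst pos_divide_le_eq) auto
      moreover have "R powr d = R powr (k - k / m) / R powr E" by (simp add: d_def powr_diff)
      ultimately show ?thesis by (simp add: mult_ac)
    qed
    have "filterlim (\<lambda>R. R powr d / ln (exp 1 + R)) at_top at_top"
      using d by real_asymp
    then have "filterlim (\<lambda>R. \<epsilon>' * c0 * (R powr d / ln (exp 1 + R))) at_top at_top"
      using \<epsilon>' c0(1) by (intro filterlim_tendsto_pos_mult_at_top[OF tendsto_const]) auto
    then have "\<forall>\<^sub>F R in at_top. \<epsilon>' * c0 * (R powr d / ln (exp 1 + R)) > M"
      by (simp add: filterlim_at_top_dense)
    moreover have "\<forall>\<^sub>F R in at_top. (R::real) \<ge> 1" by (rule eventually_ge_at_top)
    ultimately have "\<forall>\<^sub>F R::real in at_top. False"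
      by eventually_elim (use le in force)
    then show False by simp
  next
    case True
    define N where "N n = real (Suc n)" for n
    have N: "N n \<ge> 1" for n by (simp add: N_def)
    have "Lp_fun 1 u1" using assms(8) True by simp
    then have clim: "(\<lambda>n. c (N n)) \<longlonglongrightarrow> (LINT x|lebesgue. u1 x)"
      unfolding c_def N_def using q(2) by (rule scaled_weight_integral_tendsto)
    have pos: "(LINT x|lebesgue. u1 x) > 0" using assms(9) True by simp
    \<comment> \<open>At the critical exponent E = 0, and then \<open>main\<close> yields only a
      uniform bound.\<close>
    have "E \<le> 0"
      using exponent_bound[where m = 1 and p = p and \<sigma> = \<sigma> and k = k and \<sigma>\<^sub>1 = \<sigma>\<^sub>1] assms(2,11,12) True by (simp add: E_def k_def)
    then have RE: "N n powr E \<le> 1" for n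
      using powr_mono[of E 0 "N n"] N[of n] by simp
    have "M \<ge> 0" using K(1) r by (simp add: M_def)
    have "\<forall>\<^sub>F n in sequentially. c (N n) > 0" using order_tendstoD(1)[OF clim pos] .
    then have Ibd: "\<forall>\<^sub>F n in sequentially. I (N n) \<le> M / (1 - 1 / p)"
    proof eventually_elim
      case (elim n)
      have "(1 - 1 / p) * I (N n) \<le> (1 - 1 / p) * I (N n) + \<epsilon>' * c (N n)"
        using elim \<epsilon>' by simp
      also have "\<dots> \<le> M * N n powr E" by (rule main[OF N])
      also have "\<dots> \<le> M * 1" using RE \<open>M \<ge> 0\<close> by (rule mult_left_mono)
      finally show ?case using p' by (simp add: pos_le_divide_eq mult.commute)
    qed
    have Nlim: "filterlim N at_top sequentially"
      unfolding N_def by real_asymp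
    then have Tlim: "filterlim (\<lambda>n. T (N n)) at_top sequentially"
      unfolding T_def using assms(2,3,4)
      by (intro filterlim_compose[OF real_powr_at_top Nlim]) auto
    have Up: "integrable half_space (\<lambda>z. U z powr p)"
    \<comment> \<open>The limit of the weights is 1/e times 1: the cut-off tends to its value at
      time 0 of the profile, the dilated weight to 1.\<close>
    proof (rule integrable_bounded_weights[where k = "\<lambda>n. test_fun q (T (N n)) (N n)" and c = "exp (- 1) * 1"])
      show "(\<lambda>z. U z powr p) \<in> borel_measurable half_space" using Um by measurable
      show "\<forall>\<^sub>F n in sequentially. (LINT z|half_space. U z powr p * test_fun q (T (N n)) (N n) z) \<le> M / (1 - 1 / p)"
        using Ibd unfolding I_def .
      show "(\<lambda>n. test_fun q (T (N n)) (N n) z) \<longlonglongrightarrow> exp (- 1) * 1" for z :: "real \<times> (real^'n)"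
        unfolding test_fun_def using scaled_weight_tendsto[of q "snd z"] cutoff_tendsto[OF Tlim]
        by (intro tendsto_mult) (auto simp: N_def)
    qed (use T N test(1) in \<open>auto intro!: test_fun_nonneg\<close>)
    \<comment> \<open>The dual factor tends to 0 pointwise because A is a multiple of R^(-2 sigma),
      while its r-th power has integral at most C^r K R^E, which E <= 0 keeps bounded.\<close>
    have "(\<lambda>n. J (N n)) \<longlonglongrightarrow> 0"
      unfolding J_def
    proof (rule tendsto_integral_mult_0[where p = p and q = r and g = "\<lambda>n z. A (N n) powr r * slab_weight q (T (N n)) (N n) z" and K = "C powr r * K"])
      show "(\<lambda>z::real \<times> (real^'n). A (N n) * dual_fun p q (T (N n)) (N n) z) \<in> borel_measurable half_space" for n
        by (intro borel_measurable_half_space) measurable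
      show "(\<lambda>n. A (N n) * dual_fun p q (T (N n)) (N n) z) \<longlonglongrightarrow> 0" for z :: "real \<times> (real^'n)"
      proof (rule Lim_null_comparison)
        have "((\<lambda>n. N n powr (- 2 * \<sigma>)) \<longlongrightarrow> 0) sequentially"
          by (rule tendsto_neg_powr[OF _ Nlim]) (use assms(2) in auto)
        then show "((\<lambda>n. C * N n powr (- 2 * \<sigma>)) \<longlongrightarrow> 0) sequentially"
          by (rule tendsto_mult_right_zero)
        have "dual_fun p q (T (N n)) (N n) z \<le> 1" for n
        proof -
          have "dual_fun p q (T (N n)) (N n) z powr 1 \<le> slab_weight q (T (N n)) (N n) z"
            using T[OF N] N[of n] q(2) \<open>1 < p\<close> by (intro dual_fun_le_slab_weight) auto
          also have "\<dots> \<le> 1" using scaled_weight_le_1[of "N n" q "snd z"] N[of n] q(2)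
            by (auto simp: slab_weight_def indicator_def)
          finally show ?thesis by (simp add: dual_fun_nonneg)
        qed
        then show "\<forall>\<^sub>F n in sequentially. norm (A (N n) * dual_fun p q (T (N n)) (N n) z) \<le> C * N n powr (- 2 * \<sigma>)"
          unfolding A_def[symmetric]
          by (intro always_eventually) (auto simp: abs_mult dual_fun_nonneg abs_of_nonneg[OF A] intro!: mult_left_le A)
      qed
      show "integral\<^sup>L half_space (\<lambda>z::real \<times> (real^'n). A (N n) powr r * slab_weight q (T (N n)) (N n) z) \<le> C powr r * K" for n
        using slab[OF N, of n] mult_left_mono[OF RE[of n], of "C powr r * K"] K(1)
        by (simp add: has_bochner_integral_iff)
      show "(A (N n) * dual_fun p q (T (N n)) (N n) z) powr r \<le> A (N n) powr r * slab_weight q (T (N n)) (N n) z" for n and z :: "real \<times> (real^'n)"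
        using dual_fun_le_slab_weight[of "T (N n)" "N n" q p r z] T[OF N, of n] N[of n] q(2) \<open>1 < p\<close> r A dual_fun_nonneg
        by (simp add: powr_mult mult_left_mono)
    qed (use slab[OF N] r \<open>1 < p\<close> Up Um U0 A in \<open>auto simp: has_bochner_integral_iff dual_fun_nonneg\<close>)
    moreover have "(\<lambda>n. \<epsilon>' * c (N n)) \<longlonglongrightarrow> \<epsilon>' * (LINT x|lebesgue. u1 x)"
      by (intro tendsto_mult_left clim)
    \<comment> \<open>Here the tested inequality is used before Young's inequality, with only the
      nonnegative \<open>I\<close> dropped; the datum term keeps a positive limit while
      \<open>J\<close> tends to 0.\<close>
    moreover have "\<epsilon>' * c (N n) \<le> J (N n)" for n
      using test(3)[OF N, of n] I0[OF N, of n] by simp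
    ultimately have "\<epsilon>' * (LINT x|lebesgue. u1 x) \<le> 0"
      by (intro LIMSEQ_le[of _ _ "\<lambda>n. J (N n)"]) auto
    then show False using pos \<epsilon>' by (simp add: mult_le_0_iff)
  qed
qed

end
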